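(* Let $1<r<2$ and let $r'=r/(r-1)$ be the dual exponent. There is a constant $C_r>0$ such that the following holds. For every $\delta>0$ there is a constant $C_{r,\delta}>0$ such that, for every integer $y\ge 1$, setting $N_{r,y}=e^{C_{r,\delta}y^{\delta}}$, for all integers $N>N_{r,y}$ and all finitely supported $f:\mathbb Z\to\mathbb C$, $$\max_{1\le b\le y,\ (b,y)=1}\ \lVert A_{N,y,b}f\rVert_{\ell^{r'}(\mathbb Z)}\le C_r\Big(\frac{y}{N}\Big)^{\frac1r-\frac1{r'}}\lVert f\rVert_{\ell^r(\mathbb Z)}.$$
   Context: $\Lambda$ denotes the von Mangoldt function and $\phi$ the Euler totient function. For integers $y\ge1$, $b$ with $(b,y)=1$, $N\ge y$, and $f:\mathbb Z\to\mathbb C$, the average along primes in the progression $b \bmod y$ is $$A_{N,y,b}f(x)=\frac{\phi(y)}{N}\sum_{\substack{1\le n<N\\ n\equiv b \bmod y}}\Lambda(n)f(x-n),\qquad x\in\mathbb Z.$$ *)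

theory Defs
  imports "HOL-Analysis.Analysis" "HOL-Number_Theory.Number_Theory"
begin

definition prime_avg :: "nat \<Rightarrow> nat \<Rightarrow> nat \<Rightarrow> (int \<Rightarrow> complex) \<Rightarrow> int \<Rightarrow> complex" where
  "prime_avg N y b f x =
     complex_of_real (real (totient y) / real N) *
     (\<Sum>n \<in> {n. 1 \<le> n \<and> n < N \<and> [n = b] (mod y)}. mangoldt n * f (x - int n))"

text \<open>The l^p norm on Z of a finitely supported function (sum over its support).\<close>
definition lp_norm :: "real \<Rightarrow> (int \<Rightarrow> complex) \<Rightarrow> real" where
  "lp_norm p f = (\<Sum>x \<in> {x. f x \<noteq> 0}. cmod (f x) powr p) powr (1 / p)"

end

theory Submission
  imports Defs "HOL-Complex_Analysis.Conformal_Mappings" "HOL-Computational_Algebra.Squarefree"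
begin

text \<open>
  The averages are positive operators and only an upper bound is wanted, so \<open>\<Lambda>\<close> may be replaced by
  Selberg's upper bound sieve and no information on the distribution of primes is needed.
  With \<open>R\<close> a small power of \<open>N\<close> and \<open>S(n) = \<Sum> \<mu>(q) c\<^sub>q(n) / \<phi>(q)\<close>, summed over \<open>q \<le> R\<close> coprime to \<open>y\<close>,
  one has \<open>S(n) = G = \<Sum> \<mu>(q)\<^sup>2 / \<phi>(q)\<close> whenever \<open>n\<close> has no prime factor up to \<open>R\<close>, and
  \<open>G\<close> is at least of the order \<open>\<phi>(y) / y \<cdot> ln R\<close>; hence \<open>\<phi>(y) / y \<cdot> \<Lambda>\<close> is dominated by a multiple of
  \<open>S\<^sup>2 / G\<close>, apart from the powers of the few primes up to \<open>R\<close>.  Expanding the square gives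
  \<open>S\<^sup>2 / G = \<Sum> w(q) c\<^sub>q\<close> with \<open>w(q)\<close> essentially bounded by \<open>1 / q\<close>.

  Consider the part of this sum with \<open>q\<close> of size \<open>Q\<close>, along the progression.  By the large sieve it acts
  on \<open>\<ell>\<^sup>2\<close> with a gain of almost \<open>1 / Q\<close>; its moments of any order are bounded up to \<open>Q\<^sup>\<epsilon>\<close> because truncated
  divisor functions have small moments, which by Young's inequality gives an \<open>\<ell>\<^sup>p \<rightarrow> \<ell>\<^sup>p\<^sup>'\<close> bound for \<open>p\<close> close
  to \<open>1\<close>.  Interpolating between the two leaves a negative power of \<open>Q\<close>, and the dyadic pieces can be summed.
\<close>

section \<open>Interpolation and Young's inequality\<close>

text \<open>The overview does not say how much room there is. The range of \<open>N\<close> enters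
  only through \<open>y^2 <= N\<close> and \<open>2^(8 s) <= N\<close>, where \<open>s\<close> is an
  integer with \<open>s >= r/(r-1)\<close>. The progression then has at least about sqrt(N) terms,
  and \<open>R = N^(1/(16 s))\<close> keeps the product of any \<open>s\<close> moduli below its
  length. Since \<open>ln N / ln R\<close> is the constant \<open>16 s\<close>, the sieve loses only
  a constant factor, and the \<phi>(y)/y in the lower bound for \<open>G\<close> cancels the totient
  in the normalisation. Moments of order \<open>s\<close> put the kernel into l^s, and Young's
  inequality then acts on an exponent strictly below \<open>r\<close>. Hence the l^2 bound enters
  the interpolation with a positive weight \<theta>, and all losses of the form Q^\<epsilon> can be
  held below half of its gain. As the moduli are coprime to \<open>y\<close>, multiplying the
  frequencies by \<open>y\<close> keeps them apart, so the large sieve works along the progression.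
  These estimates concern bilinear forms on one interval of length about \<open>2 N / y\<close>,
  whereas the support of \<open>f\<close> may be much longer. The intervals are glued together by
  \<open>r/(r-1) >= r\<close>, each point of the support being covered at most twice.\<close>

lemma three_lines:
  fixes F :: "complex \<Rightarrow> complex"
  assumes hol: "F holomorphic_on UNIV"
    and bdd: "\<And>z. 0 \<le> Re z \<Longrightarrow> Re z \<le> 1 \<Longrightarrow> norm (F z) \<le> B"
    and left: "\<And>z. Re z = 0 \<Longrightarrow> norm (F z) \<le> A0"
    and right: "\<And>z. Re z = 1 \<Longrightarrow> norm (F z) \<le> A1"
    and pos: "A0 > 0" "A1 > 0" and \<theta>: "0 \<le> \<theta>" "\<theta> \<le> 1"
  shows "norm (F (of_real \<theta>)) \<le> A0 powr (1 - \<theta>) * A1 powr \<theta>"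
proof -
  \<comment> \<open>Dividing by \<open>A0^(1-z) * A1^z\<close> reduces both edge bounds to
    1.\<close>
  define H where "H z = F z * exp ((z - 1) * of_real (ln A0) - z * of_real (ln A1))" for z
  have normH: "norm (H z) = norm (F z) * exp ((Re z - 1) * ln A0 - Re z * ln A1)" for z
    by (simp add: H_def norm_mult)
  define B' where "B' = max 1 (B * exp (\<bar>ln A0\<bar> + \<bar>ln A1\<bar>))"
  have B0: "B \<ge> 0" using order_trans[OF norm_ge_zero bdd[of 0]] by simp
  have HB: "norm (H z) \<le> B'" if "0 \<le> Re z" "Re z \<le> 1" for z
  proof -
    have 1: "(Re z - 1) * ln A0 \<le> \<bar>ln A0\<bar>"
    proof -
      have "\<bar>(Re z - 1) * ln A0\<bar> \<le> 1 * \<bar>ln A0\<bar>"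
        unfolding abs_mult using that by (intro mult_right_mono) auto
      then show ?thesis by linarith
    qed
    have 2: "- (Re z * ln A1) \<le> \<bar>ln A1\<bar>"
    proof -
      have "\<bar>Re z * ln A1\<bar> \<le> 1 * \<bar>ln A1\<bar>"
        unfolding abs_mult using that by (intro mult_right_mono) auto
      then show ?thesis by linarith
    qed
    have "norm (H z) \<le> B * exp (\<bar>ln A0\<bar> + \<bar>ln A1\<bar>)"
      unfolding normH using 1 2 B0 bdd[OF that] by (intro mult_mono) auto
    then show ?thesis by (simp add: B'_def)
  qed
  have H0: "norm (H z) \<le> 1" if "Re z = 0" for z
    using left[OF that] pos by (simp add: normH that exp_minus field_simps)
  have H1: "norm (H z) \<le> 1" if "Re z = 1" for z
    using right[OF that] pos by (simp add: normH that exp_minus field_simps)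
  have key: "norm (H (of_real \<theta>)) \<le> exp \<epsilon>" if "\<epsilon> > 0" for \<epsilon>
  proof -
    \<comment> \<open>On the strip the extra factor has modulus at most
      \<open>exp (- \<epsilon> * (Im z)^2)\<close>, so it damps \<open>H\<close> far up and down;
      the maximum principle then applies on a rectangle.\<close>
    define E where "E z = H z * exp (of_real \<epsilon> * (z\<^sup>2 - 1))" for z
    have normE: "norm (E z) = norm (H z) * exp (\<epsilon> * ((Re z)\<^sup>2 - (Im z)\<^sup>2 - 1))" for z
      by (simp add: E_def norm_mult Re_power2)
    \<comment> \<open>This height makes the damping on the horizontal sides at most
      \<open>exp (- B')\<close>, and \<open>B' * exp (- B') <= 1\<close>.\<close>
    define T where "T = sqrt (B' / \<epsilon>)"
    have "B' \<ge> 1" by (simp add: B'_def)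
    then have T: "T \<ge> 0" "\<epsilon> * T\<^sup>2 = B'" using that by (simp_all add: T_def)
    define S where "S = cbox (Complex 0 (-T)) (Complex 1 T)"
    have holE: "E holomorphic_on UNIV"
      unfolding E_def H_def by (intro holomorphic_intros hol) 
    have "norm (E (of_real \<theta>)) \<le> 1"
    proof (rule maximum_modulus_frontier[of E S])
      show "E holomorphic_on interior S" using holE holomorphic_on_subset by blast
      show "continuous_on (closure S) E"
        using holE holomorphic_on_imp_continuous_on continuous_on_subset by blast
      show "bounded S" by (simp add: S_def)
      show "of_real \<theta> \<in> S" using \<theta> T by (simp add: S_def in_cbox_complex_iff)
    next
      fix z assume "z \<in> frontier S"
      then have z: "z \<in> S" "z \<notin> box (Complex 0 (-T)) (Complex 1 T)"
        by (auto simp: S_def frontier_cbox)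
      then have zr: "0 \<le> Re z" "Re z \<le> 1" "\<bar>Im z\<bar> \<le> T"
        by (auto simp: S_def in_cbox_complex_iff)
      have zr2: "(Re z)\<^sup>2 \<le> 1" using zr by (simp add: power_le_one)
      consider "Re z = 0" | "Re z = 1" | "\<bar>Im z\<bar> = T"
        using z zr by (force simp: in_box_complex_iff)
      then show "norm (E z) \<le> 1"
      proof cases
        case 3
        then have "(Im z)\<^sup>2 = T\<^sup>2" by (metis power2_abs)
        then have "\<epsilon> * ((Re z)\<^sup>2 - (Im z)\<^sup>2 - 1) \<le> - B'"
          using T(2) zr2 that by (simp add: algebra_simps)
        then have "norm (E z) \<le> B' * exp (- B')"
          unfolding normE using HB[OF zr(1,2)] \<open>B' \<ge> 1\<close> by (intro mult_mono) auto
        also have "\<dots> \<le> 1" using exp_ge_add_one_self[of B'] by (simp add: exp_minus field_simps)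
        finally show ?thesis .
      next
        case 1
        have "\<epsilon> * ((Re z)\<^sup>2 - (Im z)\<^sup>2 - 1) \<le> 0"
          using zr2 that by (intro mult_nonneg_nonpos) (auto intro: order_trans[OF _ zr2])
        then show ?thesis unfolding normE using H0[OF 1] by (simp add: mult_le_one)
      next
        case 2
        have "\<epsilon> * ((Re z)\<^sup>2 - (Im z)\<^sup>2 - 1) \<le> 0"
          using zr2 that by (intro mult_nonneg_nonpos) (auto intro: order_trans[OF _ zr2])
        then show ?thesis unfolding normE using H1[OF 2] by (simp add: mult_le_one)
      qed
    qed
    then have "norm (H (of_real \<theta>)) * exp (\<epsilon> * (\<theta>\<^sup>2 - 1)) \<le> 1" by (simp add: normE)
    then have "norm (H (of_real \<theta>)) * exp (\<epsilon> * (\<theta>\<^sup>2 - 1)) * exp (\<epsilon> * (1 - \<theta>\<^sup>2)) \<le> 1 * exp (\<epsilon> * (1 - \<theta>\<^sup>2))"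
      by (intro mult_right_mono) auto
    moreover have "exp (\<epsilon> * (\<theta>\<^sup>2 - 1)) * exp (\<epsilon> * (1 - \<theta>\<^sup>2)) = 1"
      by (subst exp_add[symmetric]) (simp add: algebra_simps)
    ultimately have "norm (H (of_real \<theta>)) \<le> exp (\<epsilon> * (1 - \<theta>\<^sup>2))"
      by (simp add: mult.assoc)
    also have "\<dots> \<le> exp \<epsilon>" using that by (simp add: mult_le_cancel_left1)
    finally show ?thesis .
  qed
  \<comment> \<open>The limit \<epsilon> to 0: if the norm exceeded 1, half of its logarithm would
    be an \<epsilon> contradicting \<open>key\<close>.\<close>
  have "norm (H (of_real \<theta>)) \<le> 1"
  proof (rule ccontr)
    assume "\<not> ?thesis"
    then have gt1: "norm (H (of_real \<theta>)) > 1" by simp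
    then have "ln (norm (H (of_real \<theta>))) > 0" by (rule ln_gt_zero)
    then have "norm (H (of_real \<theta>)) \<le> exp (ln (norm (H (of_real \<theta>))) / 2)" by (intro key) simp
    moreover have "\<dots> < exp (ln (norm (H (of_real \<theta>))))"
      using \<open>ln (norm (H (of_real \<theta>))) > 0\<close> by (subst exp_less_cancel_iff) simp
    ultimately show False using gt1 exp_ln[of "norm (H (of_real \<theta>))"] by linarith
  qed
  then have "norm (F (of_real \<theta>)) \<le> inverse (exp ((\<theta> - 1) * ln A0 - \<theta> * ln A1))"
    by (simp add: normH field_simps)
  also have "\<dots> = A0 powr (1 - \<theta>) * A1 powr \<theta>"
    using pos by (simp add: powr_def exp_minus[symmetric] exp_add[symmetric] algebra_simps)
  finally show ?thesis .
qed

text \<open>Riesz-Thorin for a finite bilinear form, with one exponent family on both sides. For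
  vectors of l^r norm 1 the entries are raised to the complex power \<open>a z\<close>, affine in
  \<open>z\<close>: on the edge \<open>Re z = 0\<close> the moduli to the power \<open>p0\<close>
  are the original entries to the power \<open>r\<close>, on \<open>Re z = 1\<close> the same holds
  with \<open>p1\<close>, and \<open>a \<theta> = 1\<close>. The three lines theorem gives the
  normalised case, and scaling gives the rest.\<close>

lemma bilinear_interpolation:
  fixes K :: "'a \<Rightarrow> 'b \<Rightarrow> complex" and f :: "'b \<Rightarrow> real" and g :: "'a \<Rightarrow> real"
  assumes fin: "finite X" "finite Y"
    and L0: "\<And>f g. norm (\<Sum>x\<in>X. \<Sum>t\<in>Y. K x t * f t * g x) \<le>
        A0 * (\<Sum>t\<in>Y. norm (f t) powr p0) powr (1 / p0) * (\<Sum>x\<in>X. norm (g x) powr p0) powr (1 / p0)"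
    and L1: "\<And>f g. norm (\<Sum>x\<in>X. \<Sum>t\<in>Y. K x t * f t * g x) \<le>
        A1 * (\<Sum>t\<in>Y. norm (f t) powr p1) powr (1 / p1) * (\<Sum>x\<in>X. norm (g x) powr p1) powr (1 / p1)"
    and p: "p0 > 0" "p1 > 0" "r > 0" "1 / r = (1 - \<theta>) / p0 + \<theta> / p1"
    and pos: "A0 > 0" "A1 > 0" and \<theta>: "0 \<le> \<theta>" "\<theta> \<le> 1"
    and f: "\<And>t. t \<in> Y \<Longrightarrow> f t \<ge> 0" and g: "\<And>x. x \<in> X \<Longrightarrow> g x \<ge> 0"
  shows "norm (\<Sum>x\<in>X. \<Sum>t\<in>Y. K x t * of_real (f t) * of_real (g x)) \<le>
        A0 powr (1 - \<theta>) * A1 powr \<theta> *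
        (\<Sum>t\<in>Y. f t powr r) powr (1 / r) * (\<Sum>x\<in>X. g x powr r) powr (1 / r)"
proof -
  have normalised: "norm (\<Sum>x\<in>X. \<Sum>t\<in>Y. K x t * of_real (f t) * of_real (g x)) \<le> A0 powr (1 - \<theta>) * A1 powr \<theta>"
    if f: "\<And>t. t \<in> Y \<Longrightarrow> f t \<ge> 0" and g: "\<And>x. x \<in> X \<Longrightarrow> g x \<ge> 0"
      and sf: "(\<Sum>t\<in>Y. f t powr r) = 1" and sg: "(\<Sum>x\<in>X. g x powr r) = 1" for f g
  proof -
    define a where "a z = of_real r * ((1 - z) / of_real p0 + z / of_real p1)" for z :: complex
    have Re_a: "Re (a z) = r * ((1 - Re z) / p0 + Re z / p1)" for z
      by (simp add: a_def)
    \<comment> \<open>Zero entries are kept at 0, so that the power is entire in \<open>z\<close>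
      and no logarithm of 0 is involved.\<close>
    define P where "P u z = (if u = 0 then 0 else exp (a z * of_real (ln u)))" for u :: real and z
    have normP: "norm (P u z) = u powr Re (a z)" if "u \<ge> 0" for u z
      using that by (simp add: P_def powr_def)
    define F where "F z = (\<Sum>x\<in>X. \<Sum>t\<in>Y. K x t * P (f t) z * P (g x) z)" for z
    have "norm (F (of_real \<theta>)) \<le> A0 powr (1 - \<theta>) * A1 powr \<theta>"
    proof (rule three_lines)
      have "(\<lambda>z. P u z) holomorphic_on UNIV" for u
      proof (cases "u = 0")
        case False
        then show ?thesis unfolding P_def a_def using p by (auto intro!: holomorphic_intros)
      qed (simp add: P_def)
      then show "F holomorphic_on UNIV" unfolding F_def by (intro holomorphic_intros)
    next
      fix z :: complex assume z: "0 \<le> Re z" "Re z \<le> 1"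
      define c where "c u = exp (r * (1 / p0 + 1 / p1) * \<bar>ln u\<bar>)" for u :: real
      have cP: "norm (P u z) \<le> c u" if "u \<ge> 0" for u
      proof (cases "u = 0")
        case False
        have "0 \<le> Re (a z)" "Re (a z) \<le> r * (1 / p0 + 1 / p1)"
          unfolding Re_a using z p by (auto intro!: mult_left_mono add_mono divide_right_mono)
        then have "Re (a z) * ln u \<le> r * (1 / p0 + 1 / p1) * \<bar>ln u\<bar>"
          by (intro order_trans[OF mult_left_mono[OF abs_ge_self] mult_right_mono]) auto
        then show ?thesis using False that by (simp add: P_def c_def)
      qed (simp add: P_def c_def)
      have "norm (F z) \<le> (\<Sum>x\<in>X. \<Sum>t\<in>Y. norm (K x t * P (f t) z * P (g x) z))"
        unfolding F_def by (intro sum_norm_le order_refl norm_sum)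
      also have "\<dots> \<le> (\<Sum>x\<in>X. \<Sum>t\<in>Y. norm (K x t) * c (f t) * c (g x))"
        unfolding norm_mult using cP f g by (intro sum_mono mult_mono) (auto simp: c_def)
      finally show "norm (F z) \<le> (\<Sum>x\<in>X. \<Sum>t\<in>Y. norm (K x t) * c (f t) * c (g x))" .
    next
      fix z :: complex assume z: "Re z = 0"
      have *: "norm (P u z) powr p0 = u powr r" if "u \<ge> 0" for u
        using p z that by (simp add: normP Re_a powr_powr)
      have "norm (F z) \<le> A0 * (\<Sum>t\<in>Y. norm (P (f t) z) powr p0) powr (1 / p0) * (\<Sum>x\<in>X. norm (P (g x) z) powr p0) powr (1 / p0)"
        unfolding F_def by (rule L0)
      also have "(\<Sum>t\<in>Y. norm (P (f t) z) powr p0) = 1"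
        unfolding sf[symmetric] by (intro sum.cong * f refl)
      also have "(\<Sum>x\<in>X. norm (P (g x) z) powr p0) = 1"
        unfolding sg[symmetric] by (intro sum.cong * g refl)
      finally show "norm (F z) \<le> A0" by simp
    next
      fix z :: complex assume z: "Re z = 1"
      have *: "norm (P u z) powr p1 = u powr r" if "u \<ge> 0" for u
        using p z that by (simp add: normP Re_a powr_powr)
      have "norm (F z) \<le> A1 * (\<Sum>t\<in>Y. norm (P (f t) z) powr p1) powr (1 / p1) * (\<Sum>x\<in>X. norm (P (g x) z) powr p1) powr (1 / p1)"
        unfolding F_def by (rule L1)
      also have "(\<Sum>t\<in>Y. norm (P (f t) z) powr p1) = 1"
        unfolding sf[symmetric] by (intro sum.cong * f refl)
      also have "(\<Sum>x\<in>X. norm (P (g x) z) powr p1) = 1"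
        unfolding sg[symmetric] by (intro sum.cong * g refl)
      finally show "norm (F z) \<le> A1" by simp
    qed (use pos \<theta> in auto)
    moreover have "a (of_real \<theta>) = 1"
    proof -
      have "a (of_real \<theta>) = of_real (r * ((1 - \<theta>) / p0 + \<theta> / p1))" by (simp add: a_def)
      also have "r * ((1 - \<theta>) / p0 + \<theta> / p1) = 1" using p by (simp flip: p(4))
      finally show ?thesis by simp
    qed
    then have "P u (of_real \<theta>) = of_real u" if "u \<ge> 0" for u
      using that by (simp add: P_def exp_of_real)
    then have "F (of_real \<theta>) = (\<Sum>x\<in>X. \<Sum>t\<in>Y. K x t * of_real (f t) * of_real (g x))"
      unfolding F_def using f g by (intro sum.cong) auto
    ultimately show ?thesis by simp
  qed
  define nf where "nf = (\<Sum>t\<in>Y. f t powr r) powr (1 / r)"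
  define ng where "ng = (\<Sum>x\<in>X. g x powr r) powr (1 / r)"
  show ?thesis
  proof (cases "nf = 0 \<or> ng = 0")
    case True
    have "(\<forall>t\<in>Y. f t = 0) \<or> (\<forall>x\<in>X. g x = 0)"
      using True fin by (auto simp: nf_def ng_def sum_nonneg_eq_0_iff)
    then have "(\<Sum>x\<in>X. \<Sum>t\<in>Y. K x t * of_real (f t) * of_real (g x)) = 0"
      by (auto intro!: sum.neutral)
    then show ?thesis by simp
  next
    case False
    then have n: "nf > 0" "ng > 0" by (auto simp: nf_def ng_def)
    have nfr: "nf powr r = (\<Sum>t\<in>Y. f t powr r)" "ng powr r = (\<Sum>x\<in>X. g x powr r)"
      using p(3) by (auto simp: nf_def ng_def powr_powr sum_nonneg)
    have "nf powr r \<noteq> 0" "ng powr r \<noteq> 0" using n by auto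
    note nfr = nfr this[unfolded nfr]
    have 1: "(\<Sum>t\<in>Y. (f t / nf) powr r) = 1"
      using nfr n f by (simp add: powr_divide flip: sum_divide_distrib)
    have 2: "(\<Sum>x\<in>X. (g x / ng) powr r) = 1"
      using nfr n g by (simp add: powr_divide flip: sum_divide_distrib)
    have "norm (\<Sum>x\<in>X. \<Sum>t\<in>Y. K x t * of_real (f t / nf) * of_real (g x / ng)) \<le> A0 powr (1 - \<theta>) * A1 powr \<theta>"
      using n f g by (intro normalised 1 2) auto
    also have "(\<Sum>x\<in>X. \<Sum>t\<in>Y. K x t * of_real (f t / nf) * of_real (g x / ng)) =
        (\<Sum>x\<in>X. \<Sum>t\<in>Y. K x t * of_real (f t) * of_real (g x)) / of_real (nf * ng)"
      by (simp add: sum_divide_distrib mult_ac)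
    finally show ?thesis using n
      by (simp add: norm_divide norm_mult field_simps flip: nf_def ng_def)
  qed
qed

text \<open>The symmetric case \<open>1/s + 2/p = 2\<close> of Young's inequality. With \<alpha> =
  1/(2s), the functions \<open>K\<close>, \<open>f\<close>, \<open>g\<close> are multiples of
  u^(2\<alpha>), v^(1-\<alpha>), w^(1-\<alpha>) for nonnegative u, v, w of sum 1. The product of
  these powers equals (uv)^\<alpha> (uw)^\<alpha> (vw)^(1-2\<alpha>), which weighted AM-GM bounds by
  a convex combination of uv, uw and vw; each of the three double sums is at most 1.\<close>

lemma young_bilinear:
  fixes K f g :: "int \<Rightarrow> real"
  assumes fin: "finite X" "finite Y" "finite D"
    and D: "\<And>x t. x \<in> X \<Longrightarrow> t \<in> Y \<Longrightarrow> x - t \<in> D"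
    and s: "s \<ge> 1" and p: "1 / p = 1 - 1 / (2 * s)"
    and K: "\<And>m. K m \<ge> 0" and f: "\<And>t. f t \<ge> 0" and g: "\<And>x. g x \<ge> 0"
  shows "(\<Sum>x\<in>X. \<Sum>t\<in>Y. K (x - t) * f t * g x) \<le>
     (\<Sum>m\<in>D. K m powr s) powr (1 / s) * (\<Sum>t\<in>Y. f t powr p) powr (1 / p) *
     (\<Sum>x\<in>X. g x powr p) powr (1 / p)"
proof -
  define \<alpha> where "\<alpha> = 1 / (2 * s)"
  have \<alpha>: "0 < \<alpha>" "2 * \<alpha> \<le> 1" "1 / s = 2 * \<alpha>" "1 / p = 1 - \<alpha>" using s p by (auto simp: \<alpha>_def field_simps)
  then have "p > 0" by (subst zero_less_divide_1_iff[symmetric]) simp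
  define U where "U = (\<Sum>m\<in>D. K m powr s)"
  define V where "V = (\<Sum>t\<in>Y. f t powr p)"
  define W where "W = (\<Sum>x\<in>X. g x powr p)"
  have nn: "U \<ge> 0" "V \<ge> 0" "W \<ge> 0" by (auto simp: U_def V_def W_def intro: sum_nonneg)
  show ?thesis
  proof (cases "U = 0 \<or> V = 0 \<or> W = 0")
    case True
    have "K (x - t) = 0 \<or> f t = 0 \<or> g x = 0" if "x \<in> X" "t \<in> Y" for x t
      using True that D fin by (auto simp: U_def V_def W_def sum_nonneg_eq_0_iff)
    then have "(\<Sum>x\<in>X. \<Sum>t\<in>Y. K (x - t) * f t * g x) = 0"
      by (intro sum.neutral ballI) fastforce
    then show ?thesis by simp
  next
    case False
    then have pos: "U > 0" "V > 0" "W > 0" using nn by auto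
    define u where "u m = K m powr s / U" for m
    define v where "v t = f t powr p / V" for t
    define w where "w x = g x powr p / W" for x
    have uvw: "u m \<ge> 0" "v t \<ge> 0" "w x \<ge> 0" for m t x using pos by (auto simp: u_def v_def w_def)
    have Ku: "K m = U powr (2 * \<alpha>) * u m powr (2 * \<alpha>)" for m
      using pos s K[of m] by (simp add: u_def powr_powr powr_divide flip: \<alpha>(3))
    have fv: "f t = V powr (1 - \<alpha>) * v t powr (1 - \<alpha>)" for t
      using pos \<open>p > 0\<close> f[of t] by (simp add: v_def powr_powr powr_divide flip: \<alpha>(4))
    have gw: "g x = W powr (1 - \<alpha>) * w x powr (1 - \<alpha>)" for x
      using pos \<open>p > 0\<close> g[of x] by (simp add: w_def powr_powr powr_divide flip: \<alpha>(4))
    have amgm: "a powr (2 * \<alpha>) * b powr (1 - \<alpha>) * c powr (1 - \<alpha>) \<le> \<alpha> * (a * b) + \<alpha> * (a * c) + (1 - 2 * \<alpha>) * (b * c)"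
      if "a \<ge> 0" "b \<ge> 0" "c \<ge> 0" for a b c
    proof (cases "a = 0 \<or> b = 0 \<or> c = 0")
      case True
      then show ?thesis using that \<alpha> by auto
    next
      case False
      then have abc: "a > 0" "b > 0" "c > 0" using that by auto
      have "a powr (2 * \<alpha>) * b powr (1 - \<alpha>) * c powr (1 - \<alpha>) =
          ((a * b) powr (1/2) * (a * c) powr (1/2)) powr (2 * \<alpha>) * (b * c) powr (1 - 2 * \<alpha>)"
        using abc by (simp add: powr_def ln_mult flip: exp_add) (simp add: field_simps)
      also have "\<dots> \<le> (1/2 * (a * b) + 1/2 * (a * c)) powr (2 * \<alpha>) * (b * c) powr (1 - 2 * \<alpha>)"
        using abc \<alpha> by (intro mult_right_mono powr_mono2 Youngs_inequality_0) auto
      also have "\<dots> \<le> 2 * \<alpha> * (1/2 * (a * b) + 1/2 * (a * c)) + (1 - 2 * \<alpha>) * (b * c)"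
        using abc \<alpha> by (intro Youngs_inequality_0) (auto intro: add_pos_pos)
      finally show ?thesis by (simp add: algebra_simps)
    qed
    have sv: "(\<Sum>t\<in>Y. v t) = 1" using pos by (simp add: v_def V_def flip: sum_divide_distrib)
    have sw: "(\<Sum>x\<in>X. w x) = 1" using pos by (simp add: w_def W_def flip: sum_divide_distrib)
    have su: "(\<Sum>m\<in>D. u m) = 1" using pos by (simp add: u_def U_def flip: sum_divide_distrib)
    have su1: "(\<Sum>x\<in>X. u (x - t)) \<le> 1" if "t \<in> Y" for t
    proof -
      have "(\<Sum>x\<in>X. u (x - t)) = (\<Sum>m\<in>(\<lambda>x. x - t) ` X. u m)"
        by (subst sum.reindex) (auto simp: inj_on_def)
      also have "\<dots> \<le> (\<Sum>m\<in>D. u m)" using fin D that uvw by (intro sum_mono2) auto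
      finally show ?thesis by (simp add: su)
    qed
    have su2: "(\<Sum>t\<in>Y. u (x - t)) \<le> 1" if "x \<in> X" for x
    proof -
      have "(\<Sum>t\<in>Y. u (x - t)) = (\<Sum>m\<in>(\<lambda>t. x - t) ` Y. u m)"
        by (subst sum.reindex) (auto simp: inj_on_def)
      also have "\<dots> \<le> (\<Sum>m\<in>D. u m)" using fin D that uvw by (intro sum_mono2) auto
      finally show ?thesis by (simp add: su)
    qed
    have 1: "(\<Sum>x\<in>X. \<Sum>t\<in>Y. u (x - t) * v t) \<le> 1"
    proof -
      have "(\<Sum>x\<in>X. \<Sum>t\<in>Y. u (x - t) * v t) = (\<Sum>t\<in>Y. (\<Sum>x\<in>X. u (x - t)) * v t)"
        by (subst sum.swap) (simp add: sum_distrib_right)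
      also have "\<dots> \<le> (\<Sum>t\<in>Y. 1 * v t)" using su1 uvw by (intro sum_mono mult_right_mono) auto
      finally show ?thesis by (simp add: sv)
    qed
    have 2: "(\<Sum>x\<in>X. \<Sum>t\<in>Y. u (x - t) * w x) \<le> 1"
    proof -
      have "(\<Sum>x\<in>X. \<Sum>t\<in>Y. u (x - t) * w x) = (\<Sum>x\<in>X. (\<Sum>t\<in>Y. u (x - t)) * w x)"
        by (simp add: sum_distrib_right)
      also have "\<dots> \<le> (\<Sum>x\<in>X. 1 * w x)" using su2 uvw by (intro sum_mono mult_right_mono) auto
      finally show ?thesis by (simp add: sw)
    qed
    have 3: "(\<Sum>x\<in>X. \<Sum>t\<in>Y. v t * w x) = 1"
      using sum_product[of w X v Y] by (simp add: sv sw mult.commute)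
    have "(\<Sum>x\<in>X. \<Sum>t\<in>Y. u (x - t) powr (2 * \<alpha>) * v t powr (1 - \<alpha>) * w x powr (1 - \<alpha>)) \<le>
        (\<Sum>x\<in>X. \<Sum>t\<in>Y. \<alpha> * (u (x - t) * v t) + \<alpha> * (u (x - t) * w x) + (1 - 2 * \<alpha>) * (v t * w x))"
      using uvw by (intro sum_mono amgm)
    also have "\<dots> = \<alpha> * (\<Sum>x\<in>X. \<Sum>t\<in>Y. u (x - t) * v t) + \<alpha> * (\<Sum>x\<in>X. \<Sum>t\<in>Y. u (x - t) * w x)
        + (1 - 2 * \<alpha>) * (\<Sum>x\<in>X. \<Sum>t\<in>Y. v t * w x)"
      by (simp add: sum.distrib sum_distrib_left)
    also have "\<dots> \<le> \<alpha> * 1 + \<alpha> * 1 + (1 - 2 * \<alpha>) * 1"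
      using 1 2 3 \<alpha> by (intro add_mono mult_left_mono) auto
    finally have main: "(\<Sum>x\<in>X. \<Sum>t\<in>Y. u (x - t) powr (2 * \<alpha>) * v t powr (1 - \<alpha>) * w x powr (1 - \<alpha>)) \<le> 1"
      by simp
    have "(\<Sum>x\<in>X. \<Sum>t\<in>Y. K (x - t) * f t * g x) = U powr (2 * \<alpha>) * V powr (1 - \<alpha>) * W powr (1 - \<alpha>) *
        (\<Sum>x\<in>X. \<Sum>t\<in>Y. u (x - t) powr (2 * \<alpha>) * v t powr (1 - \<alpha>) * w x powr (1 - \<alpha>))"
      unfolding sum_distrib_left by (intro sum.cong refl, subst Ku, subst fv, subst gw) (simp add: mult_ac)
    also have "\<dots> \<le> U powr (2 * \<alpha>) * V powr (1 - \<alpha>) * W powr (1 - \<alpha>) * 1"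
      by (intro mult_left_mono main) auto
    finally show ?thesis by (simp add: U_def V_def W_def \<alpha>)
  qed
qed

section \<open>The square of Selberg's sieve\<close>

lemmas [simp del] = of_nat_prod

text \<open>
  A squarefree modulus \<open>q\<close> is represented by the set of its prime factors; \<open>ram_prod P n\<close> is then the
  Ramanujan sum \<open>c\<^sub>q(n)\<close> and \<open>inv_phi P\<close> is \<open>1 / \<phi>(q)\<close>.
\<close>
definition prime_sets :: "nat \<Rightarrow> nat set set" where
  "prime_sets y = {P. finite P \<and> (\<forall>p\<in>P. prime p \<and> \<not> p dvd y)}"

definition sieve_sets :: "nat \<Rightarrow> real \<Rightarrow> nat set set" where
  "sieve_sets y R = {P \<in> prime_sets y. real (\<Prod>P) \<le> R}"

definition ram :: "nat \<Rightarrow> int \<Rightarrow> real" where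
  "ram p n = (if int p dvd n then real p - 1 else -1)"

definition ram_prod :: "nat set \<Rightarrow> int \<Rightarrow> real" where
  "ram_prod P n = (\<Prod>p\<in>P. ram p n)"

definition inv_phi :: "nat set \<Rightarrow> real" where
  "inv_phi P = (\<Prod>p\<in>P. 1 / (real p - 1))"

definition sieve_mass :: "nat \<Rightarrow> real \<Rightarrow> real" where
  "sieve_mass y R = (\<Sum>P\<in>sieve_sets y R. inv_phi P)"

definition sieve_sum :: "nat \<Rightarrow> real \<Rightarrow> int \<Rightarrow> real" where
  "sieve_sum y R n = (\<Sum>P\<in>sieve_sets y R. \<Prod>p\<in>P. - ram p n / (real p - 1))"

section \<open>Arithmetic of squarefree moduli given by their prime sets\<close>

lemma sum_Times_snd:
  fixes h :: "'b \<Rightarrow> real"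
  shows "(\<Sum>v\<in>A \<times> Z. h (snd v)) = real (card A) * (\<Sum>z\<in>Z. h z)"
  using sum.cartesian_product[of "\<lambda>a z. h z" Z A] by (simp add: case_prod_unfold)

lemma prime_setsD:
  assumes "P \<in> prime_sets y"
  shows "finite P" "p \<in> P \<Longrightarrow> prime p" "p \<in> P \<Longrightarrow> \<not> p dvd y" "p \<in> P \<Longrightarrow> 2 \<le> p"
  using assms by (auto simp: prime_sets_def prime_ge_2_nat)

lemma prime_sets_subset: "P \<in> prime_sets y \<Longrightarrow> Q \<subseteq> P \<Longrightarrow> Q \<in> prime_sets y"
  using finite_subset[of Q P] by (auto simp: prime_sets_def)

lemma prime_sets_Un: "P \<in> prime_sets y \<Longrightarrow> Q \<in> prime_sets y \<Longrightarrow> P \<union> Q \<in> prime_sets y"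
  by (auto simp: prime_sets_def)

lemma prod_pos_prime_sets: "P \<in> prime_sets y \<Longrightarrow> 0 < \<Prod>P"
  by (rule prod_pos) (auto simp: prime_sets_def prime_gt_0_nat)

lemma prod_dvd_prime_sets: "P \<in> prime_sets y \<Longrightarrow> Q \<subseteq> P \<Longrightarrow> \<Prod>Q dvd \<Prod>P"
  by (rule prod_dvd_prod_subset) (auto simp: prime_sets_def)

lemma prod_mono_prime_sets: "P \<in> prime_sets y \<Longrightarrow> Q \<subseteq> P \<Longrightarrow> \<Prod>Q \<le> \<Prod>P"
  by (rule dvd_imp_le) (auto intro: prod_dvd_prime_sets prod_pos_prime_sets)

lemma member_le_prod_prime_sets: "P \<in> prime_sets y \<Longrightarrow> p \<in> P \<Longrightarrow> p \<le> \<Prod>P"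
  using prod_mono_prime_sets[of P y "{p}"] by simp

lemma prime_factors_prod_prime_sets:
  assumes "P \<in> prime_sets y"
  shows "prime_factors (\<Prod>P) = P"
proof -
  have "finite P" "\<And>p. p \<in> P \<Longrightarrow> prime p" using assms by (auto simp: prime_sets_def)
  then show ?thesis
  proof (induction P rule: finite_induct)
    case (insert p P)
    then have "\<Prod>P \<noteq> 0" by (metis insertI2 not_prime_0 prod_zero_iff)
    moreover have "p \<noteq> 0" using insert.prems by (auto simp: prime_gt_0_nat)
    ultimately show ?case using insert by (simp add: prime_factors_product prime_prime_factors)
  qed simp
qed

lemma inj_on_Prod_prime_sets: "inj_on Prod (prime_sets y)"
  by (rule inj_on_inverseI[of _ prime_factors]) (simp add: prime_factors_prod_prime_sets)

lemma sieve_sets_subset: "sieve_sets y R \<subseteq> Pow {..nat \<lfloor>R\<rfloor>}"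
proof safe
  fix P p assume P: "P \<in> sieve_sets y R" and "p \<in> P"
  then have "p \<le> \<Prod>P" using member_le_prod_prime_sets by (auto simp: sieve_sets_def)
  then have "real p \<le> real (\<Prod>P)" by (rule of_nat_mono)
  then have "real p \<le> R" using P by (simp add: sieve_sets_def)
  then show "p \<le> nat \<lfloor>R\<rfloor>" by (simp add: le_nat_floor)
qed

lemma finite_sieve_sets [simp]: "finite (sieve_sets y R)"
  by (rule finite_subset[OF sieve_sets_subset]) simp

lemma sum_sieve_sets_le:
  fixes h :: "nat \<Rightarrow> real"
  assumes "\<And>n. h n \<ge> 0"
  shows "(\<Sum>P\<in>sieve_sets y R. h (\<Prod>P)) \<le> (\<Sum>n=1..nat \<lfloor>R\<rfloor>. h n)"
proof -
  have "(\<Sum>P\<in>sieve_sets y R. h (\<Prod>P)) = (\<Sum>n\<in>Prod ` sieve_sets y R. h n)"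
    by (subst sum.reindex) (auto intro: inj_on_subset[OF inj_on_Prod_prime_sets] simp: sieve_sets_def)
  also have "\<dots> \<le> (\<Sum>n=1..nat \<lfloor>R\<rfloor>. h n)"
  proof (rule sum_mono2)
    show "Prod ` sieve_sets y R \<subseteq> {1..nat \<lfloor>R\<rfloor>}"
      using prod_pos_prime_sets by (auto simp: sieve_sets_def Suc_le_eq le_nat_floor)
  qed (use assms in auto)
  finally show ?thesis .
qed

lemma sieve_sets_down:
  assumes "P \<in> sieve_sets y R" "Q \<subseteq> P"
  shows "Q \<in> sieve_sets y R"
proof -
  have P: "P \<in> prime_sets y" "real (\<Prod>P) \<le> R" using assms by (auto simp: sieve_sets_def)
  then have "real (\<Prod>Q) \<le> real (\<Prod>P)"
    using prod_mono_prime_sets[OF P(1) assms(2)] by simp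
  then show ?thesis using P prime_sets_subset[OF P(1) assms(2)] by (simp add: sieve_sets_def)
qed

lemma empty_in_sieve_sets: "R \<ge> 1 \<Longrightarrow> {} \<in> sieve_sets y R"
  by (simp add: sieve_sets_def prime_sets_def)

lemma inv_phi_pos: "P \<in> prime_sets y \<Longrightarrow> inv_phi P > 0"
  unfolding inv_phi_def by (rule prod_pos) (auto dest: prime_setsD(4))

lemma sieve_mass_ge_1: assumes "R \<ge> 1" shows "sieve_mass y R \<ge> 1"
proof -
  have "inv_phi {} \<le> sieve_mass y R"
    unfolding sieve_mass_def
  proof (rule member_le_sum)
    show "{} \<in> sieve_sets y R" using assms by (rule empty_in_sieve_sets)
    show "0 \<le> inv_phi P" if "P \<in> sieve_sets y R - {{}}" for P
      using that inv_phi_pos[of P y] by (auto simp: sieve_sets_def)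
  qed simp
  then show ?thesis by (simp add: inv_phi_def)
qed

lemma inv_phi_Un:
  assumes "finite A" "finite B" "A \<inter> B = {}"
  shows "inv_phi (A \<union> B) = inv_phi A * inv_phi B"
  unfolding inv_phi_def by (rule prod.union_disjoint) fact+

lemma ram_prod_Un:
  assumes "finite A" "finite B" "A \<inter> B = {}"
  shows "ram_prod (A \<union> B) n = ram_prod A n * ram_prod B n"
  unfolding ram_prod_def by (rule prod.union_disjoint) fact+

lemma sieve_sum_eq_mass:
  assumes "\<And>p. prime p \<Longrightarrow> real p \<le> R \<Longrightarrow> \<not> int p dvd n"
  shows "sieve_sum y R n = sieve_mass y R"
  unfolding sieve_sum_def sieve_mass_def inv_phi_def
proof (intro sum.cong prod.cong refl)
  fix P p assume P: "P \<in> sieve_sets y R" and p: "p \<in> P"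
  then have "prime p" "p \<le> \<Prod>P" "real (\<Prod>P) \<le> R"
    using member_le_prod_prime_sets by (auto simp: sieve_sets_def prime_sets_def)
  then have "\<not> int p dvd n" by (intro assms) (auto simp: le_diff_eq intro: order_trans[OF of_nat_mono])
  then show "- ram p n / (real p - 1) = 1 / (real p - 1)" by (simp add: ram_def)
qed

section \<open>Expansion of the squared sieve sum in Ramanujan sums\<close>

text \<open>At a prime common to \<open>P\<close> and \<open>Q\<close> the square of c_p/(p-1)
  equals (p-2)/(p-1)^2 c_p + 1/(p-1). \<open>X\<close> is the set of common primes at which the
  first summand is chosen; a prime in only one of the two sets keeps its factor -c_p/(p-1).\<close>

definition square_coeff :: "nat set \<Rightarrow> nat set \<Rightarrow> nat set \<Rightarrow> real" where
  "square_coeff P Q X =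
     (\<Prod>p\<in>(P - Q) \<union> (Q - P). - 1 / (real p - 1)) * (\<Prod>p\<in>X. (real p - 2) / (real p - 1)\<^sup>2) * inv_phi (P \<inter> Q - X)"

lemma ram_product_expansion:
  assumes P: "P \<in> prime_sets y" and Q: "Q \<in> prime_sets y"
  shows "(\<Prod>p\<in>P. - ram p n / (real p - 1)) * (\<Prod>p\<in>Q. - ram p n / (real p - 1)) =
    (\<Sum>X\<in>Pow (P \<inter> Q). square_coeff P Q X * ram_prod (((P - Q) \<union> (Q - P)) \<union> X) n)"
proof -
  let ?a = "\<lambda>p. - ram p n / (real p - 1)"
  let ?U = "(P - Q) \<union> (Q - P)"
  have fin: "finite P" "finite Q" using P Q by (auto dest: prime_setsD)
  have "prod ?a P = prod ?a (P - Q) * prod ?a (P \<inter> Q)"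
    using fin by (subst prod.union_disjoint[symmetric]) (auto intro!: prod.cong)
  moreover have "prod ?a Q = prod ?a (Q - P) * prod ?a (P \<inter> Q)"
    using fin by (subst prod.union_disjoint[symmetric]) (auto intro!: prod.cong)
  moreover have "prod ?a ?U = prod ?a (P - Q) * prod ?a (Q - P)"
    using fin by (subst prod.union_disjoint) auto
  ultimately have "prod ?a P * prod ?a Q = prod ?a ?U * (\<Prod>p\<in>P \<inter> Q. (?a p)\<^sup>2)"
    by (simp only: power2_eq_square prod.distrib mult_ac)
  also have "(\<Prod>p\<in>P \<inter> Q. (?a p)\<^sup>2) = (\<Prod>p\<in>P \<inter> Q. (real p - 2) / (real p - 1)\<^sup>2 * ram p n + 1 / (real p - 1))"
  proof (intro prod.cong refl)
    fix p assume "p \<in> P \<inter> Q"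
    then have "real p - 1 \<noteq> 0" using prime_setsD(4)[OF P] by fastforce
    then show "(?a p)\<^sup>2 = (real p - 2) / (real p - 1)\<^sup>2 * ram p n + 1 / (real p - 1)"
      by (auto simp: ram_def power2_eq_square divide_simps) (simp add: algebra_simps)
  qed
  also have "\<dots> = (\<Sum>X\<in>Pow (P \<inter> Q). (\<Prod>p\<in>X. (real p - 2) / (real p - 1)\<^sup>2 * ram p n) * inv_phi (P \<inter> Q - X))"
    using fin by (subst prod_add) (auto simp: inv_phi_def)
  finally have 1: "prod ?a P * prod ?a Q =
      (\<Sum>X\<in>Pow (P \<inter> Q). prod ?a ?U * ((\<Prod>p\<in>X. (real p - 2) / (real p - 1)\<^sup>2 * ram p n) * inv_phi (P \<inter> Q - X)))"
    by (simp add: sum_distrib_left)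
  have U: "prod ?a ?U = (\<Prod>p\<in>?U. - 1 / (real p - 1)) * ram_prod ?U n"
    unfolding ram_prod_def prod.distrib[symmetric] by (intro prod.cong) auto
  show ?thesis unfolding 1
  proof (intro sum.cong refl)
    fix X assume X: "X \<in> Pow (P \<inter> Q)"
    then have "ram_prod (?U \<union> X) n = ram_prod ?U n * ram_prod X n"
      using fin by (intro ram_prod_Un) (auto intro: finite_subset)
    then show "prod ?a ?U * ((\<Prod>p\<in>X. (real p - 2) / (real p - 1)\<^sup>2 * ram p n) * inv_phi (P \<inter> Q - X)) =
        square_coeff P Q X * ram_prod (?U \<union> X) n"
      by (simp only: U square_coeff_def prod.distrib ram_prod_def mult_ac)
  qed
qed

lemma abs_square_coeff_le:
  assumes P: "P \<in> prime_sets y" and Q: "Q \<in> prime_sets y" and X: "X \<subseteq> P \<inter> Q"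
  shows "\<bar>square_coeff P Q X\<bar> \<le> inv_phi (((P - Q) \<union> (Q - P)) \<union> X) * inv_phi (P \<inter> Q - X)"
proof -
  let ?U = "(P - Q) \<union> (Q - P)"
  have fin: "finite P" "finite Q" "finite X" using P Q X by (auto dest: prime_setsD intro: finite_subset)
  have p2: "2 \<le> p" if "p \<in> P \<union> Q" for p using that P Q prime_setsD(4) by blast
  have "\<bar>\<Prod>p\<in>?U. - 1 / (real p - 1)\<bar> = inv_phi ?U"
    unfolding abs_prod inv_phi_def using p2 by (intro prod.cong) force+
  moreover have "\<bar>\<Prod>p\<in>X. (real p - 2) / (real p - 1)\<^sup>2\<bar> \<le> inv_phi X"
    unfolding abs_prod inv_phi_def
  proof (intro prod_mono conjI)
    fix p assume "p \<in> X"
    then have "2 \<le> real p" using p2[of p] X by auto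
    then show "\<bar>(real p - 2) / (real p - 1)\<^sup>2\<bar> \<le> 1 / (real p - 1)"
      by (simp add: power2_eq_square divide_simps)
  qed auto
  moreover have "inv_phi (P \<inter> Q - X) > 0" "inv_phi ?U > 0"
    using P Q by (auto intro!: inv_phi_pos[of _ y] simp: prime_sets_def)
  moreover have "inv_phi (?U \<union> X) = inv_phi ?U * inv_phi X"
    using fin X by (intro inv_phi_Un) auto
  ultimately show ?thesis
    unfolding square_coeff_def abs_mult by (auto intro!: mult_right_mono mult_left_mono)
qed

text \<open>The bound q^(-1+o(1)) in explicit form. The power of 4 counts, for each modulus, the
  possible traces on it of the two factors of the square.\<close>

definition sieve_weight :: "nat \<Rightarrow> (nat set \<Rightarrow> real) \<Rightarrow> bool" where
  "sieve_weight y w \<longleftrightarrow> (\<forall>P\<in>prime_sets y. \<bar>w P\<bar> \<le> 4 ^ card P * inv_phi P)"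

text \<open>The triples \<open>(A, B, X)\<close> contributing to a fixed modulus \<open>P\<close>
  are determined by \<open>A \<inter> P\<close>, \<open>B \<inter> P\<close> and the set
  \<open>A \<inter> B - X\<close> of primes that have dropped out. The first two have at most
  \<open>4 ^ card P\<close> values. The third is itself a sieve set and carries the weight
  \<open>inv_phi\<close>, so summing over it gives at most the full mass \<open>G\<close>, which is
  exactly what the normalisation divides out.\<close>

lemma sieve_square_expansion:
  assumes R: "R \<ge> 1"
  obtains w where
    "\<And>n. (sieve_sum y R n)\<^sup>2 = sieve_mass y R * (\<Sum>P\<in>sieve_sets y (R\<^sup>2). w P * ram_prod P n)"
    "sieve_weight y w"
proof -
  let ?S = "sieve_sets y R"
  define T where "T = Sigma ?S (\<lambda>P. Sigma ?S (\<lambda>Q. Pow (P \<inter> Q)))"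
  define \<phi> where "\<phi> = (\<lambda>(P, Q, X). ((P - Q) \<union> (Q - P)) \<union> X :: nat set)"
  define c where "c = (\<lambda>(P, Q, X). square_coeff P Q X)"
  define G where "G = sieve_mass y R"
  have G: "G \<ge> 1" unfolding G_def by (rule sieve_mass_ge_1[OF R])
  have Sprime: "P \<in> prime_sets y" if "P \<in> ?S" for P using that by (simp add: sieve_sets_def)
  have finS: "finite P" if "P \<in> ?S" for P using Sprime[OF that] prime_setsD(1) by blast
  have finT: "finite T" unfolding T_def using finS by (intro finite_SigmaI) auto
  have \<phi>: "\<phi> ` T \<subseteq> sieve_sets y (R\<^sup>2)"
  proof safe
    fix P Q X assume "(P, Q, X) \<in> T"
    then have *: "P \<in> ?S" "Q \<in> ?S" "X \<subseteq> P \<inter> Q" by (auto simp: T_def)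
    have PQ: "P \<union> Q \<in> prime_sets y" using * by (intro prime_sets_Un) (auto simp: Sprime)
    have sub: "\<phi> (P, Q, X) \<subseteq> P \<union> Q" using * by (auto simp: \<phi>_def)
    have "P \<union> Q = P \<union> (Q - P)" by auto
    then have "\<Prod>(P \<union> Q) = \<Prod>P * \<Prod>(Q - P)"
      using * finS by (metis Diff_disjoint finite_Diff prod.union_disjoint)
    also have "\<dots> \<le> \<Prod>P * \<Prod>Q" using * by (intro mult_left_mono prod_mono_prime_sets[of _ y] Sprime) auto
    finally have "\<Prod>(\<phi> (P, Q, X)) \<le> \<Prod>P * \<Prod>Q"
      using prod_mono_prime_sets[OF PQ sub] by linarith
    then have "real (\<Prod>(\<phi> (P, Q, X))) \<le> real (\<Prod>P) * real (\<Prod>Q)"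
      by (metis of_nat_mono of_nat_mult)
    also have "\<dots> \<le> R * R" using * R by (intro mult_mono) (auto simp: sieve_sets_def)
    finally show "\<phi> (P, Q, X) \<in> sieve_sets y (R\<^sup>2)"
      using prime_sets_subset[OF PQ sub] by (simp add: sieve_sets_def power2_eq_square)
  qed
  define w where "w P = (\<Sum>\<tau>\<in>{\<tau>\<in>T. \<phi> \<tau> = P}. c \<tau>) / G" for P
  show thesis
  proof
    fix n
    have "(sieve_sum y R n)\<^sup>2 = (\<Sum>P\<in>?S. \<Sum>Q\<in>?S. (\<Prod>p\<in>P. - ram p n / (real p - 1)) * (\<Prod>p\<in>Q. - ram p n / (real p - 1)))"
      unfolding sieve_sum_def power2_eq_square sum_product by simp
    also have "\<dots> = (\<Sum>P\<in>?S. \<Sum>Q\<in>?S. \<Sum>X\<in>Pow (P \<inter> Q). square_coeff P Q X * ram_prod (((P - Q) \<union> (Q - P)) \<union> X) n)"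
      by (intro sum.cong refl ram_product_expansion[of _ y]) (auto simp: Sprime)
    also have "\<dots> = (\<Sum>\<tau>\<in>T. c \<tau> * ram_prod (\<phi> \<tau>) n)"
      unfolding T_def using finS
      by (subst sum.Sigma) (auto simp: c_def \<phi>_def sum.Sigma case_prod_unfold intro!: sum.cong)
    also have "\<dots> = (\<Sum>P\<in>sieve_sets y (R\<^sup>2). \<Sum>\<tau>\<in>{\<tau>\<in>T. \<phi> \<tau> = P}. c \<tau> * ram_prod (\<phi> \<tau>) n)"
      by (rule sum.group[symmetric]) (use finT \<phi> in auto)
    also have "\<dots> = (\<Sum>P\<in>sieve_sets y (R\<^sup>2). G * (w P * ram_prod P n))"
      using G by (intro sum.cong refl) (simp add: w_def sum_distrib_right)
    finally show "(sieve_sum y R n)\<^sup>2 = sieve_mass y R * (\<Sum>P\<in>sieve_sets y (R\<^sup>2). w P * ram_prod P n)"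
      by (simp add: sum_distrib_left G_def)
  next
    show "sieve_weight y w" unfolding sieve_weight_def
    proof
      fix P assume P: "P \<in> prime_sets y"
      have finP: "finite P" using P prime_setsD by blast
      define \<psi> where "\<psi> = (\<lambda>(A, B, X). (A \<inter> P, B \<inter> P, A \<inter> B - X))"
      let ?F = "{\<tau>\<in>T. \<phi> \<tau> = P}"
      have inj: "inj_on \<psi> ?F"
      proof (rule inj_on_inverseI)
        fix \<tau> assume "\<tau> \<in> ?F"
        then obtain A B X where t: "\<tau> = (A, B, X)" "X \<subseteq> A \<inter> B" "P = ((A - B) \<union> (B - A)) \<union> X"
          by (auto simp: T_def \<phi>_def)
        \<comment> \<open>Recovery of the triple: \<open>X\<close> is the common part of the two
          traces, since \<open>P\<close> meets \<open>A \<inter> B\<close> only in \<open>X\<close>,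
          and each of \<open>A\<close>, \<open>B\<close> is its trace together with the dropped
          primes.\<close>
        show "(\<lambda>(C, D, Y). (C \<union> Y, D \<union> Y, C \<inter> D)) (\<psi> \<tau>) = \<tau>"
          unfolding \<psi>_def t using t(2) by auto
      qed
      have img: "\<psi> ` ?F \<subseteq> Pow P \<times> (Pow P \<times> ?S)"
      proof (rule image_subsetI)
        fix \<tau> assume "\<tau> \<in> ?F"
        then obtain A B X where t: "\<tau> = (A, B, X)" "A \<in> ?S" by (auto simp: T_def)
        then have "A \<inter> B - X \<in> ?S"
          by (auto intro: sieve_sets_down[OF t(2)])
        then show "\<psi> \<tau> \<in> Pow P \<times> (Pow P \<times> ?S)" by (simp add: \<psi>_def t)
      qed
      have "\<bar>\<Sum>\<tau>\<in>?F. c \<tau>\<bar> \<le> (\<Sum>\<tau>\<in>?F. inv_phi P * inv_phi (snd (snd (\<psi> \<tau>))))"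
      proof (rule order_trans[OF sum_abs sum_mono])
        fix \<tau> assume "\<tau> \<in> ?F"
        then obtain A B X where t: "\<tau> = (A, B, X)" "X \<subseteq> A \<inter> B" "P = ((A - B) \<union> (B - A)) \<union> X" "A \<in> ?S" "B \<in> ?S"
          by (auto simp: T_def \<phi>_def)
        show "\<bar>c \<tau>\<bar> \<le> inv_phi P * inv_phi (snd (snd (\<psi> \<tau>)))"
          using abs_square_coeff_le[OF Sprime Sprime t(2), OF t(4,5)] by (simp add: c_def \<psi>_def t(1) flip: t(3))
      qed
      also have "\<dots> = (\<Sum>v\<in>\<psi> ` ?F. inv_phi P * inv_phi (snd (snd v)))"
        by (subst sum.reindex[OF inj]) simp
      also have "\<dots> \<le> (\<Sum>v\<in>Pow P \<times> (Pow P \<times> ?S). inv_phi P * inv_phi (snd (snd v)))"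
        using img finP P
        by (intro sum_mono2) (auto intro!: mult_nonneg_nonneg less_imp_le[OF inv_phi_pos[of _ y]] dest: Sprime)
      also have "\<dots> = 4 ^ card P * inv_phi P * G"
        using finP sum_Times_snd[of "\<lambda>v. inv_phi P * inv_phi (snd v)" "Pow P" "Pow P \<times> ?S"]
          sum_Times_snd[of "\<lambda>v. inv_phi P * inv_phi v" "Pow P" ?S]
          power_mult_distrib[of "2::real" 2 "card P"]
        by (auto simp: card_Pow G_def sieve_mass_def simp flip: sum_distrib_left)
      finally show "\<bar>w P\<bar> \<le> 4 ^ card P * inv_phi P"
        using G by (simp add: w_def field_simps)
    qed
  qed
qed

section \<open>Size of the sieve weights and moments of the pieces\<close>

lemma prod_prime_factors_squarefree:
  fixes n :: nat
  assumes "squarefree n"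
  shows "\<Prod>(prime_factors n) = n"
proof -
  have "n \<noteq> 0" using assms by (metis not_squarefree_0)
  then have "n = (\<Prod>p\<in>prime_factors n. p ^ multiplicity p n)"
    by (intro prime_factorization_nat) simp
  also have "\<dots> = (\<Prod>p\<in>prime_factors n. p)"
  proof (intro prod.cong refl)
    fix p assume "p \<in> prime_factors n"
    then have "prime p" "multiplicity p n > 0" by (auto simp: prime_factors_multiplicity)
    moreover have "multiplicity p n \<le> 1"
      using assms squarefree_factorial_semiring''[OF \<open>n \<noteq> 0\<close>] \<open>prime p\<close> by simp
    ultimately have "multiplicity p n = 1" by linarith
    then show "p ^ multiplicity p n = p" by simp
  qed
  finally show ?thesis by simp
qed

lemma sum_inverse_squares_le: "(\<Sum>k=1..n. 1 / (real k)\<^sup>2) \<le> 2 - 1 / real n"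
proof (induction n)
  case (Suc n)
  show ?case
  proof (cases "n = 0")
    case False
    have "1 / (real (Suc n))\<^sup>2 \<le> 1 / real n - 1 / real (Suc n)"
      using False by (simp add: divide_simps power2_eq_square)
    then show ?thesis using Suc by simp
  qed simp
qed simp

lemma inv_phi_ge: assumes "P \<in> prime_sets y" shows "1 / real (\<Prod>P) \<le> inv_phi P"
proof -
  have "1 / real (\<Prod>P) = (\<Prod>p\<in>P. 1 / real p)" by (simp add: prod_dividef of_nat_prod)
  also have "\<dots> \<le> inv_phi P" unfolding inv_phi_def
    using prime_setsD(4)[OF assms] by (intro prod_mono) (force simp: divide_simps)
  finally show ?thesis .
qed

lemma inv_phi_le: assumes "P \<in> prime_sets y" shows "inv_phi P \<le> 2 ^ card P / real (\<Prod>P)"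
proof -
  have "inv_phi P \<le> (\<Prod>p\<in>P. 2 * (1 / real p))" unfolding inv_phi_def
  proof (intro prod_mono conjI)
    fix p assume "p \<in> P"
    then have "2 \<le> real p" using prime_setsD(4)[OF assms] by force
    then show "0 \<le> 1 / (real p - 1)" "1 / (real p - 1) \<le> 2 * (1 / real p)"
      by (auto simp: divide_simps)
  qed
  also have "\<dots> = 2 ^ card P / real (\<Prod>P)"
    by (simp add: prod_dividef of_nat_prod)
  finally show ?thesis .
qed

text \<open>Each n is a squarefree number times a square k^2. Hence the harmonic sum up to
  \<open>R\<close> is at most the sum of 1/q over squarefree q up to \<open>R\<close> times the sum
  of 1/k^2, which is at most 2, and 1/q is at most 1/\<phi>(q).\<close>

lemma sieve_mass_1_ge: assumes "R \<ge> 1" shows "ln R / 2 \<le> sieve_mass 1 R"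
proof -
  let ?K = "nat \<lfloor>R\<rfloor>" and ?S = "sieve_sets 1 R"
  define \<phi> where "\<phi> n = (prime_factors (squarefree_part n), square_part n)" for n :: nat
  define h where "h = (\<lambda>(P, k). 1 / real (\<Prod>P) * (1 / (real k)\<^sup>2))"
  have prods: "\<Prod>(prime_factors (squarefree_part n)) = squarefree_part n" for n :: nat
    by (intro prod_prime_factors_squarefree) simp
  have "inj \<phi>"
  proof (rule injI)
    fix m n assume *: "\<phi> m = \<phi> n"
    then have "squarefree_part m = squarefree_part n" using prods by (metis \<phi>_def prod.inject)
    with * show "m = n" by (metis \<phi>_def prod.inject squarefree_decompose)
  qed
  have img: "\<phi> ` {1..?K} \<subseteq> ?S \<times> {1..?K}"
  proof (rule image_subsetI)
    fix n assume n: "n \<in> {1..?K}"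
    then have "n \<noteq> 0" by auto
    have dv: "squarefree_part n dvd n" "square_part n dvd n"
      using squarefree_decompose[of n] by (metis dvd_triv_left, metis dvd_mult dvd_power pos2)
    then have le: "squarefree_part n \<le> n" "square_part n \<le> n"
      using \<open>n \<noteq> 0\<close> by (auto intro: dvd_imp_le)
    have nR: "real n \<le> R" using n assms by (simp add: le_nat_iff le_floor_iff)
    have "1 \<le> square_part n" using \<open>n \<noteq> 0\<close> square_part_0_iff[of n] by linarith
    moreover have "prime_factors (squarefree_part n) \<in> prime_sets 1"
      by (auto simp: prime_sets_def in_prime_factors_iff)
    ultimately show "\<phi> n \<in> ?S \<times> {1..?K}"
      using le n nR by (auto simp: \<phi>_def sieve_sets_def prods)
  qed
  have "ln R \<le> ln (real ?K + 1)" using assms by (subst ln_le_cancel_iff) linarith+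
  also have "\<dots> \<le> harm ?K" by (rule ln_le_harm)
  also have "\<dots> = (\<Sum>n\<in>{1..?K}. h (\<phi> n))"
    unfolding harm_def
  proof (intro sum.cong refl)
    fix n :: nat
    have "real n = real (squarefree_part n) * (real (square_part n))\<^sup>2"
      by (metis of_nat_mult of_nat_power squarefree_decompose)
    then show "inverse (real n) = h (\<phi> n)"
      by (simp add: h_def \<phi>_def prods field_simps)
  qed
  also have "\<dots> = (\<Sum>v\<in>\<phi> ` {1..?K}. h v)"
    using \<open>inj \<phi>\<close> by (subst sum.reindex) (auto intro: inj_on_subset)
  also have "\<dots> \<le> (\<Sum>v\<in>?S \<times> {1..?K}. h v)"
    using img by (intro sum_mono2) (auto simp: h_def)
  also have "\<dots> = (\<Sum>P\<in>?S. 1 / real (\<Prod>P)) * (\<Sum>k\<in>{1..?K}. 1 / (real k)\<^sup>2)"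
    unfolding h_def sum.cartesian_product[symmetric] sum_product by simp
  also have "\<dots> \<le> sieve_mass 1 R * 2"
  proof (rule mult_mono)
    show "(\<Sum>P\<in>?S. 1 / real (\<Prod>P)) \<le> sieve_mass 1 R"
      unfolding sieve_mass_def by (intro sum_mono inv_phi_ge[of _ 1]) (simp add: sieve_sets_def)
    show "(\<Sum>k\<in>{1..?K}. 1 / (real k)\<^sup>2) \<le> 2"
      using sum_inverse_squares_le[of ?K] by (smt (verit) divide_nonneg_nonneg of_nat_0_le_iff)
    show "0 \<le> sieve_mass 1 R" using sieve_mass_ge_1[OF assms, of 1] by linarith
  qed (auto intro: sum_nonneg)
  finally show ?thesis by simp
qed

text \<open>Splitting every squarefree modulus into a part dividing \<open>y\<close> and a part
  coprime to \<open>y\<close> shows that dropping the primes of \<open>y\<close> costs at most the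
  product of 1 + 1/(p-1) over these primes, which is y/\<phi>(y).\<close>

lemma sieve_mass_ge:
  assumes "R \<ge> 1" "y \<ge> 1"
  shows "real (totient y) / real y * ln R / 2 \<le> sieve_mass y R"
proof -
  let ?F = "prime_factors y"
  let ?h = "\<lambda>v. inv_phi (fst v) * inv_phi (snd v)"
  have p2: "2 \<le> p" if "p \<in> ?F" for p using that by (auto intro: prime_ge_2_nat)
  define \<phi> where "\<phi> P = (P \<inter> ?F, P - ?F)" for P :: "nat set"
  have inj: "inj \<phi>" by (rule injI) (auto simp: \<phi>_def)
  have down: "P - ?F \<in> sieve_sets y R" if "P \<in> sieve_sets 1 R" for P
  proof -
    have "P - ?F \<in> sieve_sets 1 R" using that by (rule sieve_sets_down) auto
    moreover have "\<not> p dvd y" if "p \<in> P - ?F" for p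
      using that assms \<open>P \<in> sieve_sets 1 R\<close> by (auto simp: sieve_sets_def prime_sets_def prime_factors_dvd)
    ultimately show ?thesis by (auto simp: sieve_sets_def prime_sets_def)
  qed
  have "sieve_mass 1 R = (\<Sum>P\<in>sieve_sets 1 R. ?h (\<phi> P))"
    unfolding sieve_mass_def
  proof (intro sum.cong refl)
    fix P assume "P \<in> sieve_sets 1 R"
    then have "finite P" by (auto simp: sieve_sets_def prime_sets_def)
    have "P = (P \<inter> ?F) \<union> (P - ?F)" by auto
    then have "inv_phi P = inv_phi ((P \<inter> ?F) \<union> (P - ?F))" by simp
    also have "\<dots> = inv_phi (P \<inter> ?F) * inv_phi (P - ?F)"
      using \<open>finite P\<close> by (intro inv_phi_Un) auto
    finally show "inv_phi P = ?h (\<phi> P)" by (simp add: \<phi>_def)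
  qed
  also have "\<dots> = (\<Sum>v\<in>\<phi> ` sieve_sets 1 R. ?h v)"
    using inj by (subst sum.reindex) (auto intro: inj_on_subset)
  also have "\<dots> \<le> (\<Sum>v\<in>Pow ?F \<times> sieve_sets y R. ?h v)"
  proof (rule sum_mono2)
    show "\<phi> ` sieve_sets 1 R \<subseteq> Pow ?F \<times> sieve_sets y R"
      using down by (auto simp: \<phi>_def)
    fix v assume "v \<in> Pow ?F \<times> sieve_sets y R - \<phi> ` sieve_sets 1 R"
    then have "fst v \<subseteq> ?F" "snd v \<in> prime_sets y" by (auto simp: sieve_sets_def)
    then have "fst v \<in> prime_sets 1"
      using finite_subset[of "fst v" ?F] by (auto simp: prime_sets_def in_prime_factors_iff subset_iff)
    then show "0 \<le> ?h v"
      using \<open>snd v \<in> prime_sets y\<close> by (intro mult_nonneg_nonneg less_imp_le inv_phi_pos)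
  qed auto
  also have "\<dots> = (\<Sum>A\<in>Pow ?F. inv_phi A) * sieve_mass y R"
    unfolding sieve_mass_def sum_product sum.cartesian_product by (simp add: case_prod_unfold)
  also have "(\<Sum>A\<in>Pow ?F. inv_phi A) = (\<Prod>p\<in>?F. 1 / (real p - 1) + 1)"
    by (subst prod_add) (auto simp: inv_phi_def)
  also have "\<dots> = inverse (\<Prod>p\<in>?F. 1 - 1 / real p)"
    unfolding prod_inversef[symmetric] comp_def
  proof (intro prod.cong refl)
    fix p assume "p \<in> ?F"
    then have "2 \<le> real p" using p2[of p] by simp
    then show "1 / (real p - 1) + 1 = inverse (1 - 1 / real p)" by (simp add: divide_simps)
  qed
  finally have 1: "sieve_mass 1 R \<le> inverse (\<Prod>p\<in>?F. 1 - 1 / real p) * sieve_mass y R" .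
  have pos: "(\<Prod>p\<in>?F. 1 - 1 / real p) > 0"
    using p2 by (intro prod_pos) (force simp: divide_simps)
  have "real (totient y) / real y = (\<Prod>p\<in>?F. 1 - 1 / real p)"
    using assms by (simp add: totient_formula2)
  then have "real (totient y) / real y * ln R / 2 \<le> (\<Prod>p\<in>?F. 1 - 1 / real p) * sieve_mass 1 R"
    using sieve_mass_1_ge[OF assms(1)] pos by simp
  also have "\<dots> \<le> sieve_mass y R" using 1 pos by (simp add: field_simps)
  finally show ?thesis .
qed

section \<open>Divisor-type bounds uniform in the modulus y\<close>

text \<open>The classical bound for A^\<omega>(q): primes above A^(1/\<eta>) satisfy A <= p^\<eta>,
  and the boundedly many smaller ones contribute only to the constant.\<close>

lemma power_card_le_powr:
  fixes A \<eta> :: real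
  assumes "A \<ge> 1" "\<eta> > 0"
  obtains C where "C \<ge> 1" "\<And>y P. P \<in> prime_sets y \<Longrightarrow> A ^ card P \<le> C * real (\<Prod>P) powr \<eta>"
proof -
  define K where "K = nat \<lceil>A powr (1 / \<eta>)\<rceil>"
  have small: "A \<le> real p powr \<eta>" if "p > K" for p
  proof -
    have "A powr (1 / \<eta>) \<le> real p" using that unfolding K_def by linarith
    then have "(A powr (1 / \<eta>)) powr \<eta> \<le> real p powr \<eta>" using assms by (intro powr_mono2) auto
    then show ?thesis using assms by (simp add: powr_powr)
  qed
  show thesis
  proof
    show "A ^ (K + 1) \<ge> 1" using assms by (rule_tac one_le_power) auto
    fix y P assume P: "P \<in> prime_sets y"
    have fin: "finite P" using P by (auto dest: prime_setsD)
    let ?B = "P \<inter> {..K}" and ?D = "P - {..K}"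
    have "card ?B \<le> card {..K}" using fin by (intro card_mono) auto
    then have "A ^ card ?B \<le> A ^ (K + 1)" using assms by (intro power_increasing) auto
    moreover have "A ^ card ?D \<le> real (\<Prod>P) powr \<eta>"
    proof -
      have "A ^ card ?D = (\<Prod>p\<in>?D. A)" by simp
      also have "\<dots> \<le> (\<Prod>p\<in>?D. real p powr \<eta>)" using assms small by (intro prod_mono) auto
      also have "\<dots> = real (\<Prod>?D) powr \<eta>" by (simp add: of_nat_prod prod_powr_distrib)
      also have "\<dots> \<le> real (\<Prod>P) powr \<eta>"
        using assms prod_mono_prime_sets[OF P, of ?D] by (intro powr_mono2) auto
      finally show ?thesis .
    qed
    moreover have "card P = card ?B + card ?D"
      using fin by (subst card_Un_disjoint[symmetric]) (auto intro!: arg_cong[where f = card])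
    ultimately show "A ^ card P \<le> A ^ (K + 1) * real (\<Prod>P) powr \<eta>"
      using assms by (auto simp: power_add intro!: mult_mono)
  qed
qed

lemma harm_le_ln: "n \<ge> 1 \<Longrightarrow> harm n \<le> 1 + ln (real n)"
proof -
  assume "n \<ge> 1"
  then obtain m where "n = Suc m" by (cases n) auto
  then show ?thesis using decseqD[OF decseq_harm_diff_ln, of 0 m] by (simp add: harm_def)
qed

text \<open>Half of \<eta> absorbs the power of \<open>A\<close>, the other half the logarithm
  coming from the harmonic sum.\<close>

lemma sum_power_card_div_le:
  fixes A \<eta> :: real
  assumes "A \<ge> 1" "\<eta> > 0"
  obtains C where "C \<ge> 1"
    "\<And>y z. z \<ge> 1 \<Longrightarrow> (\<Sum>P\<in>sieve_sets y z. A ^ card P / real (\<Prod>P)) \<le> C * z powr \<eta>"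
proof -
  obtain C where C: "C \<ge> 1" "\<And>y P. P \<in> prime_sets y \<Longrightarrow> A ^ card P \<le> C * real (\<Prod>P) powr (\<eta> / 2)"
    using power_card_le_powr[of A "\<eta> / 2"] assms by auto
  show thesis
  proof
    show "C * (1 + 2 / \<eta>) \<ge> 1" using C assms by (intro mult_ge1_I) auto
    fix y :: nat and z :: real assume z: "z \<ge> 1"
    have "(\<Sum>P\<in>sieve_sets y z. A ^ card P / real (\<Prod>P)) \<le> (\<Sum>P\<in>sieve_sets y z. C * z powr (\<eta> / 2) * (1 / real (\<Prod>P)))"
    proof (rule sum_mono)
      fix P assume P: "P \<in> sieve_sets y z"
      then have "A ^ card P \<le> C * real (\<Prod>P) powr (\<eta> / 2)" by (intro C(2)[of P y]) (simp add: sieve_sets_def)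
      also have "\<dots> \<le> C * z powr (\<eta> / 2)"
        using C assms P by (intro mult_left_mono powr_mono2) (auto simp: sieve_sets_def)
      finally show "A ^ card P / real (\<Prod>P) \<le> C * z powr (\<eta> / 2) * (1 / real (\<Prod>P))"
        by (simp add: divide_right_mono)
    qed
    also have "\<dots> = C * z powr (\<eta> / 2) * (\<Sum>P\<in>sieve_sets y z. 1 / real (\<Prod>P))"
      by (simp add: sum_distrib_left)
    also have "\<dots> \<le> C * z powr (\<eta> / 2) * ((1 + 2 / \<eta>) * z powr (\<eta> / 2))"
    proof (intro mult_left_mono)
      have "(\<Sum>P\<in>sieve_sets y z. 1 / real (\<Prod>P)) \<le> (\<Sum>n=1..nat \<lfloor>z\<rfloor>. 1 / real n)"
        by (rule sum_sieve_sets_le) auto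
      also have "\<dots> = harm (nat \<lfloor>z\<rfloor>)" by (simp add: harm_def field_simps)
      also have "\<dots> \<le> 1 + ln (real (nat \<lfloor>z\<rfloor>))" using z by (intro harm_le_ln) (simp add: le_nat_iff)
      also have "\<dots> \<le> 1 + ln z" using z by (simp add: ln_mono)
      also have "\<dots> \<le> z powr (\<eta> / 2) + z powr (\<eta> / 2) / (\<eta> / 2)"
        using z assms by (intro add_mono ge_one_powr_ge_zero ln_powr_bound) auto
      finally show "(\<Sum>P\<in>sieve_sets y z. 1 / real (\<Prod>P)) \<le> (1 + 2 / \<eta>) * z powr (\<eta> / 2)"
        by (simp add: algebra_simps)
    qed (use C in auto)
    also have "\<dots> = C * (1 + 2 / \<eta>) * (z powr (\<eta> / 2) * z powr (\<eta> / 2))" by simp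
    also have "z powr (\<eta> / 2) * z powr (\<eta> / 2) = z powr \<eta>" by (simp flip: powr_add)
    finally show "(\<Sum>P\<in>sieve_sets y z. A ^ card P / real (\<Prod>P)) \<le> C * (1 + 2 / \<eta>) * z powr \<eta>" .
  qed
qed

section \<open>Moments through truncated divisor functions\<close>

lemma prod_dvd_iff_prime_sets:
  assumes "P \<in> prime_sets y"
  shows "int (\<Prod>P) dvd n \<longleftrightarrow> (\<forall>p\<in>P. int p dvd n)"
proof
  assume L: "int (\<Prod>P) dvd n"
  show "\<forall>p\<in>P. int p dvd n"
  proof
    fix p assume "p \<in> P"
    then have "p dvd \<Prod>P" using assms by (intro dvd_prodI) (auto dest: prime_setsD)
    then show "int p dvd n" using L by (meson dvd_trans of_nat_dvd_iff)
  qed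
next
  assume R: "\<forall>p\<in>P. int p dvd n"
  have "finite P" "\<And>p. p \<in> P \<Longrightarrow> prime p" using assms by (auto dest: prime_setsD)
  then show "int (\<Prod>P) dvd n" using R
  proof (induction P rule: finite_induct)
    case (insert p P)
    have "coprime p (\<Prod>P)"
      using insert by (intro prod_coprime_right primes_coprime) auto
    then have "coprime (int p) (int (\<Prod>P))" by (simp only: coprime_int_iff)
    then have "int p * int (\<Prod>P) dvd n" using insert by (intro divides_mult) auto
    then show ?case using insert by simp
  qed simp
qed

definition sieve_divisors :: "nat \<Rightarrow> real \<Rightarrow> int \<Rightarrow> nat set set" where
  "sieve_divisors y z n = {D \<in> sieve_sets y z. int (\<Prod>D) dvd n}"

lemma finite_sieve_divisors [simp]: "finite (sieve_divisors y z n)"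
  unfolding sieve_divisors_def by simp

text \<open>A k-tuple of squarefree divisors of \<open>n\<close> up to \<open>z\<close> has a least
  common multiple that again divides \<open>n\<close> and is at most \<open>z ^ k\<close>; on prime
  sets it is the union. The induction joins one divisor at a time, and a given union
  \<open>E\<close> arises from at most \<open>4 ^ card E\<close> pairs. Keeping the truncation is
  the point: moduli up to \<open>z ^ k\<close> can still be counted in an interval of length at
  least \<open>z ^ k\<close>.\<close>

lemma card_sieve_divisors_power_le:
  assumes z: "z \<ge> 1"
  shows "real (card (sieve_divisors y z n)) ^ k \<le> (\<Sum>D\<in>sieve_divisors y (z ^ k) n. (4 ^ k) ^ card D)"
proof (induction k)
  case 0
  have "sieve_divisors y 1 n \<noteq> {}"
    using empty_in_sieve_sets[of 1 y] by (auto simp: sieve_divisors_def)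
  then have "card (sieve_divisors y 1 n) \<ge> 1" by (simp add: Suc_le_eq card_gt_0_iff)
  then show ?case by simp
next
  case (Suc k)
  let ?A = "sieve_divisors y z n" and ?B = "sieve_divisors y (z ^ k) n"
  let ?E = "sieve_divisors y (z ^ Suc k) n"
  define \<phi> where "\<phi> = (\<lambda>(d, D). d \<union> D :: nat set)"
  have \<phi>: "\<phi> ` (?A \<times> ?B) \<subseteq> ?E"
  proof safe
    fix d D assume "d \<in> ?A" "D \<in> ?B"
    then have *: "d \<in> prime_sets y" "D \<in> prime_sets y" "real (\<Prod>d) \<le> z" "real (\<Prod>D) \<le> z ^ k"
      "int (\<Prod>d) dvd n" "int (\<Prod>D) dvd n" by (auto simp: sieve_divisors_def sieve_sets_def)
    have un: "d \<union> D \<in> prime_sets y" using * by (intro prime_sets_Un)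
    have "finite d" "finite D" using * by (auto dest: prime_setsD)
    then have "\<Prod>(d \<union> D) = \<Prod>d * \<Prod>(D - d)"
      by (metis Diff_disjoint Un_Diff_cancel finite_Diff prod.union_disjoint)
    also have "\<dots> \<le> \<Prod>d * \<Prod>D" using * by (intro mult_left_mono prod_mono_prime_sets[of _ y]) auto
    finally have "real (\<Prod>(d \<union> D)) \<le> real (\<Prod>d) * real (\<Prod>D)" by (metis of_nat_mono of_nat_mult)
    also have "\<dots> \<le> z * z ^ k" using * z by (intro mult_mono) auto
    finally have "real (\<Prod>(d \<union> D)) \<le> z ^ Suc k" by simp
    moreover have "int (\<Prod>(d \<union> D)) dvd n"
      using * by (auto simp: prod_dvd_iff_prime_sets[OF un] prod_dvd_iff_prime_sets)
    ultimately show "\<phi> (d, D) \<in> ?E" using un by (simp add: \<phi>_def sieve_divisors_def sieve_sets_def)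
  qed
  have fin: "finite D" if "D \<in> sieve_divisors y z n" for D z
    using that by (auto simp: sieve_divisors_def sieve_sets_def prime_sets_def)
  have "real (card ?A) ^ Suc k \<le> real (card ?A) * (\<Sum>D\<in>?B. (4 ^ k) ^ card D)"
    using Suc by (simp add: mult_left_mono)
  also have "\<dots> = (\<Sum>v\<in>?A \<times> ?B. (4 ^ k) ^ card (snd v))"
    by (subst sum_Times_snd) simp
  also have "\<dots> \<le> (\<Sum>v\<in>?A \<times> ?B. (4 ^ k) ^ card (\<phi> v))"
    using fin by (intro sum_mono power_increasing) (auto simp: \<phi>_def intro!: card_mono)
  also have "\<dots> = (\<Sum>E\<in>?E. \<Sum>v\<in>{v\<in>?A \<times> ?B. \<phi> v = E}. (4 ^ k) ^ card (\<phi> v))"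
    by (rule sum.group[symmetric]) (use \<phi> in auto)
  also have "\<dots> \<le> (\<Sum>E\<in>?E. (4 ^ Suc k) ^ card E)"
  proof (rule sum_mono)
    fix E assume "E \<in> ?E"
    then have "finite E" by (rule fin)
    have "card {v\<in>?A \<times> ?B. \<phi> v = E} \<le> card (Pow E \<times> Pow E)"
      using \<open>finite E\<close> by (intro card_mono) (auto simp: \<phi>_def)
    also have "\<dots> = 4 ^ card E"
      using \<open>finite E\<close> by (simp add: card_Pow flip: power_mult_distrib)
    finally have "real (card {v\<in>?A \<times> ?B. \<phi> v = E}) \<le> real (4 ^ card E)" by (rule of_nat_mono)
    also have "\<dots> = 4 ^ card E" by simp
    finally have "real (card {v\<in>?A \<times> ?B. \<phi> v = E}) \<le> 4 ^ card E" .
    then have "real (card {v\<in>?A \<times> ?B. \<phi> v = E}) * (4 ^ k) ^ card E \<le> 4 ^ card E * (4 ^ k) ^ card E"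
      by (intro mult_right_mono) auto
    then show "(\<Sum>v\<in>{v\<in>?A \<times> ?B. \<phi> v = E}. (4 ^ k) ^ card (\<phi> v)) \<le> ((4::real) ^ Suc k) ^ card E"
      by (simp add: power_mult_distrib)
  qed
  finally show ?case .
qed

text \<open>As \<open>D\<close> is coprime to \<open>y\<close>, all solutions are congruent to the
  least one modulo \<open>D\<close>.\<close>

lemma card_dvd_progression_le:
  fixes a b :: int and y D L :: nat
  assumes "coprime D y" "D > 0"
  shows "real (card {m\<in>{a..<a + int L}. int D dvd b + int y * m}) \<le> real L / real D + 1"
proof (cases "{m\<in>{a..<a + int L}. int D dvd b + int y * m} = {}")
  case False
  let ?M = "{m\<in>{a..<a + int L}. int D dvd b + int y * m}"
  have fin: "finite ?M" by (rule finite_subset[of _ "{a..<a + int L}"]) auto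
  define m0 where "m0 = Min ?M"
  have m0: "m0 \<in> ?M" "\<And>m. m \<in> ?M \<Longrightarrow> m0 \<le> m"
    using Min_in[OF fin False] Min_le[OF fin] by (auto simp: m0_def)
  have dv: "int D dvd m - m0" if "m \<in> ?M" for m
  proof -
    have "int D dvd (b + int y * m) - (b + int y * m0)" using that m0 by (intro dvd_diff) auto
    then have "int D dvd int y * (m - m0)" by (simp add: algebra_simps)
    then show ?thesis using assms by (simp add: coprime_dvd_mult_right_iff)
  qed
  have "inj_on (\<lambda>m. (m - m0) div int D) ?M"
  proof (rule inj_onI)
    fix m m' assume "m \<in> ?M" "m' \<in> ?M" "(m - m0) div int D = (m' - m0) div int D"
    then have "m - m0 = m' - m0" using dv by (metis dvd_div_mult_self)
    then show "m = m'" by simp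
  qed
  moreover have "(\<lambda>m. (m - m0) div int D) ` ?M \<subseteq> {0..int L div int D}"
  proof safe
    fix m assume m: "m \<in> {a..<a + int L}" "int D dvd b + int y * m"
    then have "m0 \<le> m" "m - m0 \<le> int L" using m0 by auto
    then show "(m - m0) div int D \<in> {0..int L div int D}"
      using assms by (auto intro: zdiv_mono1 simp: pos_imp_zdiv_nonneg_iff)
  qed
  ultimately have "card ?M \<le> card {0..int L div int D}"
    by (intro card_inj_on_le) auto
  also have "\<dots> = L div D + 1" by (simp add: nat_add_distrib flip: zdiv_int)
  finally have "real (card ?M) \<le> real (L div D) + 1" by linarith
  then show ?thesis using of_nat_div_le_of_nat[of L D, where ?'a = real] by linarith
qed (simp only: card.empty, simp)

text \<open>The right side is the greatest common divisor of \<open>n\<close> and the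
  modulus.\<close>

lemma abs_ram_prod_le:
  assumes "P \<in> prime_sets y"
  shows "\<bar>ram_prod P n\<bar> \<le> real (\<Prod>{p\<in>P. int p dvd n})"
proof -
  have fin: "finite P" using assms by (auto dest: prime_setsD)
  have "\<bar>ram_prod P n\<bar> \<le> (\<Prod>p\<in>P. if int p dvd n then real p else 1)"
    unfolding ram_prod_def abs_prod using prime_setsD(4)[OF assms]
    by (intro prod_mono) (force simp: ram_def)
  also have "\<dots> = real (\<Prod>{p\<in>P. int p dvd n})"
    using fin by (subst prod.inter_filter[symmetric]) (auto simp: of_nat_prod)
  finally show ?thesis .
qed

text \<open>Let d be the part of the modulus q that divides \<open>n\<close>. The Ramanujan sum is
  at most d and the weight at most 8^\<omega>(q)/q, which leaves 8^\<omega>(q)/(q/d). The pair (d,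
  q/d) determines q; summing over q/d costs a logarithm and summing over d counts divisors of
  \<open>n\<close>. Only absolute values enter, so the bound holds for every subfamily
  \<open>F\<close>, in particular for dyadic pieces.\<close>

lemma sieve_kernel_bound:
  fixes \<eta> :: real
  assumes "\<eta> > 0"
  obtains C where "C \<ge> 1"
    "\<And>y z w F n. z \<ge> 1 \<Longrightarrow> F \<subseteq> sieve_sets y z \<Longrightarrow>
      sieve_weight y w \<Longrightarrow>
      \<bar>\<Sum>P\<in>F. w P * ram_prod P n\<bar> \<le> C * z powr \<eta> * real (card (sieve_divisors y z n))"
proof -
  \<comment> \<open>8 = 4 * 2: the 4 comes from \<open>sieve_weight\<close>, the 2 from p/(p-1) <= 2
    at each prime.\<close>
  obtain C1 where C1: "C1 \<ge> 1" "\<And>y P. P \<in> prime_sets y \<Longrightarrow> 8 ^ card P \<le> C1 * real (\<Prod>P) powr (\<eta> / 2)"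
    using power_card_le_powr[of 8 "\<eta> / 2"] assms by auto
  obtain C2 where C2: "C2 \<ge> 1"
    "\<And>y z. z \<ge> 1 \<Longrightarrow> (\<Sum>P\<in>sieve_sets y z. 1 ^ card P / real (\<Prod>P)) \<le> C2 * z powr (\<eta> / 2)"
    using sum_power_card_div_le[of 1 "\<eta> / 2"] assms by auto
  show thesis
  proof
    show "C1 * C2 \<ge> 1" using C1 C2 by (intro mult_ge1_I)
    fix y z F n and w :: "nat set \<Rightarrow> real"
    assume z: "z \<ge> 1" and F: "F \<subseteq> sieve_sets y z"
      and w: "sieve_weight y w"
    let ?d = "\<lambda>P. {p\<in>P. int p dvd n}"
    let ?S = "sieve_sets y z" and ?T = "sieve_divisors y z n"
    define h where "h v = 1 / real (\<Prod>(snd v))" for v :: "nat set \<times> nat set"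
    define \<phi> where "\<phi> P = (?d P, P - ?d P)" for P
    have inj: "inj \<phi>" by (rule injI) (auto simp: \<phi>_def)
    have "\<bar>\<Sum>P\<in>F. w P * ram_prod P n\<bar> \<le> (\<Sum>P\<in>F. \<bar>w P * ram_prod P n\<bar>)" by (rule sum_abs)
    also have "\<dots> \<le> (\<Sum>P\<in>?S. \<bar>w P * ram_prod P n\<bar>)" using F by (intro sum_mono2) auto
    also have "\<dots> \<le> (\<Sum>P\<in>?S. C1 * z powr (\<eta> / 2) * h (\<phi> P))"
    proof (rule sum_mono)
      fix P assume "P \<in> ?S"
      then have P: "P \<in> prime_sets y" "real (\<Prod>P) \<le> z" by (auto simp: sieve_sets_def)
      have fin: "finite P" using P by (auto dest: prime_setsD)
      have pos: "0 < \<Prod>(?d P)" "0 < \<Prod>(P - ?d P)"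
        using prod_pos_prime_sets[OF prime_sets_subset[OF P(1)]] by auto
      have split: "\<Prod>P = \<Prod>(?d P) * \<Prod>(P - ?d P)"
        using fin by (subst prod.union_disjoint[symmetric]) (auto intro!: prod.cong)
      have "\<bar>w P\<bar> \<le> 4 ^ card P * inv_phi P" using P w by (simp add: sieve_weight_def)
      also have "\<dots> \<le> 4 ^ card P * (2 ^ card P / real (\<Prod>P))"
        using inv_phi_le[OF P(1)] by (intro mult_left_mono) auto
      also have "\<dots> = 8 ^ card P / real (\<Prod>P)"
        by (simp flip: power_mult_distrib)
      finally have "\<bar>w P * ram_prod P n\<bar> \<le> 8 ^ card P / real (\<Prod>P) * real (\<Prod>(?d P))"
        unfolding abs_mult using abs_ram_prod_le[OF P(1), of n] by (intro mult_mono) auto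
      also have "\<dots> = 8 ^ card P * h (\<phi> P)"
        unfolding split h_def \<phi>_def using pos by simp
      also have "8 ^ card P \<le> C1 * z powr (\<eta> / 2)"
      proof -
        have "8 ^ card P \<le> C1 * real (\<Prod>P) powr (\<eta> / 2)" using P by (intro C1)
        also have "\<dots> \<le> C1 * z powr (\<eta> / 2)" using P C1 assms by (intro mult_left_mono powr_mono2) auto
        finally show ?thesis .
      qed
      then have "8 ^ card P * h (\<phi> P) \<le> C1 * z powr (\<eta> / 2) * h (\<phi> P)"
        by (intro mult_right_mono) (auto simp: h_def)
      finally show "\<bar>w P * ram_prod P n\<bar> \<le> C1 * z powr (\<eta> / 2) * h (\<phi> P)" .
    qed
    also have "\<dots> = C1 * z powr (\<eta> / 2) * (\<Sum>v\<in>\<phi> ` ?S. h v)"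
      using inj by (subst sum.reindex) (auto intro: inj_on_subset simp: sum_distrib_left)
    also have "\<dots> \<le> C1 * z powr (\<eta> / 2) * (\<Sum>v\<in>?T \<times> ?S. h v)"
    proof (intro mult_left_mono sum_mono2)
      show "\<phi> ` ?S \<subseteq> ?T \<times> ?S"
      proof (rule image_subsetI)
        fix P assume P: "P \<in> ?S"
        then have "?d P \<in> ?S" "P - ?d P \<in> ?S" by (auto intro: sieve_sets_down[OF P])
        moreover from this have "int (\<Prod>(?d P)) dvd n"
          by (subst prod_dvd_iff_prime_sets[of _ y]) (auto simp: sieve_sets_def)
        ultimately show "\<phi> P \<in> ?T \<times> ?S" by (simp add: \<phi>_def sieve_divisors_def)
      qed
    qed (use C1 in \<open>auto simp: h_def\<close>)
    also have "(\<Sum>v\<in>?T \<times> ?S. h v) = real (card ?T) * (\<Sum>P\<in>?S. 1 / real (\<Prod>P))"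
      unfolding h_def by (rule sum_Times_snd)
    also have "C1 * z powr (\<eta> / 2) * \<dots> \<le> C1 * z powr (\<eta> / 2) * (real (card ?T) * (C2 * z powr (\<eta> / 2)))"
      using C2(2)[OF z, of y] C1 by (intro mult_left_mono) auto
    also have "\<dots> = C1 * C2 * (z powr (\<eta> / 2) * z powr (\<eta> / 2)) * real (card ?T)" by simp
    also have "z powr (\<eta> / 2) * z powr (\<eta> / 2) = z powr \<eta>" by (simp flip: powr_add)
    finally show "\<bar>\<Sum>P\<in>F. w P * ram_prod P n\<bar> \<le> C1 * C2 * z powr \<eta> * real (card ?T)" .
  qed
qed

text \<open>The pointwise bound reduces the moment to one of the divisor count, whose power is a sum
  over single divisors up to \<open>z ^ k\<close>. Exchanging the sums leaves, for each divisor, the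
  number of its multiples along the progression.\<close>

lemma sieve_kernel_moment:
  fixes \<eta> :: real and k :: nat
  assumes \<eta>: "\<eta> > 0"
  obtains C where "C \<ge> 1"
    "\<And>y z w F a b L. z \<ge> 1 \<Longrightarrow> F \<subseteq> sieve_sets y z \<Longrightarrow>
      sieve_weight y w \<Longrightarrow> z ^ k \<le> real L \<Longrightarrow>
      (\<Sum>m\<in>{a..<a + int L}. \<bar>\<Sum>P\<in>F. w P * ram_prod P (b + int y * m)\<bar> ^ k) \<le> C * z powr (\<eta> * real k) * real L"
proof -
  obtain C1 where C1: "C1 \<ge> 1"
    "\<And>y z w F n. z \<ge> 1 \<Longrightarrow> F \<subseteq> sieve_sets y z \<Longrightarrow>
      sieve_weight y w \<Longrightarrow>
      \<bar>\<Sum>P\<in>F. w P * ram_prod P n\<bar> \<le> C1 * z powr (\<eta> / 2) * real (card (sieve_divisors y z n))"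
    using sieve_kernel_bound[of "\<eta> / 2"] \<eta> by auto
  obtain C2 where C2: "C2 \<ge> 1"
    "\<And>y z. z \<ge> 1 \<Longrightarrow> (\<Sum>P\<in>sieve_sets y z. (4 ^ k) ^ card P / real (\<Prod>P)) \<le> C2 * z powr (\<eta> / 2)"
    using sum_power_card_div_le[of "4 ^ k" "\<eta> / 2"] \<eta> by auto
  show thesis
  proof
    show "C1 ^ k * (2 * C2) \<ge> 1" using C1 C2 by (intro mult_ge1_I one_le_power) auto
    fix y z F a b L and w :: "nat set \<Rightarrow> real"
    assume z: "z \<ge> 1" and F: "F \<subseteq> sieve_sets y z"
      and w: "sieve_weight y w" and L: "z ^ k \<le> real L"
    let ?I = "{a..<a + int L}" and ?n = "\<lambda>m. b + int y * m" and ?S = "sieve_sets y (z ^ k)"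
    have "(\<Sum>m\<in>?I. \<bar>\<Sum>P\<in>F. w P * ram_prod P (?n m)\<bar> ^ k) \<le>
        (\<Sum>m\<in>?I. (C1 * z powr (\<eta> / 2)) ^ k * (\<Sum>D\<in>sieve_divisors y (z ^ k) (?n m). (4 ^ k) ^ card D))"
    proof (rule sum_mono)
      fix m
      have "\<bar>\<Sum>P\<in>F. w P * ram_prod P (?n m)\<bar> ^ k \<le> (C1 * z powr (\<eta> / 2) * real (card (sieve_divisors y z (?n m)))) ^ k"
        using C1(2)[OF z F w] by (intro power_mono) auto
      also have "\<dots> = (C1 * z powr (\<eta> / 2)) ^ k * real (card (sieve_divisors y z (?n m))) ^ k"
        by (simp add: power_mult_distrib)
      also have "\<dots> \<le> (C1 * z powr (\<eta> / 2)) ^ k * (\<Sum>D\<in>sieve_divisors y (z ^ k) (?n m). (4 ^ k) ^ card D)"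
        using C1 by (intro mult_left_mono card_sieve_divisors_power_le z) auto
      finally show "\<bar>\<Sum>P\<in>F. w P * ram_prod P (?n m)\<bar> ^ k \<le>
          (C1 * z powr (\<eta> / 2)) ^ k * (\<Sum>D\<in>sieve_divisors y (z ^ k) (?n m). (4 ^ k) ^ card D)" .
    qed
    also have "\<dots> = (C1 * z powr (\<eta> / 2)) ^ k *
        (\<Sum>m\<in>?I. \<Sum>D\<in>?S. if int (\<Prod>D) dvd ?n m then (4 ^ k) ^ card D else 0)"
      unfolding sieve_divisors_def by (simp add: sum_distrib_left sum.inter_filter)
    also have "(\<Sum>m\<in>?I. \<Sum>D\<in>?S. if int (\<Prod>D) dvd ?n m then (4 ^ k) ^ card D else 0) =
        (\<Sum>D\<in>?S. \<Sum>m\<in>?I. if int (\<Prod>D) dvd ?n m then (4 ^ k) ^ card D else 0)"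
      by (rule sum.swap)
    also have "\<dots> = (\<Sum>D\<in>?S. real (card {m\<in>?I. int (\<Prod>D) dvd ?n m}) * (4 ^ k) ^ card D)"
      by (intro sum.cong refl) (simp flip: sum.inter_filter)
    also have "\<dots> \<le> (\<Sum>D\<in>?S. 2 * real L * ((4 ^ k) ^ card D / real (\<Prod>D)))"
    proof (rule sum_mono)
      fix D assume "D \<in> ?S"
      then have D: "D \<in> prime_sets y" "real (\<Prod>D) \<le> z ^ k" by (auto simp: sieve_sets_def)
      have pos: "0 < \<Prod>D" using D prod_pos_prime_sets by blast
      have "coprime (\<Prod>D) y"
        using D by (intro prod_coprime_left) (auto simp: prime_sets_def prime_imp_coprime)
      then have "real (card {m\<in>?I. int (\<Prod>D) dvd ?n m}) \<le> real L / real (\<Prod>D) + 1"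
        using pos by (intro card_dvd_progression_le)
      \<comment> \<open>The hypothesis \<open>z ^ k <= L\<close> is spent here: the interval is at
        least as long as every divisor, so the additive 1 in the count is absorbed.\<close>
      also have "1 \<le> real L / real (\<Prod>D)" using D L pos by (simp add: field_simps)
      finally have "real (card {m\<in>?I. int (\<Prod>D) dvd ?n m}) \<le> 2 * real L / real (\<Prod>D)" by simp
      then have "real (card {m\<in>?I. int (\<Prod>D) dvd ?n m}) * (4 ^ k) ^ card D \<le> 2 * real L / real (\<Prod>D) * (4 ^ k) ^ card D"
        by (intro mult_right_mono) auto
      then show "real (card {m\<in>?I. int (\<Prod>D) dvd ?n m}) * (4 ^ k) ^ card D \<le> 2 * real L * ((4 ^ k) ^ card D / real (\<Prod>D))"
        by simp
    qed
    also have "\<dots> = 2 * real L * (\<Sum>D\<in>?S. (4 ^ k) ^ card D / real (\<Prod>D))" by (simp add: sum_distrib_left)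
    also have "\<dots> \<le> 2 * real L * (C2 * (z ^ k) powr (\<eta> / 2))"
      using z by (intro mult_left_mono C2) auto
    finally have "(\<Sum>m\<in>?I. \<bar>\<Sum>P\<in>F. w P * ram_prod P (?n m)\<bar> ^ k) \<le>
        (C1 * z powr (\<eta> / 2)) ^ k * (2 * real L * (C2 * (z ^ k) powr (\<eta> / 2)))"
      using C1 by (simp add: mult_left_mono)
    also have "\<dots> = C1 ^ k * (2 * C2) * ((z powr (\<eta> / 2)) ^ k * (z ^ k) powr (\<eta> / 2)) * real L"
      by (simp add: power_mult_distrib)
    also have "(z powr (\<eta> / 2)) ^ k * (z ^ k) powr (\<eta> / 2) = z powr (\<eta> * real k)"
      using z by (simp add: powr_realpow[symmetric] powr_powr flip: powr_add)
    finally show "(\<Sum>m\<in>?I. \<bar>\<Sum>P\<in>F. w P * ram_prod P (?n m)\<bar> ^ k) \<le>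
        C1 ^ k * (2 * C2) * z powr (\<eta> * real k) * real L" .
  qed
qed

section \<open>The large sieve for the pieces\<close>

definition ex :: "real \<Rightarrow> complex" where "ex x = cis (2 * pi * x)"

lemma ex_add: "ex (x + y) = ex x * ex y"
  by (simp add: ex_def cis_mult algebra_simps)

lemma norm_ex [simp]: "norm (ex x) = 1"
  by (simp add: ex_def)

lemma ex_0 [simp]: "ex 0 = 1"
  by (simp add: ex_def)

lemma ex_sum: "finite A \<Longrightarrow> ex (\<Sum>i\<in>A. f i) = (\<Prod>i\<in>A. ex (f i))"
  by (induction A rule: finite_induct) (auto simp: ex_add)

lemma cnj_ex: "cnj (ex x) = ex (- x)"
  by (simp add: ex_def cis_cnj)

lemma ex_diff: "ex (x - y) = ex x * cnj (ex y)"
  using ex_add[of x "- y"] by (simp add: cnj_ex)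

lemma ex_power: "ex x ^ n = ex (real n * x)"
  unfolding ex_def Complex.DeMoivre by (simp add: mult_ac)

lemma ex_of_int [simp]: "ex (of_int k) = 1"
  unfolding ex_def by (rule cis_multiple_2pi) auto

lemma ex_eq_1_iff: "ex x = 1 \<longleftrightarrow> x \<in> \<int>"
proof
  assume "ex x = 1"
  then have "cos (2 * pi * x) = 1" by (simp add: ex_def complex_eq_iff)
  then obtain n :: int where "2 * pi * x = of_int n * 2 * pi" using cos_one_2pi_int by auto
  then have "x = of_int n" by simp
  then show "x \<in> \<int>" by simp
qed (auto elim: Ints_cases)

lemma ex_ratio_eq_1_iff:
  assumes "q > 0" shows "ex (real_of_int k / real q) = 1 \<longleftrightarrow> int q dvd k"
proof -
  have "real_of_int k / real q = real_of_int k / real_of_int (int q)" by simp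
  then show ?thesis
    using assms of_int_div_of_int_in_Ints_iff[of k "int q", where ?'a = real] by (simp add: ex_eq_1_iff)
qed

section \<open>Ramanujan sums as sums over reduced fractions\<close>

lemma ram_eq_exponential_sum:
  assumes "p > 0"
  shows "complex_of_real (ram p n) = (\<Sum>a\<in>{1..<p}. ex (real_of_int n * (real a / real p)))"
proof -
  let ?\<zeta> = "ex (real_of_int n / real p)"
  have eq: "ex (real_of_int n * (real a / real p)) = ?\<zeta> ^ a" for a
    by (simp add: ex_power mult_ac)
  have "(\<Sum>a<p. ?\<zeta> ^ a) = 1 + (\<Sum>a\<in>{1..<p}. ?\<zeta> ^ a)"
    using assms by (simp add: lessThan_atLeast0 sum.atLeast_Suc_lessThan)
  moreover have "(\<Sum>a<p. ?\<zeta> ^ a) = (if int p dvd n then of_nat p else 0)"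
  proof (cases "int p dvd n")
    case True
    then have "?\<zeta> = 1" using ex_ratio_eq_1_iff[OF assms] by simp
    then show ?thesis using True by simp
  next
    case False
    then have "?\<zeta> \<noteq> 1" using ex_ratio_eq_1_iff[OF assms] by simp
    moreover have "?\<zeta> ^ p = 1" using assms by (simp add: ex_power)
    ultimately show ?thesis using False by (simp add: geometric_sum)
  qed
  ultimately have "(\<Sum>a\<in>{1..<p}. ?\<zeta> ^ a) = (if int p dvd n then of_nat p else 0) - 1"
    by (simp add: eq_diff_eq add.commute)
  then show ?thesis unfolding eq by (simp add: ram_def)
qed

text \<open>By the Chinese remainder theorem the sums of a_p/p with 0 < a_p < p run modulo 1 exactly
  once through the reduced fractions whose denominator is the product of \<open>P\<close>. Working
  with the tuples avoids residues modulo that product.\<close>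

definition fractions :: "nat set \<Rightarrow> (nat \<Rightarrow> nat) set" where
  "fractions P = PiE P (\<lambda>p. {1..<p})"

definition freq :: "nat set \<Rightarrow> (nat \<Rightarrow> nat) \<Rightarrow> real" where
  "freq P \<alpha> = (\<Sum>p\<in>P. real (\<alpha> p) / real p)"

lemma finite_fractions [simp]: "finite P \<Longrightarrow> finite (fractions P)"
  unfolding fractions_def by (intro finite_PiE) auto

lemma ram_prod_eq_exponential_sum:
  assumes "P \<in> prime_sets y"
  shows "complex_of_real (ram_prod P n) = (\<Sum>\<alpha>\<in>fractions P. ex (real_of_int n * freq P \<alpha>))"
proof -
  have fin: "finite P" using assms by (rule prime_setsD)
  have "complex_of_real (ram_prod P n) = (\<Prod>p\<in>P. \<Sum>a\<in>{1..<p}. ex (real_of_int n * (real a / real p)))"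
    unfolding ram_prod_def of_real_prod using prime_setsD(4)[OF assms]
    by (intro prod.cong refl ram_eq_exponential_sum) force
  also have "\<dots> = (\<Sum>\<alpha>\<in>fractions P. \<Prod>p\<in>P. ex (real_of_int n * (real (\<alpha> p) / real p)))"
    unfolding fractions_def using fin by (intro prod_sum_PiE) auto
  also have "\<dots> = (\<Sum>\<alpha>\<in>fractions P. ex (real_of_int n * freq P \<alpha>))"
    using fin by (intro sum.cong refl) (simp add: freq_def sum_distrib_left ex_sum)
  finally show ?thesis .
qed

text \<open>Averaging \<open>1 - \<zeta>^j\<close> over a full period gives \<open>1\<close>, which bounds \<open>1 - \<zeta>\<close> away from \<open>0\<close>.\<close>
lemma norm_one_minus_root_of_unity_ge:
  fixes \<zeta> :: complex
  assumes "\<zeta> ^ q = 1" "\<zeta> \<noteq> 1" "norm \<zeta> = 1" "q > 0"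
  shows "norm (1 - \<zeta>) \<ge> 1 / real q"
proof -
  have "(\<Sum>j<q. 1 - \<zeta> ^ j) = of_nat q"
    using assms by (simp add: sum_subtractf geometric_sum)
  then have "real q = norm (\<Sum>j<q. 1 - \<zeta> ^ j)" by simp
  also have "\<dots> \<le> (\<Sum>j<q. norm (1 - \<zeta> ^ j))" by (rule norm_sum)
  also have "\<dots> \<le> (\<Sum>j<q. real q * norm (1 - \<zeta>))"
  proof (rule sum_mono)
    fix j assume "j \<in> {..<q}"
    have "norm (1 ^ j - \<zeta> ^ j) \<le> real j * norm (1 - \<zeta>)"
      using assms by (intro norm_power_diff) auto
    also have "\<dots> \<le> real q * norm (1 - \<zeta>)" using \<open>j \<in> {..<q}\<close> by (intro mult_right_mono) auto
    finally show "norm (1 - \<zeta> ^ j) \<le> real q * norm (1 - \<zeta>)" by simp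
  qed
  finally have "real q * 1 \<le> real q * (real q * norm (1 - \<zeta>))" by simp
  then have "1 \<le> real q * norm (1 - \<zeta>)" using assms by (subst (asm) mult_le_cancel_left_pos) auto
  then show ?thesis using assms by (simp add: field_simps)
qed

text \<open>A geometric series whose ratio \<zeta> is a nontrivial q-th root of unity: the numerator
  is at most 2 and |1 - \<zeta>| is at least 1/q, whatever the length of the interval.\<close>

lemma norm_sum_ex_interval_le:
  assumes q: "q > 0" and k: "\<not> int q dvd k"
  shows "norm (\<Sum>x\<in>{a..<a + int L}. ex (real_of_int k / real q * real_of_int x)) \<le> 2 * real q"
proof -
  let ?\<zeta> = "ex (real_of_int k / real q)"
  have ne: "?\<zeta> \<noteq> 1" using k ex_ratio_eq_1_iff[OF q] by simp
  have "bij_betw (\<lambda>j. a + int j) {..<L} {a..<a + int L}"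
    by (rule bij_betwI[of _ _ _ "\<lambda>x. nat (x - a)"]) auto
  then have "(\<Sum>x\<in>{a..<a + int L}. ex (real_of_int k / real q * real_of_int x)) =
      (\<Sum>j<L. ex (real_of_int k / real q * real_of_int (a + int j)))"
    by (rule sum.reindex_bij_betw[symmetric])
  also have "\<dots> = ex (real_of_int k / real q * real_of_int a) * (\<Sum>j<L. ?\<zeta> ^ j)"
    unfolding sum_distrib_left
    by (intro sum.cong refl) (simp add: ex_power algebra_simps add_divide_distrib ex_add)
  finally have "norm (\<Sum>x\<in>{a..<a + int L}. ex (real_of_int k / real q * real_of_int x)) = norm (\<Sum>j<L. ?\<zeta> ^ j)"
    by (simp add: norm_mult)
  also have "\<dots> = norm (1 - ?\<zeta> ^ L) / norm (1 - ?\<zeta>)"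
    using ne by (simp add: geometric_sum norm_divide norm_minus_commute)
  also have "\<dots> \<le> 2 / (1 / real q)"
  proof (rule frac_le)
    show "norm (1 - ?\<zeta> ^ L) \<le> 2"
      using norm_triangle_ineq4[of 1 "?\<zeta> ^ L"] by (simp add: norm_power)
    show "norm (1 - ?\<zeta>) \<ge> 1 / real q"
      using q ne by (intro norm_one_minus_root_of_unity_ge) (auto simp: ex_power)
  qed (use q in auto)
  finally show ?thesis by simp
qed

text \<open>Duality and almost orthogonality. The left side \<open>A\<close> is the pairing of
  \<open>g\<close> with the dual sum \<open>H\<close>; expanding the square of \<open>H\<close>
  gives a diagonal term \<open>L * A\<close>, and off the diagonal at most \<Delta> times the number
  of frequencies times \<open>A\<close>. The hypothesis on that number makes the second term no
  larger than the first. This crude form is affordable because the moduli are tiny compared with the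
  interval.\<close>

lemma large_sieve:
  fixes \<theta> :: "'a \<Rightarrow> real" and g :: "int \<Rightarrow> complex"
  assumes fin: "finite \<Phi>" "finite I"
    and sep: "\<And>\<phi> \<psi>. \<phi> \<in> \<Phi> \<Longrightarrow> \<psi> \<in> \<Phi> \<Longrightarrow> \<phi> \<noteq> \<psi> \<Longrightarrow>
      norm (\<Sum>x\<in>I. ex ((\<theta> \<phi> - \<theta> \<psi>) * real_of_int x)) \<le> \<Delta>"
    and \<Delta>: "\<Delta> \<ge> 0" and card: "real (card \<Phi>) * \<Delta> \<le> real (card I)"
  shows "(\<Sum>\<phi>\<in>\<Phi>. (norm (\<Sum>x\<in>I. g x * ex (\<theta> \<phi> * real_of_int x)))\<^sup>2) \<le>
    2 * real (card I) * (\<Sum>x\<in>I. (norm (g x))\<^sup>2)"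
proof -
  let ?L = "real (card I)"
  define G where "G \<phi> = (\<Sum>x\<in>I. g x * ex (\<theta> \<phi> * real_of_int x))" for \<phi>
  define A where "A = (\<Sum>\<phi>\<in>\<Phi>. (norm (G \<phi>))\<^sup>2)"
  define H where "H x = (\<Sum>\<phi>\<in>\<Phi>. cnj (G \<phi>) * ex (\<theta> \<phi> * real_of_int x))" for x
  have A0: "A \<ge> 0" unfolding A_def by (intro sum_nonneg) auto
  have "complex_of_real A = (\<Sum>\<phi>\<in>\<Phi>. cnj (G \<phi>) * G \<phi>)"
    unfolding A_def of_real_sum by (intro sum.cong refl) (simp add: complex_norm_square mult.commute del: of_real_power)
  also have "\<dots> = (\<Sum>\<phi>\<in>\<Phi>. \<Sum>x\<in>I. g x * (cnj (G \<phi>) * ex (\<theta> \<phi> * real_of_int x)))"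
    by (subst (2) G_def) (simp add: sum_distrib_left mult_ac)
  also have "\<dots> = (\<Sum>x\<in>I. g x * H x)"
    by (subst sum.swap) (simp add: H_def sum_distrib_left)
  finally have "A = norm (\<Sum>x\<in>I. g x * H x)" using A0 by (metis abs_of_nonneg norm_of_real)
  also have "\<dots> \<le> (\<Sum>x\<in>I. norm (g x) * norm (H x))" by (rule sum_norm_le) (simp add: norm_mult)
  finally have "A\<^sup>2 \<le> (\<Sum>x\<in>I. norm (g x) * norm (H x))\<^sup>2" using A0 by (rule power_mono)
  also have "\<dots> \<le> (\<Sum>x\<in>I. (norm (g x))\<^sup>2) * (\<Sum>x\<in>I. (norm (H x))\<^sup>2)" by (rule Cauchy_Schwarz_ineq_sum)
  finally have 1: "A\<^sup>2 \<le> (\<Sum>x\<in>I. (norm (g x))\<^sup>2) * (\<Sum>x\<in>I. (norm (H x))\<^sup>2)" .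
  have "complex_of_real (\<Sum>x\<in>I. (norm (H x))\<^sup>2) = (\<Sum>x\<in>I. H x * cnj (H x))"
    unfolding of_real_sum by (intro sum.cong refl) (simp add: complex_norm_square del: of_real_power)
  also have "\<dots> = (\<Sum>x\<in>I. \<Sum>\<phi>\<in>\<Phi>. \<Sum>\<psi>\<in>\<Phi>. cnj (G \<phi>) * G \<psi> * ex ((\<theta> \<phi> - \<theta> \<psi>) * real_of_int x))"
    unfolding H_def cnj_sum sum_product
    by (intro sum.cong refl) (simp only: left_diff_distrib right_diff_distrib ex_diff complex_cnj_mult complex_cnj_cnj mult_ac)
  also have "\<dots> = (\<Sum>\<phi>\<in>\<Phi>. \<Sum>\<psi>\<in>\<Phi>. cnj (G \<phi>) * G \<psi> * (\<Sum>x\<in>I. ex ((\<theta> \<phi> - \<theta> \<psi>) * real_of_int x)))"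
    by (subst sum.swap) (simp add: sum.swap[of _ I] sum_distrib_left)
  finally have "(\<Sum>x\<in>I. (norm (H x))\<^sup>2) = norm (\<Sum>\<phi>\<in>\<Phi>. \<Sum>\<psi>\<in>\<Phi>. cnj (G \<phi>) * G \<psi> * (\<Sum>x\<in>I. ex ((\<theta> \<phi> - \<theta> \<psi>) * real_of_int x)))"
    by (metis (no_types, lifting) abs_of_nonneg norm_of_real sum_nonneg zero_le_power2)
  \<comment> \<open>\<Delta> is added on the diagonal too, so that its total contribution is a
    perfect square.\<close>
  also have "\<dots> \<le> (\<Sum>\<phi>\<in>\<Phi>. \<Sum>\<psi>\<in>\<Phi>. norm (G \<phi>) * norm (G \<psi>) * ((if \<phi> = \<psi> then ?L else 0) + \<Delta>))"
  proof (intro sum_norm_le)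
    fix \<phi> \<psi> assume "\<phi> \<in> \<Phi>" "\<psi> \<in> \<Phi>"
    then have "norm (\<Sum>x\<in>I. ex ((\<theta> \<phi> - \<theta> \<psi>) * real_of_int x)) \<le> (if \<phi> = \<psi> then ?L else 0) + \<Delta>"
      using sep[of \<phi> \<psi>] \<Delta> by auto
    then show "norm (cnj (G \<phi>) * G \<psi> * (\<Sum>x\<in>I. ex ((\<theta> \<phi> - \<theta> \<psi>) * real_of_int x))) \<le>
        norm (G \<phi>) * norm (G \<psi>) * ((if \<phi> = \<psi> then ?L else 0) + \<Delta>)"
      unfolding norm_mult complex_mod_cnj by (intro mult_left_mono) auto
  qed
  also have "\<dots> = ?L * A + \<Delta> * (\<Sum>\<phi>\<in>\<Phi>. norm (G \<phi>))\<^sup>2"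
  proof -
    have "(\<Sum>\<phi>\<in>\<Phi>. \<Sum>\<psi>\<in>\<Phi>. norm (G \<phi>) * norm (G \<psi>) * ((if \<phi> = \<psi> then ?L else 0) + \<Delta>)) =
        (\<Sum>\<phi>\<in>\<Phi>. (\<Sum>\<psi>\<in>\<Phi>. if \<phi> = \<psi> then norm (G \<phi>) * norm (G \<psi>) * ?L else 0) + (\<Sum>\<psi>\<in>\<Phi>. norm (G \<phi>) * norm (G \<psi>) * \<Delta>))"
      unfolding sum.distrib[symmetric] by (intro sum.cong refl) (simp add: algebra_simps)
    also have "\<dots> = (\<Sum>\<phi>\<in>\<Phi>. norm (G \<phi>) * norm (G \<phi>) * ?L) + (\<Sum>\<phi>\<in>\<Phi>. \<Sum>\<psi>\<in>\<Phi>. norm (G \<phi>) * norm (G \<psi>) * \<Delta>)"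
      using fin by (simp add: sum.distrib)
    also have "\<dots> = ?L * A + \<Delta> * (\<Sum>\<phi>\<in>\<Phi>. norm (G \<phi>))\<^sup>2"
      by (simp add: A_def power2_eq_square sum_product sum_distrib_left mult_ac)
    finally show ?thesis .
  qed
  also have "(\<Sum>\<phi>\<in>\<Phi>. norm (G \<phi>))\<^sup>2 \<le> A * real (card \<Phi>)"
    using Cauchy_Schwarz_ineq_sum[of "\<lambda>\<phi>. norm (G \<phi>)" "\<lambda>_. 1" \<Phi>] by (simp add: A_def)
  then have "?L * A + \<Delta> * (\<Sum>\<phi>\<in>\<Phi>. norm (G \<phi>))\<^sup>2 \<le> ?L * A + \<Delta> * (A * real (card \<Phi>))"
    using \<Delta> by (intro add_left_mono mult_left_mono)
  also have "\<dots> = (?L + real (card \<Phi>) * \<Delta>) * A" by (simp add: algebra_simps)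
  also have "\<dots> \<le> (?L + ?L) * A" using card A0 by (intro mult_right_mono) auto
  finally have 2: "(\<Sum>x\<in>I. (norm (H x))\<^sup>2) \<le> 2 * ?L * A" by simp
  have "A * A \<le> (2 * ?L * (\<Sum>x\<in>I. (norm (g x))\<^sup>2)) * A"
    using order_trans[OF 1 mult_left_mono[OF 2]] by (simp add: power2_eq_square sum_nonneg mult_ac)
  then have "A \<le> 2 * ?L * (\<Sum>x\<in>I. (norm (g x))\<^sup>2)"
    using A0 by (cases "A = 0") (auto simp: sum_nonneg)
  then show ?thesis by (simp add: A_def G_def)
qed

text \<open>Suppose the numerator \<open>k\<close> were divisible by the common denominator. Modulo
  a prime p of \<open>P \<union> Q\<close> every term of \<open>k\<close> but the one for p
  vanishes, and both \<open>y\<close> and the cofactor \<open>M p\<close> are invertible, so p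
  divides the difference \<open>c p\<close>, which is smaller than p and hence 0. As all entries lie
  in 1..p-1, this forces both the sets and the tuples to agree.\<close>

lemma freq_difference:
  assumes P: "P \<in> prime_sets y" and Q: "Q \<in> prime_sets y"
    and \<alpha>: "\<alpha> \<in> fractions P" and \<beta>: "\<beta> \<in> fractions Q" and ne: "(P, \<alpha>) \<noteq> (Q, \<beta>)"
  obtains k where "real y * freq P \<alpha> - real y * freq Q \<beta> = real_of_int k / real (\<Prod>(P \<union> Q))"
    "\<not> int (\<Prod>(P \<union> Q)) dvd k"
proof -
  let ?U = "P \<union> Q"
  have U: "?U \<in> prime_sets y" using P Q by (rule prime_sets_Un)
  have fin: "finite P" "finite Q" using P Q by (auto dest: prime_setsD)
  \<comment> \<open>Off its own set a tuple has the value \<open>undefined\<close>, hence the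
    explicit default 0.\<close>
  define c where "c p = int (if p \<in> P then \<alpha> p else 0) - int (if p \<in> Q then \<beta> p else 0)" for p
  define M where "M p = int (\<Prod>(?U - {p}))" for p
  define k where "k = int y * (\<Sum>p\<in>?U. c p * M p)"
  have UM: "int (\<Prod>?U) = int p * M p" if "p \<in> ?U" for p
  proof -
    have "\<Prod>?U = p * \<Prod>(?U - {p})" using fin that by (intro prod.remove) auto
    then show ?thesis by (simp add: M_def)
  qed
  have pos: "real (\<Prod>?U) \<noteq> 0" using prod_pos_prime_sets[OF U] by simp
  have "freq P \<alpha> = (\<Sum>p\<in>?U. real (if p \<in> P then \<alpha> p else 0) / real p)"
    unfolding freq_def using fin by (intro sum.mono_neutral_cong_left) auto
  moreover have "freq Q \<beta> = (\<Sum>p\<in>?U. real (if p \<in> Q then \<beta> p else 0) / real p)"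
    unfolding freq_def using fin by (intro sum.mono_neutral_cong_left) auto
  ultimately have "freq P \<alpha> - freq Q \<beta> = (\<Sum>p\<in>?U. real_of_int (c p) / real p)"
    by (simp add: c_def diff_divide_distrib sum_subtractf)
  also have "\<dots> = (\<Sum>p\<in>?U. real_of_int (c p * M p) / real (\<Prod>?U))"
  proof (intro sum.cong refl)
    fix p assume p: "p \<in> ?U"
    then have "p \<noteq> 0" using prime_setsD(4)[OF U] by force
    moreover have "real (\<Prod>?U) = real p * real_of_int (M p)"
      using UM[OF p] by (metis of_int_mult of_int_of_nat_eq)
    ultimately show "real_of_int (c p) / real p = real_of_int (c p * M p) / real (\<Prod>?U)"
      using pos by (simp add: field_simps)
  qed
  finally have "real y * freq P \<alpha> - real y * freq Q \<beta> = real_of_int k / real (\<Prod>?U)"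
    by (simp add: k_def flip: right_diff_distrib sum_divide_distrib)
  moreover have "\<not> int (\<Prod>?U) dvd k"
  proof
    assume dvd: "int (\<Prod>?U) dvd k"
    have c0: "c p = 0" if p: "p \<in> ?U" for p
    proof -
      have pr: "prime p" "\<not> p dvd y" using prime_setsD[OF U] p by auto
      have "int p dvd k" using dvd UM[OF p] by (metis dvd_mult_left)
      moreover have "k = int y * (c p * M p) + int y * (\<Sum>r\<in>?U - {p}. c r * M r)"
        unfolding k_def using fin p by (subst sum.remove[of ?U p]) (auto simp: algebra_simps)
      moreover have "int p dvd int y * (\<Sum>r\<in>?U - {p}. c r * M r)"
      proof (intro dvd_mult dvd_sum)
        fix r assume "r \<in> ?U - {p}"
        then have "p dvd \<Prod>(?U - {r})" using fin p by (intro dvd_prodI) auto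
        then show "int p dvd M r" by (simp add: M_def)
      qed
      ultimately have "int p dvd int y * (c p * M p)" by (simp add: dvd_add_left_iff)
      moreover have pi: "prime (int p)" using pr by simp
      moreover have "\<not> int p dvd int y" using pr by simp
      moreover have "\<not> int p dvd M p"
      proof
        assume "int p dvd M p"
        then have "p dvd \<Prod>(?U - {p})" by (simp add: M_def)
        then obtain r where "r \<in> ?U - {p}" "p dvd r" using fin pr by (auto simp: prime_dvd_prod_iff)
        moreover have "prime r" using prime_setsD[OF U] \<open>r \<in> ?U - {p}\<close> by auto
        ultimately show False using pr by (auto dest: primes_dvd_imp_eq)
      qed
      ultimately have "int p dvd c p" by (auto simp: prime_dvd_mult_iff)
      moreover have "\<bar>c p\<bar> < int p"
        using \<alpha> \<beta> p prime_setsD(4)[OF U p] by (fastforce simp: c_def fractions_def PiE_iff)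
      ultimately show "c p = 0" by (metis abs_of_nat dvd_imp_le_int not_less)
    qed
    have apos: "\<alpha> p > 0" if "p \<in> P" for p using \<alpha> that by (force simp: fractions_def PiE_iff)
    have bpos: "\<beta> p > 0" if "p \<in> Q" for p using \<beta> that by (force simp: fractions_def PiE_iff)
    have "P = Q"
    proof (intro equalityI subsetI)
      fix p assume "p \<in> P" then show "p \<in> Q" using c0[of p] apos[of p] by (auto simp: c_def split: if_splits)
    next
      fix p assume "p \<in> Q" then show "p \<in> P" using c0[of p] bpos[of p] by (auto simp: c_def split: if_splits)
    qed
    moreover have "\<alpha> = \<beta>"
    proof (rule PiE_ext)
      show "\<alpha> \<in> PiE P (\<lambda>p. {1..<p})" "\<beta> \<in> PiE P (\<lambda>p. {1..<p})"
        using \<alpha> \<beta> \<open>P = Q\<close> by (auto simp: fractions_def)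
      fix p assume "p \<in> P" then show "\<alpha> p = \<beta> p" using c0[of p] \<open>P = Q\<close> by (auto simp: c_def)
    qed
    ultimately show False using ne by simp
  qed
  ultimately show thesis using that by blast
qed

lemma card_fractions_le:
  assumes z: "z \<ge> 1" and F: "F \<subseteq> sieve_sets y z"
  shows "real (card (Sigma F fractions)) \<le> z\<^sup>2"
proof -
  have finF: "finite F" using F by (rule finite_subset) simp
  have Fp: "P \<in> prime_sets y" "real (\<Prod>P) \<le> z" if "P \<in> F" for P using that F by (auto simp: sieve_sets_def)
  have "real (card (Sigma F fractions)) = (\<Sum>P\<in>F. real (card (fractions P)))"
    using finF Fp(1) by (subst card_SigmaI) (auto intro!: finite_fractions prime_setsD(1))
  also have "\<dots> \<le> (\<Sum>P\<in>F. z)"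
  proof (rule sum_mono)
    fix P assume P: "P \<in> F"
    have fin: "finite P" using Fp[OF P] by (auto dest: prime_setsD)
    have "card (fractions P) = (\<Prod>p\<in>P. p - 1)" unfolding fractions_def using fin by (subst card_PiE) auto
    also have "\<dots> \<le> \<Prod>P" by (intro prod_mono) auto
    finally have "real (card (fractions P)) \<le> real (\<Prod>P)" by (rule of_nat_mono)
    then show "real (card (fractions P)) \<le> z" using Fp[OF P] by linarith
  qed
  also have "\<dots> \<le> (\<Sum>P\<in>sieve_sets y z. z)" using F z by (intro sum_mono2) auto
  also have "\<dots> \<le> (\<Sum>n=1..nat \<lfloor>z\<rfloor>. z)" using z by (rule_tac sum_sieve_sets_le) auto
  also have "\<dots> \<le> z\<^sup>2" using z by (auto simp: power2_eq_square intro!: mult_right_mono)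
  finally show ?thesis .
qed

text \<open>Writing the Ramanujan sums as exponential sums diagonalises the form: it becomes a sum
  over frequencies of the weight times the exponential sums of \<open>g\<close> and
  \<open>f\<close>. Cauchy-Schwarz and the large sieve for each factor give \<open>L * W\<close> up
  to the constant. For weights of size 1/Q this beats the trivial size of the kernel by almost a
  factor Q.\<close>

lemma sieve_kernel_L2:
  fixes f g :: "int \<Rightarrow> complex" and a b :: int and L y :: nat
  assumes z: "z \<ge> 1" and F: "F \<subseteq> sieve_sets y z" and L: "2 * z ^ 4 \<le> real L"
    and w: "\<And>P. P \<in> F \<Longrightarrow> \<bar>w P\<bar> \<le> W" and W0: "W \<ge> 0"
  defines "I \<equiv> {a..<a + int L}"
  shows "norm (\<Sum>x\<in>I. \<Sum>t\<in>I. of_real (\<Sum>P\<in>F. w P * ram_prod P (b + int y * (x - t))) * f t * g x) \<le>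
    2 * real L * W * sqrt (\<Sum>t\<in>I. (norm (f t))\<^sup>2) * sqrt (\<Sum>x\<in>I. (norm (g x))\<^sup>2)"
proof -
  define \<Phi> where "\<Phi> = Sigma F fractions"
  define \<theta> where "\<theta> \<phi> = real y * freq (fst \<phi>) (snd \<phi>)" for \<phi>
  define E where "E h \<phi> = (\<Sum>x\<in>I. h x * ex (\<theta> \<phi> * real_of_int x))" for h \<phi>
  have finF: "finite F" using F by (rule finite_subset) simp
  have Fp: "P \<in> prime_sets y" "real (\<Prod>P) \<le> z" if "P \<in> F" for P using that F by (auto simp: sieve_sets_def)
  have finP: "finite P" if "P \<in> F" for P using Fp[OF that] by (auto dest: prime_setsD)
  have fin\<Phi>: "finite \<Phi>" unfolding \<Phi>_def using finF finP by (intro finite_SigmaI) auto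
  have finI: "finite I" "card I = L" by (auto simp: I_def)
  have LS: "(\<Sum>\<phi>\<in>\<Phi>. (norm (E h \<phi>))\<^sup>2) \<le> 2 * real L * (\<Sum>x\<in>I. (norm (h x))\<^sup>2)" for h
    unfolding E_def finI(2)[symmetric]
  \<comment> \<open>Two distinct frequencies, multiplied by \<open>y\<close>, differ modulo 1 by a
    nonzero fraction with denominator at most z^2, which gives 2 z^2. There are at most z^2
    frequencies, whence the condition \<open>2 * z ^ 4 <= L\<close>.\<close>
  proof (rule large_sieve[where \<Delta> = "2 * z\<^sup>2"])
    fix \<phi> \<psi> assume *: "\<phi> \<in> \<Phi>" "\<psi> \<in> \<Phi>" "\<phi> \<noteq> \<psi>"
    obtain P \<alpha> Q \<beta> where \<phi>: "\<phi> = (P, \<alpha>)" "\<psi> = (Q, \<beta>)" by (cases \<phi>, cases \<psi>)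
    have PQ: "P \<in> F" "Q \<in> F" "\<alpha> \<in> fractions P" "\<beta> \<in> fractions Q" using * by (auto simp: \<phi> \<Phi>_def)
    obtain k where k: "real y * freq P \<alpha> - real y * freq Q \<beta> = real_of_int k / real (\<Prod>(P \<union> Q))"
        "\<not> int (\<Prod>(P \<union> Q)) dvd k"
      using freq_difference[of P y Q \<alpha> \<beta>] PQ Fp * \<phi> by blast
    have U: "P \<union> Q \<in> prime_sets y" using Fp PQ by (intro prime_sets_Un)
    have "norm (\<Sum>x\<in>I. ex ((\<theta> \<phi> - \<theta> \<psi>) * real_of_int x)) \<le> 2 * real (\<Prod>(P \<union> Q))"
      unfolding I_def \<theta>_def \<phi> fst_conv snd_conv k(1)
      using k(2) prod_pos_prime_sets[OF U] by (intro norm_sum_ex_interval_le)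
    also have "real (\<Prod>(P \<union> Q)) \<le> z * z"
    proof -
      have "\<Prod>(P \<union> Q) = \<Prod>P * \<Prod>(Q - P)"
        using finP PQ by (metis Diff_disjoint Un_Diff_cancel finite_Diff prod.union_disjoint)
      also have "\<dots> \<le> \<Prod>P * \<Prod>Q" using PQ Fp by (intro mult_left_mono prod_mono_prime_sets[of _ y]) auto
      finally have "real (\<Prod>(P \<union> Q)) \<le> real (\<Prod>P * \<Prod>Q)" by (rule of_nat_mono)
      also have "\<dots> \<le> z * z" unfolding of_nat_mult using PQ Fp z by (intro mult_mono) auto
      finally show ?thesis .
    qed
    finally show "norm (\<Sum>x\<in>I. ex ((\<theta> \<phi> - \<theta> \<psi>) * real_of_int x)) \<le> 2 * z\<^sup>2"
      by (simp add: power2_eq_square)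
  next
    have "real (card \<Phi>) * (2 * z\<^sup>2) \<le> z\<^sup>2 * (2 * z\<^sup>2)"
      unfolding \<Phi>_def using card_fractions_le[OF z F] by (intro mult_right_mono) auto
    also have "\<dots> \<le> real L" using L by (simp add: power_add[symmetric] mult.left_commute)
    finally show "real (card \<Phi>) * (2 * z\<^sup>2) \<le> real (card I)" by (simp add: finI)
  qed (use fin\<Phi> finI in auto)
  have K: "complex_of_real (\<Sum>P\<in>F. w P * ram_prod P (b + int y * (x - t))) =
      (\<Sum>\<phi>\<in>\<Phi>. of_real (w (fst \<phi>)) * ex (real_of_int b * freq (fst \<phi>) (snd \<phi>)) * ex (\<theta> \<phi> * real_of_int x) * cnj (ex (\<theta> \<phi> * real_of_int t)))" for x t
  proof -
    have "complex_of_real (\<Sum>P\<in>F. w P * ram_prod P (b + int y * (x - t))) =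
        (\<Sum>P\<in>F. \<Sum>\<alpha>\<in>fractions P. of_real (w P) * ex (real_of_int (b + int y * (x - t)) * freq P \<alpha>))"
      unfolding of_real_sum of_real_mult
      by (intro sum.cong refl) (simp add: ram_prod_eq_exponential_sum[OF Fp(1)] sum_distrib_left)
    also have "\<dots> = (\<Sum>\<phi>\<in>\<Phi>. of_real (w (fst \<phi>)) * ex (real_of_int (b + int y * (x - t)) * freq (fst \<phi>) (snd \<phi>)))"
      unfolding \<Phi>_def using finF finP by (subst sum.Sigma) (auto simp: case_prod_unfold)
    also have "\<dots> = (\<Sum>\<phi>\<in>\<Phi>. of_real (w (fst \<phi>)) * ex (real_of_int b * freq (fst \<phi>) (snd \<phi>)) * ex (\<theta> \<phi> * real_of_int x) * cnj (ex (\<theta> \<phi> * real_of_int t)))"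
    proof (intro sum.cong refl)
      fix \<phi>
      have "real_of_int (b + int y * (x - t)) * freq (fst \<phi>) (snd \<phi>) =
          real_of_int b * freq (fst \<phi>) (snd \<phi>) + (\<theta> \<phi> * real_of_int x + - (\<theta> \<phi> * real_of_int t))"
        by (simp add: \<theta>_def algebra_simps)
      then show "of_real (w (fst \<phi>)) * ex (real_of_int (b + int y * (x - t)) * freq (fst \<phi>) (snd \<phi>)) =
          of_real (w (fst \<phi>)) * ex (real_of_int b * freq (fst \<phi>) (snd \<phi>)) * ex (\<theta> \<phi> * real_of_int x) * cnj (ex (\<theta> \<phi> * real_of_int t))"
        by (simp only: ex_add cnj_ex mult.assoc)
    qed
    finally show ?thesis .
  qed
  \<comment> \<open>\<open>E\<close> uses the phase with positive sign, but \<open>t\<close> enters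
    the kernel with the opposite sign and \<open>f\<close> without conjugation; conjugating inside
    and outside reconciles the two.\<close>
  have cnjE: "cnj (E (\<lambda>t. cnj (f t)) \<phi>) = (\<Sum>t\<in>I. f t * cnj (ex (\<theta> \<phi> * real_of_int t)))" for \<phi>
    by (simp add: E_def)
  have "(\<Sum>x\<in>I. \<Sum>t\<in>I. of_real (\<Sum>P\<in>F. w P * ram_prod P (b + int y * (x - t))) * f t * g x) =
      (\<Sum>x\<in>I. \<Sum>t\<in>I. \<Sum>\<phi>\<in>\<Phi>. of_real (w (fst \<phi>)) * ex (real_of_int b * freq (fst \<phi>) (snd \<phi>)) *
        ((g x * ex (\<theta> \<phi> * real_of_int x)) * (f t * cnj (ex (\<theta> \<phi> * real_of_int t)))))"
    unfolding K sum_distrib_right by (intro sum.cong refl) (simp add: mult_ac)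
  also have "\<dots> = (\<Sum>\<phi>\<in>\<Phi>. of_real (w (fst \<phi>)) * ex (real_of_int b * freq (fst \<phi>) (snd \<phi>)) *
        (E g \<phi> * cnj (E (\<lambda>t. cnj (f t)) \<phi>)))"
    unfolding cnjE unfolding E_def sum_product unfolding sum_distrib_left
    by (subst sum.swap[of _ _ \<Phi>], subst sum.swap[of _ _ \<Phi>]) (rule refl)
  finally have "norm (\<Sum>x\<in>I. \<Sum>t\<in>I. of_real (\<Sum>P\<in>F. w P * ram_prod P (b + int y * (x - t))) * f t * g x) \<le>
      (\<Sum>\<phi>\<in>\<Phi>. norm (of_real (w (fst \<phi>)) * ex (real_of_int b * freq (fst \<phi>) (snd \<phi>)) *
        (E g \<phi> * cnj (E (\<lambda>t. cnj (f t)) \<phi>))))" by (simp only: norm_sum)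
  also have "\<dots> \<le> (\<Sum>\<phi>\<in>\<Phi>. W * (norm (E g \<phi>) * norm (E (\<lambda>t. cnj (f t)) \<phi>)))"
  proof (rule sum_mono)
    fix \<phi> assume "\<phi> \<in> \<Phi>"
    then have "\<bar>w (fst \<phi>)\<bar> \<le> W" by (intro w) (auto simp: \<Phi>_def)
    then show "norm (of_real (w (fst \<phi>)) * ex (real_of_int b * freq (fst \<phi>) (snd \<phi>)) *
        (E g \<phi> * cnj (E (\<lambda>t. cnj (f t)) \<phi>))) \<le> W * (norm (E g \<phi>) * norm (E (\<lambda>t. cnj (f t)) \<phi>))"
      by (simp add: norm_mult mult_right_mono)
  qed
  also have "\<dots> = W * (\<Sum>\<phi>\<in>\<Phi>. norm (E g \<phi>) * norm (E (\<lambda>t. cnj (f t)) \<phi>))" by (simp add: sum_distrib_left)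
  also have "\<dots> \<le> W * (sqrt (2 * real L * (\<Sum>x\<in>I. (norm (g x))\<^sup>2)) * sqrt (2 * real L * (\<Sum>t\<in>I. (norm (f t))\<^sup>2)))"
  proof -
    have "(\<Sum>\<phi>\<in>\<Phi>. norm (E g \<phi>) * norm (E (\<lambda>t. cnj (f t)) \<phi>))\<^sup>2 \<le>
       (\<Sum>\<phi>\<in>\<Phi>. (norm (E g \<phi>))\<^sup>2) * (\<Sum>\<phi>\<in>\<Phi>. (norm (E (\<lambda>t. cnj (f t)) \<phi>))\<^sup>2)" by (rule Cauchy_Schwarz_ineq_sum)
    also have "\<dots> \<le> (2 * real L * (\<Sum>x\<in>I. (norm (g x))\<^sup>2)) * (2 * real L * (\<Sum>t\<in>I. (norm (f t))\<^sup>2))"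
      using LS[of g] LS[of "\<lambda>t. cnj (f t)"] by (intro mult_mono) (auto intro!: sum_nonneg mult_nonneg_nonneg)
    finally have "(\<Sum>\<phi>\<in>\<Phi>. norm (E g \<phi>) * norm (E (\<lambda>t. cnj (f t)) \<phi>)) \<le>
        sqrt ((2 * real L * (\<Sum>x\<in>I. (norm (g x))\<^sup>2)) * (2 * real L * (\<Sum>t\<in>I. (norm (f t))\<^sup>2)))"
      by (rule real_le_rsqrt)
    then show ?thesis using W0 by (intro mult_left_mono) (auto simp only: real_sqrt_mult)
  qed
  also have "\<dots> = 2 * real L * W * sqrt (\<Sum>t\<in>I. (norm (f t))\<^sup>2) * sqrt (\<Sum>x\<in>I. (norm (g x))\<^sup>2)"
    by (simp add: real_sqrt_mult mult_ac flip: power2_eq_square)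
  finally show ?thesis .
qed

section \<open>Summation of the pieces\<close>

definition fin_norm :: "real \<Rightarrow> 'a set \<Rightarrow> ('a \<Rightarrow> real) \<Rightarrow> real" where
  "fin_norm p A f = (\<Sum>t\<in>A. f t powr p) powr (1 / p)"

lemma fin_norm_nonneg [simp]: "fin_norm p A f \<ge> 0"
  by (simp add: fin_norm_def)

text \<open>The weight is at most 8^\<omega>(q)/q, hence a constant times q^(\<eta>-1). The exponent
  is not positive, so the lower bound q >= z/2 turns this into a power of \<open>z\<close>, at the
  cost of a factor 2.\<close>

lemma sieve_weight_le:
  fixes \<eta> :: real
  assumes \<eta>: "\<eta> > 0" "\<eta> \<le> 1"
  obtains C where "C \<ge> 1"
    "\<And>y z w P. P \<in> prime_sets y \<Longrightarrow> 0 < z \<Longrightarrow> z \<le> 2 * real (\<Prod>P) \<Longrightarrow> \<bar>w P\<bar> \<le> 4 ^ card P * inv_phi P \<Longrightarrow>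
      \<bar>w P\<bar> \<le> C * z powr (\<eta> - 1)"
proof -
  obtain C where C: "C \<ge> 1" "\<And>y P. P \<in> prime_sets y \<Longrightarrow> 8 ^ card P \<le> C * real (\<Prod>P) powr \<eta>"
    using power_card_le_powr[of 8 \<eta>] \<eta> by auto
  show thesis
  proof
    show "2 * C \<ge> 1" using C by simp
    fix y z P and w :: "nat set \<Rightarrow> real"
    assume P: "P \<in> prime_sets y" and z: "0 < z" "z \<le> 2 * real (\<Prod>P)" and w: "\<bar>w P\<bar> \<le> 4 ^ card P * inv_phi P"
    have pos: "0 < real (\<Prod>P)" using prod_pos_prime_sets[OF P] by simp
    have "\<bar>w P\<bar> \<le> 4 ^ card P * (2 ^ card P / real (\<Prod>P))"
      using w inv_phi_le[OF P] by (meson order_trans mult_left_mono zero_le_numeral zero_le_power)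
    also have "\<dots> = 8 ^ card P / real (\<Prod>P)" by (simp flip: power_mult_distrib)
    also have "\<dots> \<le> C * real (\<Prod>P) powr \<eta> / real (\<Prod>P)" using C(2)[OF P] by (intro divide_right_mono) auto
    also have "\<dots> = C * real (\<Prod>P) powr (\<eta> - 1)" using pos by (simp add: powr_diff)
    also have "\<dots> \<le> C * (2 * z powr (\<eta> - 1))"
    proof (intro mult_left_mono)
      have "real (\<Prod>P) powr (\<eta> - 1) \<le> (z / 2) powr (\<eta> - 1)" using z \<eta> by (intro powr_mono2') auto
      also have "(z / 2) powr (\<eta> - 1) = z powr (\<eta> - 1) * 2 powr (1 - \<eta>)"
        using z by (simp add: powr_divide powr_diff)
      also have "\<dots> \<le> z powr (\<eta> - 1) * 2"
        using \<eta> powr_mono[of "1 - \<eta>" 1 "2::real"] by (intro mult_left_mono) auto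
      finally show "real (\<Prod>P) powr (\<eta> - 1) \<le> 2 * z powr (\<eta> - 1)" by simp
    qed (use C in auto)
    finally show "\<bar>w P\<bar> \<le> 2 * C * z powr (\<eta> - 1)" by simp
  qed
qed

text \<open>Interpolation between Young's inequality, where the moment of order \<open>s\<close>
  costs z^\<eta>, and the l^2 bound, which gains z^(1-\<eta>). The condition
  \<open>r/(r-1) <= s\<close> makes the exponent \<open>p0\<close> of the first bound smaller than
  \<open>r\<close>, so the second one has positive weight \<theta>.\<close>

lemma sieve_piece_bound:
  fixes r :: real and s :: nat
  assumes r: "1 < r" "r < 2" and s: "r / (r - 1) \<le> real s"
  obtains C \<kappa> where "C \<ge> 1" "\<kappa> > 0"
    "\<And>(y :: nat) z w F (a :: int) (b :: int) (L :: nat) f g.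
      z \<ge> 1 \<Longrightarrow> F \<subseteq> sieve_sets y z \<Longrightarrow> (\<forall>P\<in>F. z \<le> 2 * real (\<Prod>P)) \<Longrightarrow>
      sieve_weight y w \<Longrightarrow>
      z ^ s \<le> 2 * real L \<Longrightarrow> 2 * z ^ 4 \<le> real L \<Longrightarrow> (\<forall>t. f t \<ge> 0) \<Longrightarrow> (\<forall>x. g x \<ge> 0) \<Longrightarrow>
      \<bar>\<Sum>x\<in>{a..<a + int L}. \<Sum>t\<in>{a..<a + int L}. (\<Sum>P\<in>F. w P * ram_prod P (b + int y * (x - t))) * f t * g x\<bar> \<le>
      C * z powr (- \<kappa>) * real L powr (2 - 2 / r) * fin_norm r {a..<a + int L} f * fin_norm r {a..<a + int L} g"
proof -
  have "2 < r / (r - 1)" using r by (simp add: field_simps)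
  then have s2: "2 < real s" using s by linarith
  \<comment> \<open>The solution of \<open>1/r = (1 - \<theta>)/p0 + \<theta>/2\<close> with
    \<open>1/p0 = 1 - 1/(2 s)\<close>.\<close>
  define \<theta> where "\<theta> = (1 - 1 / r - 1 / (2 * real s)) / (1 / 2 - 1 / (2 * real s))"
  have den: "1 / 2 - 1 / (2 * real s) > 0" using s2 by (simp add: field_simps)
  have "1 / (2 * real s) < 1 / real s" using s2 by (simp add: field_simps)
  also have "\<dots> \<le> 1 - 1 / r" using r s s2 by (simp add: field_simps)
  finally have \<theta>0: "\<theta> > 0" unfolding \<theta>_def using den by simp
  have "1 - 1 / r \<le> 1 / 2" using r by (simp add: field_simps)
  then have \<theta>1: "\<theta> \<le> 1" unfolding \<theta>_def using den by (simp add: divide_le_eq_1)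
  have \<theta>eq: "\<theta> * (1 / 2 - 1 / (2 * real s)) = 1 - 1 / r - 1 / (2 * real s)"
    by (metis \<theta>_def den less_irrefl nonzero_eq_divide_eq)
  define p0 where "p0 = 1 / (1 - 1 / (2 * real s))"
  have p0: "p0 > 0" "1 / p0 = 1 - 1 / (2 * real s)" using s2 by (auto simp: p0_def field_simps)
  have rp: "1 / r = (1 - \<theta>) / p0 + \<theta> / 2"
  proof -
    have "(1 - \<theta>) / p0 + \<theta> / 2 = (1 - \<theta>) * (1 / p0) + \<theta> / 2" by simp
    also have "\<dots> = 1 - 1 / (2 * real s) - \<theta> * (1 / 2 - 1 / (2 * real s))"
      unfolding p0(2) by (simp add: right_diff_distrib left_diff_distrib diff_divide_distrib)
    finally show ?thesis unfolding \<theta>eq by simp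
  qed
  have Lexp: "(1 - \<theta>) / real s + \<theta> = 2 - 2 / r"
  proof -
    have "(1 - \<theta>) / real s + \<theta> = 1 / real s + 2 * (\<theta> * (1 / 2 - 1 / (2 * real s)))"
      by (simp add: right_diff_distrib diff_divide_distrib)
    then show ?thesis unfolding \<theta>eq by simp
  qed
  \<comment> \<open>The power of \<open>z\<close> after interpolation is \<eta>(1-\<theta>) +
    (\<eta>-1)\<theta> = \<eta> - \<theta>; this choice leaves -\<theta>/2.\<close>
  define \<eta> where "\<eta> = \<theta> / 2"
  have \<eta>: "0 < \<eta>" "\<eta> \<le> 1" using \<theta>0 \<theta>1 by (auto simp: \<eta>_def)
  obtain C1 where C1: "C1 \<ge> 1"
    "\<And>y z w P. P \<in> prime_sets y \<Longrightarrow> 0 < z \<Longrightarrow> z \<le> 2 * real (\<Prod>P) \<Longrightarrow> \<bar>w P\<bar> \<le> 4 ^ card P * inv_phi P \<Longrightarrow>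
      \<bar>w P\<bar> \<le> C1 * z powr (\<eta> - 1)"
    using that by (rule sieve_weight_le[OF \<eta>])
  obtain C2 where C2: "C2 \<ge> 1"
    "\<And>y z w F a b L. z \<ge> 1 \<Longrightarrow> F \<subseteq> sieve_sets y z \<Longrightarrow>
      sieve_weight y w \<Longrightarrow> z ^ s \<le> real L \<Longrightarrow>
      (\<Sum>m\<in>{a..<a + int L}. \<bar>\<Sum>P\<in>F. w P * ram_prod P (b + int y * m)\<bar> ^ s) \<le> C2 * z powr (\<eta> * real s) * real L"
    using that by (rule sieve_kernel_moment[OF \<eta>(1), of s])
  show thesis
  proof
    show "(2 * C2) powr ((1 - \<theta>) / real s) * (2 * C1) powr \<theta> \<ge> 1"
      using C1 C2 \<theta>0 \<theta>1 by (intro mult_ge1_I ge_one_powr_ge_zero) auto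
    show "\<theta> / 2 > 0" using \<theta>0 by simp
    fix y z F a b L and f g :: "int \<Rightarrow> real" and w :: "nat set \<Rightarrow> real"
    assume z: "z \<ge> 1" and F: "F \<subseteq> sieve_sets y z" and Fz: "\<forall>P\<in>F. z \<le> 2 * real (\<Prod>P)"
      and w: "sieve_weight y w"
      and L1: "z ^ s \<le> 2 * real L" and L2: "2 * z ^ 4 \<le> real L"
      and f: "\<forall>t. f t \<ge> 0" and g: "\<forall>x. g x \<ge> 0"
    \<comment> \<open>Differences of points of \<open>?I\<close> lie in \<open>?D\<close>, of length
      \<open>2 * L\<close>; the moment bound is applied on \<open>?D\<close>, so it asks for
      \<open>z ^ s <= 2 * L\<close>.\<close>
    let ?I = "{a..<a + int L}" and ?D = "{- int L..<- int L + int (2 * L)}"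
    define K where "K m = (\<Sum>P\<in>F. w P * ram_prod P (b + int y * m))" for m
    have "1 \<le> z ^ 4" using z by simp
    then have Lpos: "real L > 0" using L2 by linarith
    define A0 where "A0 = (2 * C2 * real L * z powr (\<eta> * real s)) powr (1 / real s)"
    define A1 where "A1 = 2 * C1 * real L * z powr (\<eta> - 1)"
    have Apos: "A0 > 0" "A1 > 0" using Lpos C1 C2 z by (auto simp: A0_def A1_def)
    have KA0: "(\<Sum>m\<in>?D. \<bar>K m\<bar> powr real s) powr (1 / real s) \<le> A0"
      unfolding A0_def
    proof (rule powr_mono2)
      have "(\<Sum>m\<in>?D. \<bar>K m\<bar> powr real s) = (\<Sum>m\<in>?D. \<bar>K m\<bar> ^ s)"
        using s2 by (intro sum.cong refl powr_realpow') auto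
      also have "\<dots> \<le> C2 * z powr (\<eta> * real s) * real (2 * L)"
        unfolding K_def using L1 by (intro C2 z F w) auto
      finally show "(\<Sum>m\<in>?D. \<bar>K m\<bar> powr real s) \<le> 2 * C2 * real L * z powr (\<eta> * real s)"
        by (simp add: mult_ac)
    qed (auto intro: sum_nonneg)
    have "norm (\<Sum>x\<in>?I. \<Sum>t\<in>?I. complex_of_real (K (x - t)) * of_real (f t) * of_real (g x)) \<le>
        A0 powr (1 - \<theta>) * A1 powr \<theta> * (\<Sum>t\<in>?I. f t powr r) powr (1 / r) * (\<Sum>x\<in>?I. g x powr r) powr (1 / r)"
    proof (rule bilinear_interpolation[where ?p0.0 = p0 and ?p1.0 = 2])
      fix f g :: "int \<Rightarrow> complex"
      have "norm (\<Sum>x\<in>?I. \<Sum>t\<in>?I. complex_of_real (K (x - t)) * f t * g x) \<le>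
          (\<Sum>x\<in>?I. \<Sum>t\<in>?I. \<bar>K (x - t)\<bar> * norm (f t) * norm (g x))"
        by (intro sum_norm_le) (simp add: norm_mult)
      also have "\<dots> \<le> (\<Sum>m\<in>?D. \<bar>K m\<bar> powr real s) powr (1 / real s) *
          (\<Sum>t\<in>?I. norm (f t) powr p0) powr (1 / p0) * (\<Sum>x\<in>?I. norm (g x) powr p0) powr (1 / p0)"
        using s2 p0 by (intro young_bilinear) auto
      also have "\<dots> \<le> A0 * (\<Sum>t\<in>?I. norm (f t) powr p0) powr (1 / p0) * (\<Sum>x\<in>?I. norm (g x) powr p0) powr (1 / p0)"
        by (intro mult_right_mono KA0) auto
      finally show "norm (\<Sum>x\<in>?I. \<Sum>t\<in>?I. complex_of_real (K (x - t)) * f t * g x) \<le>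
          A0 * (\<Sum>t\<in>?I. norm (f t) powr p0) powr (1 / p0) * (\<Sum>x\<in>?I. norm (g x) powr p0) powr (1 / p0)" .
    next
      fix f g :: "int \<Rightarrow> complex"
      have "norm (\<Sum>x\<in>?I. \<Sum>t\<in>?I. complex_of_real (K (x - t)) * f t * g x) \<le>
          2 * real L * (C1 * z powr (\<eta> - 1)) * sqrt (\<Sum>t\<in>?I. (norm (f t))\<^sup>2) * sqrt (\<Sum>x\<in>?I. (norm (g x))\<^sup>2)"
        unfolding K_def
      proof (rule sieve_kernel_L2[OF z F L2])
        fix P assume "P \<in> F"
        then show "\<bar>w P\<bar> \<le> C1 * z powr (\<eta> - 1)"
          using F z Fz w by (intro C1(2)[of P y]) (auto simp: sieve_sets_def sieve_weight_def)
      qed (use C1 in auto)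
      then show "norm (\<Sum>x\<in>?I. \<Sum>t\<in>?I. complex_of_real (K (x - t)) * f t * g x) \<le>
          A1 * (\<Sum>t\<in>?I. norm (f t) powr 2) powr (1 / 2) * (\<Sum>x\<in>?I. norm (g x) powr 2) powr (1 / 2)"
        by (simp add: A1_def powr_half_sqrt sum_nonneg mult_ac)
    qed (use p0 r rp Apos \<theta>0 \<theta>1 f g in auto)
    also have "(\<Sum>x\<in>?I. \<Sum>t\<in>?I. complex_of_real (K (x - t)) * of_real (f t) * of_real (g x)) =
        of_real (\<Sum>x\<in>?I. \<Sum>t\<in>?I. K (x - t) * f t * g x)" by simp
    also have "A0 powr (1 - \<theta>) * A1 powr \<theta> =
        (2 * C2) powr ((1 - \<theta>) / real s) * (2 * C1) powr \<theta> * z powr (- (\<theta> / 2)) * real L powr (2 - 2 / r)"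
    proof -
      have "A0 powr (1 - \<theta>) * A1 powr \<theta> = (2 * C2) powr ((1 - \<theta>) / real s) * (2 * C1) powr \<theta> *
          z powr (\<eta> * (1 - \<theta>) + (\<eta> - 1) * \<theta>) * real L powr ((1 - \<theta>) / real s + \<theta>)"
        unfolding A0_def A1_def using Lpos C1 C2 z s2
        by (simp add: powr_mult powr_powr powr_add)
      also have "\<eta> * (1 - \<theta>) + (\<eta> - 1) * \<theta> = - (\<theta> / 2)" by (simp add: \<eta>_def field_simps)
      finally show ?thesis unfolding Lexp .
    qed
    finally show "\<bar>\<Sum>x\<in>?I. \<Sum>t\<in>?I. (\<Sum>P\<in>F. w P * ram_prod P (b + int y * (x - t))) * f t * g x\<bar> \<le>
        (2 * C2) powr ((1 - \<theta>) / real s) * (2 * C1) powr \<theta> * z powr (- (\<theta> / 2)) * real L powr (2 - 2 / r) *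
        fin_norm r ?I f * fin_norm r ?I g"
      unfolding norm_of_real K_def fin_norm_def .
  qed
qed

text \<open>The expanded square is cut dyadically by the size of the modulus. The piece at level j
  gains a factor 2^(-\<kappa> j), so the sum over all levels is a geometric series whose bound does
  not depend on \<open>R\<close>. The factor \<open>sieve_mass\<close> is kept outside, to be
  cancelled later against the square of the mass.\<close>

lemma sieve_majorant_bound:
  fixes r :: real and s :: nat
  assumes r: "1 < r" "r < 2" and s: "r / (r - 1) \<le> real s"
  obtains C where "C \<ge> 1"
    "\<And>(y :: nat) R (a :: int) (b :: int) (L :: nat) f g.
      R \<ge> 1 \<Longrightarrow> (2 * R\<^sup>2) ^ s \<le> 2 * real L \<Longrightarrow> 2 * (2 * R\<^sup>2) ^ 4 \<le> real L \<Longrightarrow>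
      (\<forall>t. f t \<ge> 0) \<Longrightarrow> (\<forall>x. g x \<ge> 0) \<Longrightarrow>
      (\<Sum>x\<in>{a..<a + int L}. \<Sum>t\<in>{a..<a + int L}. (sieve_sum y R (b + int y * (x - t)))\<^sup>2 * f t * g x) \<le>
      sieve_mass y R * (C * real L powr (2 - 2 / r) * fin_norm r {a..<a + int L} f * fin_norm r {a..<a + int L} g)"
proof -
  obtain C \<kappa> where C: "C \<ge> 1" "\<kappa> > 0" and piece:
    "\<And>(y :: nat) z w F (a :: int) (b :: int) (L :: nat) f g.
      z \<ge> 1 \<Longrightarrow> F \<subseteq> sieve_sets y z \<Longrightarrow> (\<forall>P\<in>F. z \<le> 2 * real (\<Prod>P)) \<Longrightarrow>
      sieve_weight y w \<Longrightarrow>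
      z ^ s \<le> 2 * real L \<Longrightarrow> 2 * z ^ 4 \<le> real L \<Longrightarrow> (\<forall>t. f t \<ge> 0) \<Longrightarrow> (\<forall>x. g x \<ge> 0) \<Longrightarrow>
      \<bar>\<Sum>x\<in>{a..<a + int L}. \<Sum>t\<in>{a..<a + int L}. (\<Sum>P\<in>F. w P * ram_prod P (b + int y * (x - t))) * f t * g x\<bar> \<le>
      C * z powr (- \<kappa>) * real L powr (2 - 2 / r) * fin_norm r {a..<a + int L} f * fin_norm r {a..<a + int L} g"
    using that by (rule sieve_piece_bound[OF r s])
  define \<rho> where "\<rho> = 2 powr (- \<kappa>)"
  have \<rho>: "0 < \<rho>" "\<rho> < 1" using C by (auto simp: \<rho>_def powr_less_one)
  show thesis
  proof
    have "1 * 1 \<le> C * (1 / (1 - \<rho>))" using C \<rho> by (intro mult_mono) auto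
    then show "C * (1 / (1 - \<rho>)) \<ge> 1" by simp
    fix y :: nat and R :: real and a b :: int and L :: nat and f g :: "int \<Rightarrow> real"
    assume R: "R \<ge> 1" and L1: "(2 * R\<^sup>2) ^ s \<le> 2 * real L" and L2: "2 * (2 * R\<^sup>2) ^ 4 \<le> real L"
      and f: "\<forall>t. f t \<ge> 0" and g: "\<forall>x. g x \<ge> 0"
    let ?I = "{a..<a + int L}" and ?S = "sieve_sets y (R\<^sup>2)"
    let ?n = "\<lambda>x t. b + int y * (x - t)"
    obtain w where sq: "\<And>n. (sieve_sum y R n)\<^sup>2 = sieve_mass y R * (\<Sum>P\<in>?S. w P * ram_prod P n)"
      and w: "sieve_weight y w"
      using that by (rule sieve_square_expansion[OF R, of y])
    have "\<forall>P\<in>?S. \<exists>j. 2 ^ j \<le> \<Prod>P \<and> \<Prod>P < 2 ^ (j + 1)"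
      using prod_pos_prime_sets by (intro ballI ex_power_ivl1) (auto simp: sieve_sets_def Suc_le_eq)
    then obtain lev where lev: "\<And>P. P \<in> ?S \<Longrightarrow> 2 ^ lev P \<le> \<Prod>P \<and> \<Prod>P < 2 ^ (lev P + 1)" by metis
    \<comment> \<open>Only finiteness of the set of levels matters, so a crude bound is
      enough.\<close>
    define J where "J = nat \<lfloor>R\<^sup>2\<rfloor>"
    have levJ: "lev P \<le> J" if "P \<in> ?S" for P
    proof -
      have "lev P < 2 ^ lev P" by simp
      then have "lev P < \<Prod>P" using lev[OF that] by linarith
      then have "real (lev P) \<le> real (\<Prod>P)" by simp
      then have "real (lev P) \<le> R\<^sup>2" using that by (simp add: sieve_sets_def)
      then show ?thesis unfolding J_def by (simp add: le_nat_floor)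
    qed
    define F where "F j = {P\<in>?S. lev P = j}" for j
    define B where "B j = (\<Sum>x\<in>?I. \<Sum>t\<in>?I. (\<Sum>P\<in>F j. w P * ram_prod P (?n x t)) * f t * g x)" for j
    define X where "X = real L powr (2 - 2 / r) * fin_norm r ?I f * fin_norm r ?I g"
    have X0: "X \<ge> 0" by (simp add: X_def)
    have Bj: "B j \<le> C * X * \<rho> ^ j" for j
    proof (cases "F j = {}")
      case True
      then show ?thesis using C X0 \<rho> by (simp add: B_def)
    next
      case False
      \<comment> \<open>Moduli of level \<open>j\<close> lie between \<open>?z / 2\<close> and
        \<open>?z\<close>. One of them exists and is at most R^2, so \<open>?z <= 2 * R^2\<close>
        and the size conditions on \<open>2 * R^2\<close> carry over.\<close>
      let ?z = "2 ^ (j + 1) :: real"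
      have Fz: "2 ^ j \<le> real (\<Prod>P)" "real (\<Prod>P) < ?z" if "P \<in> F j" for P
      proof -
        have "2 ^ j \<le> \<Prod>P" "\<Prod>P < 2 ^ (j + 1)" using lev[of P] that by (auto simp: F_def)
        then have "real (2 ^ j) \<le> real (\<Prod>P)" "real (\<Prod>P) < real (2 ^ (j + 1))" 
          by (simp_all only: of_nat_le_iff of_nat_less_iff)
        then show "2 ^ j \<le> real (\<Prod>P)" "real (\<Prod>P) < ?z" by simp_all
      qed
      obtain P where P: "P \<in> F j" using False by blast
      then have "real (\<Prod>P) \<le> R\<^sup>2" by (simp add: F_def sieve_sets_def)
      then have zR: "?z \<le> 2 * R\<^sup>2" using order_trans[OF Fz(1)[OF P]] by simp
      have "\<bar>B j\<bar> \<le> C * ?z powr (- \<kappa>) * real L powr (2 - 2 / r) * fin_norm r ?I f * fin_norm r ?I g"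
        unfolding B_def
      proof (rule piece)
        show "F j \<subseteq> sieve_sets y ?z" using Fz(2) by (auto simp: F_def sieve_sets_def intro: less_imp_le)
        show "\<forall>P\<in>F j. ?z \<le> 2 * real (\<Prod>P)" using Fz(1) by simp
        show "?z ^ s \<le> 2 * real L" using order_trans[OF power_mono[OF zR] L1] by simp
        show "2 * ?z ^ 4 \<le> real L"
          using order_trans[OF mult_left_mono[OF power_mono[OF zR, of 4], of 2] L2] by simp
        show "1 \<le> ?z" by (rule one_le_power) simp
      qed (use w f g in auto)
      also have "\<dots> = C * X * ?z powr (- \<kappa>)" by (simp add: X_def)
      also have "\<dots> \<le> C * X * \<rho> ^ j"
      proof (intro mult_left_mono)
        have "?z powr (- \<kappa>) = \<rho> ^ (j + 1)"
          unfolding \<rho>_def by (metis powr_powr powr_realpow powr_gt_zero mult.commute zero_less_numeral)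
        also have "\<dots> \<le> \<rho> ^ j" using \<rho> by (intro power_decreasing) auto
        finally show "?z powr (- \<kappa>) \<le> \<rho> ^ j" .
      qed (use C X0 in auto)
      finally show ?thesis by simp
    qed
    have "(\<Sum>x\<in>?I. \<Sum>t\<in>?I. (\<Sum>P\<in>?S. w P * ram_prod P (?n x t)) * f t * g x) = (\<Sum>j\<le>J. B j)"
    proof -
      have "(\<Sum>P\<in>?S. w P * ram_prod P n) = (\<Sum>j\<le>J. \<Sum>P\<in>F j. w P * ram_prod P n)" for n
        unfolding F_def using levJ by (intro sum.group[symmetric]) auto
      then show ?thesis
        unfolding B_def by (simp add: sum_distrib_right sum.swap[of _ "{..J}"])
    qed
    also have "\<dots> \<le> (\<Sum>j\<le>J. C * X * \<rho> ^ j)" by (intro sum_mono Bj)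
    also have "\<dots> = C * X * (\<Sum>j\<le>J. \<rho> ^ j)" by (simp add: sum_distrib_left)
    also have "(\<Sum>j\<le>J. \<rho> ^ j) \<le> 1 / (1 - \<rho>)"
      using \<rho> by (simp add: sum_gp0 divide_right_mono)
    then have "C * X * (\<Sum>j\<le>J. \<rho> ^ j) \<le> C * X * (1 / (1 - \<rho>))" using C X0 by (intro mult_left_mono) auto
    finally have main: "(\<Sum>x\<in>?I. \<Sum>t\<in>?I. (\<Sum>P\<in>?S. w P * ram_prod P (?n x t)) * f t * g x) \<le> C * X * (1 / (1 - \<rho>))" .
    have "(\<Sum>x\<in>?I. \<Sum>t\<in>?I. (sieve_sum y R (?n x t))\<^sup>2 * f t * g x) =
        sieve_mass y R * (\<Sum>x\<in>?I. \<Sum>t\<in>?I. (\<Sum>P\<in>?S. w P * ram_prod P (?n x t)) * f t * g x)"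
      unfolding sq by (simp only: sum_distrib_left[of "sieve_mass y R" _ ?I] mult.assoc)
    also have "\<dots> \<le> sieve_mass y R * (C * X * (1 / (1 - \<rho>)))"
      using main sieve_mass_ge_1[OF R, of y] by (intro mult_left_mono) auto
    finally show "(\<Sum>x\<in>?I. \<Sum>t\<in>?I. (sieve_sum y R (?n x t))\<^sup>2 * f t * g x) \<le>
        sieve_mass y R * (C * (1 / (1 - \<rho>)) * real L powr (2 - 2 / r) * fin_norm r ?I f * fin_norm r ?I g)"
      by (simp add: X_def mult_ac)
  qed
qed

section \<open>From the sieve majorant to primes in a progression\<close>

text \<open>The prime powers that the sieve does not detect, the primes up to \<open>R\<close>
  included; there are too few of them to matter.\<close>

definition small_prime_powers :: "real \<Rightarrow> nat \<Rightarrow> nat set" where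
  "small_prime_powers R N = {n. n < N \<and> (\<exists>p k. prime p \<and> real p \<le> R \<and> k > 0 \<and> n = p ^ k)}"

lemma card_small_prime_powers_le:
  assumes R: "R \<ge> 1" and N: "N \<ge> 1"
  shows "finite (small_prime_powers R N)" "real (card (small_prime_powers R N)) \<le> 2 * R * ln (real N)"
proof -
  let ?K = "nat \<lfloor>log 2 (real N)\<rfloor>"
  let ?T = "{1..nat \<lfloor>R\<rfloor>} \<times> {1..?K}"
  have sub: "small_prime_powers R N \<subseteq> (\<lambda>(p, k). p ^ k) ` ?T"
  proof
    fix n assume "n \<in> small_prime_powers R N"
    then obtain p k where n: "n < N" "prime p" "real p \<le> R" "k > 0" "n = p ^ k"
      by (auto simp: small_prime_powers_def)
    have "2 ^ k \<le> p ^ k" using n prime_ge_2_nat by (intro power_mono) auto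
    then have "2 ^ k \<le> N" using n by linarith
    then have "real (2 ^ k) \<le> real N" by (rule of_nat_mono)
    then have "2 powr real k \<le> real N" by (simp add: powr_realpow)
    then have "real k \<le> log 2 (real N)" using N by (subst le_log_iff) auto
    then have "k \<le> ?K" by (simp add: le_nat_floor)
    moreover have "p \<le> nat \<lfloor>R\<rfloor>" using n by (simp add: le_nat_floor)
    ultimately have "(p, k) \<in> ?T" using n prime_ge_1_nat by auto
    then show "n \<in> (\<lambda>(p, k). p ^ k) ` ?T" using n(5) by (intro image_eqI[of _ _ "(p, k)"]) simp_all
  qed
  then show "finite (small_prime_powers R N)" by (rule finite_subset) simp
  have "card (small_prime_powers R N) \<le> card ((\<lambda>(p, k). p ^ k) ` ?T)" using sub by (intro card_mono) auto
  also have "\<dots> \<le> card ?T" by (rule card_image_le) simp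
  also have "\<dots> = nat \<lfloor>R\<rfloor> * ?K" by simp
  finally have "real (card (small_prime_powers R N)) \<le> real (nat \<lfloor>R\<rfloor> * ?K)" by (rule of_nat_mono)
  also have "\<dots> \<le> R * log 2 (real N)"
    unfolding of_nat_mult using R N by (intro mult_mono) auto
  also have "\<dots> \<le> R * (2 * ln (real N))"
  proof (intro mult_left_mono)
    have "ln 2 \<ge> (1/2 :: real)" using ln_le_minus_one[of "1/2::real"] by (simp add: ln_div)
    then have "ln (real N) * 1 \<le> ln (real N) * (2 * ln 2)" using N by (intro mult_left_mono) auto
    then show "log 2 (real N) \<le> 2 * ln (real N)" by (simp add: log_def divide_le_eq mult_ac)
  qed (use R in auto)
  finally show "real (card (small_prime_powers R N)) \<le> 2 * R * ln (real N)" by simp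
qed

text \<open>A power of a prime above \<open>R\<close> has no prime factor up to \<open>R\<close>, so
  there the sieve sum equals the mass and the first term is exactly \<open>ln N\<close>.\<close>

lemma mangoldt_le_sieve:
  assumes R: "R \<ge> 1" and n: "1 \<le> n" "n < N"
  shows "mangoldt n \<le> ln (real N) / (sieve_mass y R)\<^sup>2 * (sieve_sum y R (int n))\<^sup>2 +
    (if n \<in> small_prime_powers R N then ln (real N) else 0)"
proof -
  have lnN: "ln (real N) \<ge> 0" using n by simp
  have mass: "sieve_mass y R > 0" using sieve_mass_ge_1[OF R, of y] by linarith
  have nn: "0 \<le> ln (real N) / (sieve_mass y R)\<^sup>2 * (sieve_sum y R (int n))\<^sup>2"
    using lnN by (intro mult_nonneg_nonneg divide_nonneg_nonneg) auto
  show ?thesis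
  proof (cases "primepow n")
    case False
    then show ?thesis using nn lnN by (simp add: mangoldt_def)
  next
    case True
    then obtain p k where pk: "prime p" "k > 0" "n = p ^ k" by (auto simp: primepow_def)
    have "p \<le> n" using pk n by (metis dvd_imp_le dvd_power less_le_trans zero_less_one)
    then have "ln (real p) \<le> ln (real N)" using pk n prime_gt_0_nat by (subst ln_le_cancel_iff) auto
    then have le: "mangoldt n \<le> ln (real N)" using pk by simp
    show ?thesis
    proof (cases "real p \<le> R")
      case True
      then have "n \<in> small_prime_powers R N" using pk n by (auto simp: small_prime_powers_def)
      then show ?thesis using le nn by simp
    next
      case False
      have "sieve_sum y R (int n) = sieve_mass y R"
      proof (rule sieve_sum_eq_mass)
        fix q :: nat assume q: "prime q" "real q \<le> R"
        show "\<not> int q dvd int n"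
        proof
          assume "int q dvd int n"
          then have "q dvd p ^ k" unfolding pk(3) by (simp only: of_nat_dvd_iff)
          then have "q = p" using q pk by (metis prime_dvd_power primes_dvd_imp_eq)
          then show False using q False by simp
        qed
      qed
      then show ?thesis using le lnN mass by simp
    qed
  qed
qed

section \<open>Convolution along one residue class\<close>

text \<open>Writing n = b + y m, the average acts on each residue class of x modulo \<open>y\<close>
  as a convolution in the quotient variable, and this is its kernel; the value 0 is used outside the
  range of summation.\<close>

definition progression_kernel :: "nat \<Rightarrow> nat \<Rightarrow> nat \<Rightarrow> int \<Rightarrow> real" where
  "progression_kernel N y b m =
    (if 0 \<le> m \<and> int b + int y * m < int N
     then real (totient y) / real N * mangoldt (nat (int b + int y * m)) else 0)"

lemma progression_kernel_nonneg: "progression_kernel N y b m \<ge> 0"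
  by (simp add: progression_kernel_def mangoldt_nonneg)

text \<open>Young's inequality for a kernel that takes the value \<open>c\<close> at no more than
  \<open>card E\<close> points: its l^s norm is at most \<open>c * card E\<close> because
  \<open>s >= 1\<close>. This wasteful bound suffices for a set as sparse as the small prime
  powers.\<close>

lemma exceptional_kernel_bound:
  fixes f g :: "int \<Rightarrow> real" and a b :: int and L :: nat
  assumes r: "1 < r" "r < 2" and c: "c \<ge> 0" and E: "finite E" and y: "y \<ge> (1::nat)"
    and fg: "\<forall>t. f t \<ge> 0" "\<forall>x. g x \<ge> 0"
  defines "I \<equiv> {a..<a + int L}"
  shows "(\<Sum>x\<in>I. \<Sum>t\<in>I. (if 0 \<le> b + int y * (x - t) \<and> nat (b + int y * (x - t)) \<in> E then c else 0) * f t * g x)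
    \<le> c * real (card E) * fin_norm r I f * fin_norm r I g"
proof -
  define K where "K m = (if 0 \<le> b + int y * m \<and> nat (b + int y * m) \<in> E then c else 0)" for m
  \<comment> \<open>Half the dual exponent, which is what Young's inequality needs to pair l^r with
    l^r.\<close>
  define s where "s = r / (2 * (r - 1))"
  have s: "s \<ge> 1" "1 / r = 1 - 1 / (2 * s)" using r by (auto simp: s_def field_simps)
  let ?D = "{- int L..int L}"
  let ?M = "{m\<in>?D. 0 \<le> b + int y * m \<and> nat (b + int y * m) \<in> E}"
  have "(\<Sum>x\<in>I. \<Sum>t\<in>I. K (x - t) * f t * g x) \<le>
      (\<Sum>m\<in>?D. K m powr s) powr (1 / s) * (\<Sum>t\<in>I. f t powr r) powr (1 / r) * (\<Sum>x\<in>I. g x powr r) powr (1 / r)"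
    using s c fg by (intro young_bilinear) (auto simp: I_def K_def)
  also have "\<dots> \<le> c * real (card E) * (\<Sum>t\<in>I. f t powr r) powr (1 / r) * (\<Sum>x\<in>I. g x powr r) powr (1 / r)"
  proof (intro mult_right_mono)
    have finM: "finite ?M" by (rule finite_subset[of _ ?D]) auto
    have "inj_on (\<lambda>m. nat (b + int y * m)) ?M"
      using y by (auto simp: inj_on_def nat_eq_iff2)
    then have "card ?M \<le> card E" using E by (intro card_inj_on_le) auto
    have "(\<Sum>m\<in>?D. K m powr s) = (\<Sum>m\<in>?D. if 0 \<le> b + int y * m \<and> nat (b + int y * m) \<in> E then c powr s else 0)"
      by (intro sum.cong refl) (simp add: K_def)
    also have "\<dots> = real (card ?M) * c powr s"
      by (subst sum.inter_filter[symmetric]) auto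
    finally have "(\<Sum>m\<in>?D. K m powr s) powr (1 / s) = real (card ?M) powr (1 / s) * c"
      using s c by (simp add: powr_mult powr_powr)
    also have "\<dots> \<le> real (card E) * c"
    proof (intro mult_right_mono)
      show "real (card ?M) powr (1 / s) \<le> real (card E)"
      proof (cases "card ?M = 0")
        case False
        then have "real (card ?M) powr (1 / s) \<le> real (card ?M) powr 1"
          using s by (intro powr_mono) (auto simp: divide_le_eq_1)
        then show ?thesis using \<open>card ?M \<le> card E\<close> False by simp
      qed (simp only:, simp)
    qed (use c in auto)
    finally show "(\<Sum>m\<in>?D. K m powr s) powr (1 / s) \<le> c * real (card E)" by (simp add: mult.commute)
  qed auto
  finally show ?thesis unfolding K_def fin_norm_def .
qed

text \<open>The main term is the sieve majorant, of size q L^(2-2/r) with q = y/N and L of order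
  1/q, that is q^(2/r-1). The small prime powers contribute about q R (ln N)^2, and q^(2-2/r) is a
  negative power of \<open>N\<close> that outweighs R (ln N)^2.\<close>

lemma progression_local_bound:
  fixes r :: real and s :: nat
  assumes r: "1 < r" "r < 2" and s: "r / (r - 1) \<le> real s"
  obtains C where "C \<ge> 1"
    "\<And>(y :: nat) N b (a :: int) f g. y \<ge> 1 \<Longrightarrow> y\<^sup>2 \<le> N \<Longrightarrow> 2 ^ (8 * s) \<le> N \<Longrightarrow> b \<ge> 1 \<Longrightarrow>
      (\<forall>t. f t \<ge> 0) \<Longrightarrow> (\<forall>x. g x \<ge> 0) \<Longrightarrow>
      (\<Sum>x\<in>{a..<a + int (2 * (N div y + 1))}. \<Sum>t\<in>{a..<a + int (2 * (N div y + 1))}.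
        progression_kernel N y b (x - t) * f t * g x) \<le>
      C * (real y / real N) powr (2 / r - 1) *
        fin_norm r {a..<a + int (2 * (N div y + 1))} f * fin_norm r {a..<a + int (2 * (N div y + 1))} g"
proof -
  obtain C where C: "C \<ge> 1" and major:
    "\<And>(y :: nat) R (a :: int) (b :: int) (L :: nat) f g.
      R \<ge> 1 \<Longrightarrow> (2 * R\<^sup>2) ^ s \<le> 2 * real L \<Longrightarrow> 2 * (2 * R\<^sup>2) ^ 4 \<le> real L \<Longrightarrow>
      (\<forall>t. f t \<ge> 0) \<Longrightarrow> (\<forall>x. g x \<ge> 0) \<Longrightarrow>
      (\<Sum>x\<in>{a..<a + int L}. \<Sum>t\<in>{a..<a + int L}. (sieve_sum y R (b + int y * (x - t)))\<^sup>2 * f t * g x) \<le>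
      sieve_mass y R * (C * real L powr (2 - 2 / r) * fin_norm r {a..<a + int L} f * fin_norm r {a..<a + int L} g)"
    using that by (rule sieve_majorant_bound[OF r s])
  have "2 < r / (r - 1)" using r by (simp add: field_simps)
  then have s2: "2 < real s" using s by linarith
  then have s3: "s \<ge> 3" by linarith
  have e: "0 < 2 - 2 / r" "2 - 2 / r \<le> 1" using r by (auto simp: field_simps)
  have es: "1 / real s \<le> 1 - 1 / r" using r s s2 by (simp add: field_simps)
  show thesis
  proof
    \<comment> \<open>128 = 32 * 4 collects the loss of the sieve and the ratio of \<open>L\<close>
      to N/y; 512 = 2 * 16^2 comes from the count of small prime powers and from two logarithms
      bounded by \<open>16 * s * R\<close>.\<close>
    have "0 \<le> 512 * (real s)\<^sup>2" by simp
    moreover have "1 * 1 \<le> 128 * real s * C" using C s2 by (intro mult_mono) auto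
    ultimately show "128 * real s * C + 512 * (real s)\<^sup>2 \<ge> 1" by linarith
    fix y N b :: nat and a :: int and f g :: "int \<Rightarrow> real"
    assume y: "y \<ge> 1" and yN: "y\<^sup>2 \<le> N" and N: "2 ^ (8 * s) \<le> N" and b: "b \<ge> 1"
      and f: "\<forall>t. f t \<ge> 0" and g: "\<forall>x. g x \<ge> 0"
    \<comment> \<open>Two adjacent blocks of \<open>N div y + 1\<close> points: the kernel reaches
      back by less than one block.\<close>
    define L where "L = 2 * (N div y + 1)"
    let ?I = "{a..<a + int L}"
    \<comment> \<open>The moduli go up to R^2 and their dyadic ends up to 2 R^2. With this
      \<open>R\<close> the s-th power of R^2 is N^(1/8), and 2^s is at most N^(1/8) as well, while L
      >= N^(1/2).\<close>
    define R where "R = real N powr (1 / (16 * real s))"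
    define q where "q = real y / real N"
    define X where "X = fin_norm r ?I f * fin_norm r ?I g"
    have X0: "X \<ge> 0" by (simp add: X_def)
    have "(2::nat) ^ 1 \<le> 2 ^ (8 * s)" using s3 by (intro power_increasing) auto
    then have N2: "N \<ge> 2" using N by simp
    have Npos: "real N > 0" "real N \<ge> 1" using N2 by auto
    have lnN: "ln (real N) > 0" using N2 by simp
    have R1: "R \<ge> 1" unfolding R_def using Npos s2 by (intro ge_one_powr_ge_zero) auto
    have lnR: "ln R = ln (real N) / (16 * real s)" unfolding R_def using Npos by (simp add: ln_powr)
    have q: "q > 0" unfolding q_def using y Npos by simp
    have "real (y\<^sup>2) \<le> real N" using yN by (rule of_nat_mono)
    then have "(real y)\<^sup>2 \<le> real N" by simp
    then have ysq: "real y \<le> real N powr (1/2)" using Npos by (simp add: powr_half_sqrt real_le_rsqrt)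
    have sqsq: "real N powr (1/2) * real N powr (1/2) = real N" using Npos by (simp flip: powr_add)
    have Nhalf: "real N powr (1/2) \<le> 1 / q"
    proof -
      have "real N powr (1/2) * real y \<le> real N"
        using mult_left_mono[OF ysq, of "real N powr (1/2)"] sqsq by simp
      then show ?thesis using y by (simp add: q_def field_simps)
    qed
    have qle: "q \<le> real N powr (-1/2)"
    proof -
      have "q \<le> 1 / real N powr (1/2)" using Nhalf q Npos by (simp add: field_simps)
      then show ?thesis using Npos by (simp add: powr_minus_divide)
    qed
    have Ldiv: "1 / q \<le> real L" "real L \<le> 4 / q"
    proof -
      have "N mod y < y" using y by simp
      then have "N < y * (N div y) + y" using mult_div_mod_eq[of y N] by linarith
      then have "N < y * (N div y + 1)" by simp
      then have "real N < real (y * (N div y + 1))" by (simp only: of_nat_less_iff)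
      then have "real N \<le> real y * real (N div y + 1)" unfolding of_nat_mult by (rule less_imp_le)
      then have "real N / real y \<le> real (N div y + 1)" using y by (simp add: divide_le_eq mult.commute)
      then show "1 / q \<le> real L" by (simp add: q_def L_def)
      have "y \<le> N" using yN y by (metis le_trans power2_nat_le_imp_le le_square power2_eq_square)
      then have "1 \<le> real N / real y" using y by simp
      moreover have "real (N div y) \<le> real N / real y" by (rule of_nat_div_le_of_nat)
      ultimately show "real L \<le> 4 / q" by (simp add: q_def L_def)
    qed
    have "2 ^ s \<le> real N powr (1/8)"
    proof -
      have "real (2 ^ (8 * s)) \<le> real N" using N by (rule of_nat_mono)
      then have "2 powr real (8 * s) \<le> real N" by (subst powr_realpow) auto
      then have "(2 powr real (8 * s)) powr (1/8) \<le> real N powr (1/8)"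
        by (intro powr_mono2) auto
      then show ?thesis by (simp add: powr_powr powr_realpow)
    qed
    have cond1: "(2 * R\<^sup>2) ^ s \<le> 2 * real L"
    proof -
      have "R ^ (2 * s) = real N powr (1/8)"
        unfolding R_def using Npos s2 by (simp add: powr_realpow[symmetric] powr_powr)
      then have "(2 * R\<^sup>2) ^ s = 2 ^ s * real N powr (1/8)" by (simp add: power_mult_distrib power_mult)
      also have "\<dots> \<le> real N powr (1/8) * real N powr (1/8)"
        using \<open>2 ^ s \<le> real N powr (1/8)\<close> by (intro mult_right_mono) auto
      also have "\<dots> = real N powr (1/4)" by (simp flip: powr_add)
      also have "\<dots> \<le> real N powr (1/2)" using Npos by (intro powr_mono) auto
      finally show ?thesis using Nhalf Ldiv by linarith
    qed
    have cond2: "2 * (2 * R\<^sup>2) ^ 4 \<le> real L"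
    proof -
      have "R ^ 8 = real N powr (1 / (2 * real s))"
        unfolding R_def using Npos s2 by (simp add: powr_realpow[symmetric] powr_powr)
      also have "\<dots> \<le> real N powr (1 / 6)"
        using Npos s3 by (intro powr_mono) (auto simp: field_simps)
      finally have R8: "R ^ 8 \<le> real N powr (1 / 6)" .
      \<comment> \<open>24 = 8 * 3 from \<open>s >= 3\<close>; the fourth root of N is thus at least
        64, more than the factor 32 to be absorbed.\<close>
      have "(2::nat) ^ 24 \<le> 2 ^ (8 * s)" using s3 by (intro power_increasing) auto
      then have "(2::nat) ^ 24 \<le> N" using N by linarith
      then have "real (2 ^ 24) \<le> real N" by (rule of_nat_mono)
      then have "(2 powr 24) powr (1/4) \<le> real N powr (1/4)"
        by (intro powr_mono2) (auto simp: powr_numeral)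
      then have "2 powr 6 \<le> real N powr (1/4)" by (simp only: powr_powr) simp
      then have 64: "64 \<le> real N powr (1/4)" by (simp add: powr_numeral)
      have "2 * (2 * R\<^sup>2) ^ 4 = 32 * R ^ 8" by (simp add: power_mult_distrib flip: power_mult)
      also have "\<dots> \<le> real N powr (1/4) * real N powr (1/6)"
        using 64 R8 R1 by (intro mult_mono) auto
      also have "\<dots> = real N powr (1/4 + 1/6)" by (rule powr_add[symmetric])
      also have "\<dots> \<le> real N powr (1/2)" using Npos by (intro powr_mono) auto
      finally show ?thesis using Nhalf Ldiv by linarith
    qed
    define mass where "mass = sieve_mass y R"
    have mass: "mass > 0" unfolding mass_def using sieve_mass_ge_1[OF R1, of y] by linarith
    have tot: "real (totient y) > 0" using y by simp
    define c where "c = real (totient y) / real N * ln (real N)"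
    have c0: "c \<ge> 0" unfolding c_def using lnN Npos by simp
    let ?n = "\<lambda>m. int b + int y * m"
    let ?E = "small_prime_powers R N"
    let ?e = "\<lambda>m. if 0 \<le> ?n m \<and> nat (?n m) \<in> ?E then c else 0"
    have kernel: "progression_kernel N y b m \<le> c / mass\<^sup>2 * (sieve_sum y R (?n m))\<^sup>2 + ?e m" for m
    proof (cases "0 \<le> m \<and> ?n m < int N")
      case False
      then show ?thesis using c0 by (auto simp: progression_kernel_def)
    next
      case True
      then have "0 \<le> int y * m" by simp
      then have "1 \<le> ?n m" using b by linarith
      then have n: "1 \<le> nat (?n m)" "nat (?n m) < N" "int (nat (?n m)) = ?n m"
        using True by (auto simp: nat_less_iff le_nat_iff)
      have "progression_kernel N y b m = real (totient y) / real N * mangoldt (nat (?n m))"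
        using True by (simp add: progression_kernel_def)
      also have "\<dots> \<le> real (totient y) / real N *
          (ln (real N) / mass\<^sup>2 * (sieve_sum y R (?n m))\<^sup>2 + (if nat (?n m) \<in> ?E then ln (real N) else 0))"
        using mangoldt_le_sieve[OF R1 n(1,2), of y] unfolding n(3) mass_def by (intro mult_left_mono) auto
      also have "\<dots> \<le> c / mass\<^sup>2 * (sieve_sum y R (?n m))\<^sup>2 + ?e m"
        using True by (auto simp: c_def distrib_left)
      finally show ?thesis .
    qed
    have "(\<Sum>x\<in>?I. \<Sum>t\<in>?I. progression_kernel N y b (x - t) * f t * g x) \<le>
        (\<Sum>x\<in>?I. \<Sum>t\<in>?I. (c / mass\<^sup>2 * (sieve_sum y R (?n (x - t)))\<^sup>2 + ?e (x - t)) * f t * g x)"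
      using f g kernel by (intro sum_mono mult_right_mono) auto
    also have "\<dots> = c / mass\<^sup>2 * (\<Sum>x\<in>?I. \<Sum>t\<in>?I. (sieve_sum y R (?n (x - t)))\<^sup>2 * f t * g x) +
        (\<Sum>x\<in>?I. \<Sum>t\<in>?I. ?e (x - t) * f t * g x)"
      by (simp only: distrib_right sum.distrib sum_distrib_left mult.assoc)
    also have "\<dots> \<le> c / mass\<^sup>2 * (mass * (C * real L powr (2 - 2 / r) * fin_norm r ?I f * fin_norm r ?I g)) +
        c * real (card ?E) * fin_norm r ?I f * fin_norm r ?I g"
      unfolding mass_def using c0 r f g y card_small_prime_powers_le(1)[OF R1, of N] N2
      by (intro add_mono mult_left_mono major[OF R1 cond1 cond2] exceptional_kernel_bound) auto
    also have "\<dots> = (c / mass * (C * real L powr (2 - 2 / r)) + c * real (card ?E)) * X"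
      using mass by (simp add: X_def power2_eq_square algebra_simps)
    also have "\<dots> \<le> ((128 * real s * C + 512 * (real s)\<^sup>2) * q powr (2 / r - 1)) * X"
    proof (intro mult_right_mono X0)
      have qsplit: "q powr (2 / r - 1) * q powr (2 - 2 / r) = q" using q by (simp flip: powr_add)
      \<comment> \<open>Here the logarithms cancel: \<open>ln R\<close> is \<open>ln N\<close>
        divided by \<open>16 * s\<close>, and the totient in \<open>c\<close> is matched by the one
        in the lower bound for the mass.\<close>
      have "c / mass \<le> 32 * real s * q"
      proof -
        have "real (totient y) / real y * ln R / 2 \<le> mass"
          unfolding mass_def by (rule sieve_mass_ge[OF R1 y])
        then have m: "real (totient y) / real y * ln (real N) / (32 * real s) \<le> mass" by (simp add: lnR)
        have "c = 32 * real s * q * (real (totient y) / real y * ln (real N) / (32 * real s))"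
          using y Npos s2 by (simp add: c_def q_def)
        also have "\<dots> \<le> 32 * real s * q * mass" using m q by (intro mult_left_mono) auto
        finally show ?thesis using mass by (simp add: divide_le_eq)
      qed
      moreover have "real L powr (2 - 2 / r) \<le> 4 * (1 / q) powr (2 - 2 / r)"
      proof -
        have "real L powr (2 - 2 / r) \<le> (4 / q) powr (2 - 2 / r)"
          using Ldiv e by (intro powr_mono2) auto
        also have "\<dots> = 4 powr (2 - 2 / r) * (1 / q) powr (2 - 2 / r)"
          using q powr_mult[of 4 "1 / q" "2 - 2 / r"] by simp
        also have "\<dots> \<le> 4 * (1 / q) powr (2 - 2 / r)"
          using e powr_mono[of "2 - 2 / r" 1 "4::real"] by (intro mult_right_mono) auto
        finally show ?thesis .
      qed
      ultimately have "c / mass * (C * real L powr (2 - 2 / r)) \<le> (32 * real s * q) * (C * (4 * (1 / q) powr (2 - 2 / r)))"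
        using C q by (intro mult_mono mult_left_mono) auto
      also have "\<dots> = 128 * real s * C * (q * (1 / q) powr (2 - 2 / r))" by simp
      also have "q * (1 / q) powr (2 - 2 / r) = q powr (2 / r - 1)"
      proof -
        have "(1 / q) powr (2 - 2 / r) = q powr (2 / r - 2)"
          using q by (simp add: powr_divide powr_minus_divide[symmetric])
        then show ?thesis using q powr_add[of q 1 "2 / r - 2"] by simp
      qed
      finally have t1: "c / mass * (C * real L powr (2 - 2 / r)) \<le> 128 * real s * C * q powr (2 / r - 1)" .
      have "c \<le> q * ln (real N)"
      proof -
        have "real (totient y) \<le> real y" by (simp add: totient_le)
        then show ?thesis unfolding c_def q_def using lnN Npos
          by (intro mult_right_mono divide_right_mono) auto
      qed
      then have "c * real (card ?E) \<le> (q * ln (real N)) * (2 * R * ln (real N))"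
        using card_small_prime_powers_le(2)[OF R1, of N] N2 c0 q lnN by (intro mult_mono) auto
      also have "\<dots> = 2 * q * (R * (ln (real N))\<^sup>2)" by (simp add: power2_eq_square)
      also have "\<dots> = 2 * q powr (2 / r - 1) * (q powr (2 - 2 / r) * (R * (ln (real N))\<^sup>2))"
        using qsplit by (metis mult.assoc)
      \<comment> \<open>From q <= N^(-1/2) and \<open>1/s <= 1 - 1/r\<close> the first factor is at
        most N^(-1/s). Each logarithm is at most \<open>16 * s * R\<close>, and R^3 is only N^(3/(16
        s)).\<close>
      also have "q powr (2 - 2 / r) * (R * (ln (real N))\<^sup>2) \<le> 256 * (real s)\<^sup>2"
      proof -
        have "q powr (2 - 2 / r) \<le> (real N powr (-1/2)) powr (2 - 2 / r)"
          using qle q e by (intro powr_mono2) auto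
        also have "\<dots> = real N powr (- (1 - 1 / r))" by (simp add: powr_powr diff_divide_distrib)
        also have "\<dots> \<le> real N powr (- (1 / real s))" using Npos es by (intro powr_mono) auto
        finally have q1: "q powr (2 - 2 / r) \<le> real N powr (- (1 / real s))" .
        have "ln (real N) \<le> real N powr (1 / (16 * real s)) / (1 / (16 * real s))"
          using Npos s2 by (intro ln_powr_bound) auto
        then have "ln (real N) \<le> 16 * real s * R" by (simp add: R_def mult.commute)
        then have "(ln (real N))\<^sup>2 \<le> (16 * real s * R)\<^sup>2" using lnN by (intro power_mono) auto
        then have "q powr (2 - 2 / r) * (R * (ln (real N))\<^sup>2) \<le> real N powr (- (1 / real s)) * (R * (16 * real s * R)\<^sup>2)"
          using q1 R1 by (intro mult_mono) auto
        also have "\<dots> = 256 * (real s)\<^sup>2 * (real N powr (- (1 / real s)) * R ^ 3)"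
          by (simp add: power2_eq_square power3_eq_cube)
        also have "real N powr (- (1 / real s)) * R ^ 3 = real N powr (- (13 / (16 * real s)))"
          unfolding R_def using Npos s2
          by (simp add: powr_realpow[symmetric] powr_powr flip: powr_add)
        also have "256 * (real s)\<^sup>2 * real N powr (- (13 / (16 * real s))) \<le> 256 * (real s)\<^sup>2 * real N powr 0"
          using Npos by (intro mult_left_mono powr_mono) auto
        finally show ?thesis using Npos by simp
      qed
      then have "2 * q powr (2 / r - 1) * (q powr (2 - 2 / r) * (R * (ln (real N))\<^sup>2)) \<le>
          2 * q powr (2 / r - 1) * (256 * (real s)\<^sup>2)" by (intro mult_left_mono) auto
      finally have t2: "c * real (card ?E) \<le> 512 * (real s)\<^sup>2 * q powr (2 / r - 1)" by (simp add: mult_ac)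
      show "c / mass * (C * real L powr (2 - 2 / r)) + c * real (card ?E) \<le>
          (128 * real s * C + 512 * (real s)\<^sup>2) * q powr (2 / r - 1)"
        using t1 t2 by (simp add: distrib_right)
    qed
    finally show "(\<Sum>x\<in>{a..<a + int (2 * (N div y + 1))}. \<Sum>t\<in>{a..<a + int (2 * (N div y + 1))}.
        progression_kernel N y b (x - t) * f t * g x) \<le>
      (128 * real s * C + 512 * (real s)\<^sup>2) * (real y / real N) powr (2 / r - 1) *
        fin_norm r {a..<a + int (2 * (N div y + 1))} f * fin_norm r {a..<a + int (2 * (N div y + 1))} g"
      unfolding X_def q_def L_def by (simp only: mult.assoc)
  qed
qed

section \<open>From local bilinear forms to norms on the integers\<close>

text \<open>The converse of Hoelder's inequality: testing with \<open>g = u^(q-1)\<close>, where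
  \<open>q = r/(r-1)\<close>, gives U <= A U^(1/r) for the sum U on the left. The conclusion stays
  in powers, which is the form that can be summed over blocks.\<close>

lemma fin_norm_dual:
  assumes fin: "finite I" and r: "1 < r" and u: "\<And>x. u x \<ge> 0" and A: "A \<ge> 0"
    and dual: "\<And>g. \<forall>x. g x \<ge> 0 \<Longrightarrow> (\<Sum>x\<in>I. u x * g x) \<le> A * fin_norm r I g"
  shows "(\<Sum>x\<in>I. u x powr (r / (r - 1))) \<le> A powr (r / (r - 1))"
proof -
  define q where "q = r / (r - 1)"
  have q: "q > 0" "(q - 1) * r = q" "(1 - 1 / r) * q = 1" using r by (auto simp: q_def field_simps)
  define U where "U = (\<Sum>x\<in>I. u x powr q)"
  have "U \<ge> 0" unfolding U_def by (intro sum_nonneg) auto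
  have "U = (\<Sum>x\<in>I. u x * u x powr (q - 1))"
    unfolding U_def using u by (intro sum.cong refl) (auto simp: powr_diff less_le[symmetric])
  also have "\<dots> \<le> A * fin_norm r I (\<lambda>x. u x powr (q - 1))" by (intro dual) auto
  also have "\<dots> = A * U powr (1 / r)" by (simp add: fin_norm_def powr_powr q U_def)
  finally have le: "U \<le> A * U powr (1 / r)" .
  have "U \<le> A powr q"
  proof (cases "U = 0")
    case False
    then have "U > 0" using \<open>U \<ge> 0\<close> by simp
    have "U powr (1 - 1 / r) \<le> A" using le \<open>U > 0\<close> by (simp add: powr_diff divide_le_eq)
    then have "(U powr (1 - 1 / r)) powr q \<le> A powr q" using q by (intro powr_mono2) auto
    then show ?thesis using \<open>U > 0\<close> by (simp add: powr_powr q)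
  qed simp
  then show ?thesis by (simp add: U_def q_def)
qed

text \<open>With x = c + y T and n = b + y m one has x - n = c - b + y (T - m), where 0 <= m < M. So
  T - m lies in the block of length \<open>M\<close> containing T or in the one before it, and
  \<open>a\<close> is the start of the latter.\<close>

lemma norm_prime_avg_le:
  fixes f :: "int \<Rightarrow> complex" and x :: int and N y b :: nat
  assumes y: "y \<ge> 1" and b: "1 \<le> b" "b \<le> y"
  defines "M \<equiv> N div y + 1"
  defines "a \<equiv> (x div int y div int M - 1) * int M"
  shows "norm (prime_avg N y b f x) \<le>
    (\<Sum>t\<in>{a..<a + int (2 * M)}. progression_kernel N y b (x div int y - t) * norm (f (x mod int y - int b + int y * t)))"
proof -
  let ?S = "{n. 1 \<le> n \<and> n < N \<and> [n = b] (mod y)}"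
  let ?c = "x mod int y" and ?T = "x div int y" and ?I = "{a..<a + int (2 * M)}"
  define h where "h t = progression_kernel N y b (?T - t) * norm (f (?c - int b + int y * t))" for t
  define m where "m n = (int n - int b) div int y" for n :: nat
  have m: "int n = int b + int y * m n" "0 \<le> m n" "m n < int M" if "n \<in> ?S" for n
  proof -
    have "[int n = int b] (mod int y)" using that by (simp add: cong_int_iff)
    then have dv: "int y dvd int n - int b" by (simp add: cong_iff_dvd_diff)
    then show eq: "int n = int b + int y * m n" by (simp add: m_def)
    have "int y * m n > int y * (-1)" using eq that b by auto
    then have "m n > -1" using y by (subst (asm) mult_less_cancel_left_pos) auto
    then show "0 \<le> m n" by simp
    have "int y * m n < int N" using eq that by auto
    then have "(int y * m n) div int y \<le> int N div int y" using y by (intro zdiv_mono1) auto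
    then show "m n < int M" using y by (simp add: M_def zdiv_int)
  qed
  have finS: "finite ?S" by (rule finite_subset[of _ "{..<N}"]) auto
  have "norm (prime_avg N y b f x) \<le> real (totient y) / real N * (\<Sum>n\<in>?S. mangoldt n * norm (f (x - int n)))"
    unfolding prime_avg_def norm_mult
    by (intro mult_mono order_trans[OF norm_sum sum_mono]) (auto simp: norm_mult norm_divide)
  also have "\<dots> = (\<Sum>n\<in>?S. h (?T - m n))"
    unfolding sum_distrib_left
  proof (intro sum.cong refl)
    fix n assume n: "n \<in> ?S"
    have "x = ?c + int y * ?T" by simp
    then have "x - int n = ?c - int b + int y * (?T - m n)"
      using m(1)[OF n] by (simp add: right_diff_distrib)
    moreover have "progression_kernel N y b (m n) = real (totient y) / real N * mangoldt n"
      using m[OF n] n by (simp add: progression_kernel_def flip: m(1)[OF n])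
    ultimately show "real (totient y) / real N * (mangoldt n * norm (f (x - int n))) = h (?T - m n)"
      by (simp add: h_def)
  qed
  also have "\<dots> = (\<Sum>t\<in>(\<lambda>n. ?T - m n) ` ?S. h t)"
  proof (rule sum.reindex[symmetric, unfolded comp_def])
    show "inj_on (\<lambda>n. ?T - m n) ?S"
    proof (rule inj_onI)
      fix n n' assume "n \<in> ?S" "n' \<in> ?S" "?T - m n = ?T - m n'"
      then have "int n = int n'" using m(1)[of n] m(1)[of n'] by simp
      then show "n = n'" by simp
    qed
  qed
  also have "\<dots> \<le> (\<Sum>t\<in>?I. h t)"
  proof (rule sum_mono2)
    have Mpos: "int M > 0" by (simp add: M_def)
    have T: "?T div int M * int M \<le> ?T" "?T < ?T div int M * int M + int M"
      using div_mult_mod_eq[of ?T "int M"] pos_mod_bound[OF Mpos, of ?T] pos_mod_sign[OF Mpos, of ?T] by linarith+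
    show "(\<lambda>n. ?T - m n) ` ?S \<subseteq> ?I"
    proof (rule image_subsetI)
      fix n assume "n \<in> ?S"
      then show "?T - m n \<in> ?I" using m(2,3)[of n] T by (auto simp: a_def left_diff_distrib)
    qed
  qed (auto simp: h_def progression_kernel_nonneg)
  finally show ?thesis by (simp add: h_def)
qed

lemma finite_support_prime_avg:
  assumes "finite {x. f x \<noteq> 0}"
  shows "finite {x. prime_avg N y b f x \<noteq> 0}"
proof (rule finite_subset)
  show "{x. prime_avg N y b f x \<noteq> 0} \<subseteq> (\<lambda>(z, n). z + int n) ` ({x. f x \<noteq> 0} \<times> {..<N})"
  proof
    fix x assume "x \<in> {x. prime_avg N y b f x \<noteq> 0}"
    then have "(\<Sum>n\<in>{n. 1 \<le> n \<and> n < N \<and> [n = b] (mod y)}. mangoldt n * f (x - int n)) \<noteq> 0"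
      by (auto simp: prime_avg_def)
    then obtain n where "n < N" "f (x - int n) \<noteq> 0" by (metis (no_types, lifting) mem_Collect_eq mult_zero_right sum.not_neutral_contains_not_neutral)
    then show "x \<in> (\<lambda>(z, n). z + int n) ` ({x. f x \<noteq> 0} \<times> {..<N})"
      by (intro image_eqI[of _ _ "(x - int n, n)"]) auto
  qed
qed (use assms in auto)

text \<open>No point is counted twice: after adding \<open>d\<close>, the residue modulo
  \<open>y\<close> gives back \<open>c\<close>, the quotient gives back \<open>t\<close>, and the
  block of \<open>t\<close> gives back \<open>l\<close>. The parameter \<open>e\<close> selects the
  current block (0) or the preceding one (1).\<close>

lemma sum_block_le:
  fixes u :: "int \<Rightarrow> real" and M :: nat and y :: nat and d e :: int
  assumes fin: "finite {z. u z \<noteq> 0}" and u: "\<And>z. u z \<ge> 0" and Ix: "finite Ix"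
    and y: "y \<ge> 1" and M: "M \<ge> 1" and res: "\<And>c l. (c, l) \<in> Ix \<Longrightarrow> 0 \<le> c \<and> c < int y"
  shows "(\<Sum>(c, l)\<in>Ix. \<Sum>t\<in>{(l - e) * int M..<(l - e) * int M + int M}. u (c - d + int y * t)) \<le> (\<Sum>z | u z \<noteq> 0. u z)"
proof -
  define J where "J i = {(snd i - e) * int M..<(snd i - e) * int M + int M}" for i :: "int \<times> int"
  define Z where "Z = Sigma Ix J"
  define h where "h v = fst (fst v) - d + int y * snd v" for v :: "(int \<times> int) \<times> int"
  have finZ: "finite Z" unfolding Z_def using Ix by (intro finite_SigmaI) (auto simp: J_def)
  have inj: "inj_on h Z"
  proof (rule inj_on_inverseI)
    fix v assume v: "v \<in> Z"
    obtain c l t where vv: "v = ((c, l), t)" by (cases v, cases "fst v") auto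
    have c: "0 \<le> c" "c < int y" and t: "(l - e) * int M \<le> t" "t < (l - e) * int M + int M"
      using v res[of c l] by (auto simp: vv Z_def J_def)
    have "(h v + d) mod int y = c" "(h v + d) div int y = t"
      using c y by (auto simp: h_def vv)
    moreover have "t div int M = l - e"
    proof -
      have "t = (l - e) * int M + (t - (l - e) * int M)" by simp
      then have "t div int M = (l - e) + (t - (l - e) * int M) div int M"
        using M by (metis div_mult_self3 add.commute of_nat_0_eq_iff not_one_le_zero)
      moreover have "(t - (l - e) * int M) div int M = 0" using t by (intro div_pos_pos_trivial) auto
      ultimately show ?thesis by simp
    qed
    ultimately show "(\<lambda>z. (((z + d) mod int y, (z + d) div int y div int M + e), (z + d) div int y)) (h v) = v"
      by (simp add: vv)
  qed
  have "(\<Sum>(c, l)\<in>Ix. \<Sum>t\<in>{(l - e) * int M..<(l - e) * int M + int M}. u (c - d + int y * t)) = (\<Sum>v\<in>Z. u (h v))"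
    unfolding Z_def using Ix sum.Sigma[of Ix J "\<lambda>i t. u (h (i, t))"]
    by (simp add: J_def[abs_def] h_def case_prod_unfold)
  also have "\<dots> = (\<Sum>z\<in>h ` Z. u z)" by (rule sum.reindex[OF inj, unfolded comp_def, symmetric])
  also have "\<dots> = (\<Sum>z\<in>h ` Z \<inter> {z. u z \<noteq> 0}. u z)" using finZ by (intro sum.mono_neutral_right) auto
  also have "\<dots> \<le> (\<Sum>z | u z \<noteq> 0. u z)" using fin u by (intro sum_mono2) auto
  finally show ?thesis .
qed

text \<open>The points x are grouped by residue modulo \<open>y\<close> and by the block of their
  quotient. On each group duality turns the local bound into A^q V^(q/r), where V is the mass of
  |f|^r on a window of two blocks. As q/r >= 1, all but one power of V may be replaced by its upper
  bound, and the V add up to at most twice the total mass, each point being in at most two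
  windows.\<close>

lemma prime_avg_power_sum_le:
  fixes f :: "int \<Rightarrow> complex"
  assumes r: "1 < r" "r < 2" and y: "y \<ge> 1" and b: "1 \<le> b" "b \<le> y" and A: "A \<ge> 0"
    and fin: "finite {x. f x \<noteq> 0}"
    and loc: "\<And>(a :: int) u g. \<forall>t. u t \<ge> 0 \<Longrightarrow> \<forall>x. g x \<ge> 0 \<Longrightarrow>
      (\<Sum>x\<in>{a..<a + int (2 * (N div y + 1))}. \<Sum>t\<in>{a..<a + int (2 * (N div y + 1))}.
        progression_kernel N y b (x - t) * u t * g x) \<le>
      A * fin_norm r {a..<a + int (2 * (N div y + 1))} u * fin_norm r {a..<a + int (2 * (N div y + 1))} g"
  defines "q \<equiv> r / (r - 1)"
  shows "(\<Sum>x | prime_avg N y b f x \<noteq> 0. norm (prime_avg N y b f x) powr q) \<le>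
    A powr q * (2 * (\<Sum>x | f x \<noteq> 0. norm (f x) powr r)) powr (q / r)"
proof -
  define M where "M = N div y + 1"
  have M: "M \<ge> 1" by (simp add: M_def)
  have q: "q > 0" "q / r \<ge> 1" using r by (auto simp: q_def field_simps)
  let ?X = "{x. prime_avg N y b f x \<noteq> 0}"
  have finX: "finite ?X" using fin by (rule finite_support_prime_avg)
  define \<tau> where "\<tau> = (\<Sum>x | f x \<noteq> 0. norm (f x) powr r)"
  have \<tau>0: "\<tau> \<ge> 0" unfolding \<tau>_def by (intro sum_nonneg) auto
  define I where "I l = {(l - 1) * int M..<(l - 1) * int M + int (2 * M)}" for l
  define J where "J e l = {(l - e) * int M..<(l - e) * int M + int M}" for e l
  define V where "V c l = (\<Sum>t\<in>I l. norm (f (c - int b + int y * t)) powr r)" for c l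
  define idx where "idx x = (x mod int y, x div int y div int M)" for x
  define Ix where "Ix = idx ` ?X"
  have finIx: "finite Ix" unfolding Ix_def using finX by simp
  have res: "0 \<le> c \<and> c < int y" if "(c, l) \<in> Ix" for c l
    using that y by (auto simp: Ix_def idx_def)
  have V0: "V c l \<ge> 0" for c l unfolding V_def by (intro sum_nonneg) auto
  have supp: "{z. norm (f z) powr r \<noteq> 0} = {z. f z \<noteq> 0}" by auto
  have split: "V c l = (\<Sum>t\<in>J 1 l. norm (f (c - int b + int y * t)) powr r) + (\<Sum>t\<in>J 0 l. norm (f (c - int b + int y * t)) powr r)" for c l
  proof -
    have "I l = J 1 l \<union> J 0 l" by (auto simp: I_def J_def left_diff_distrib)
    moreover have "J 1 l \<inter> J 0 l = {}" by (auto simp: J_def left_diff_distrib)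
    ultimately show ?thesis unfolding V_def by (simp add: sum.union_disjoint J_def)
  qed
  have block: "(\<Sum>(c, l)\<in>Z. \<Sum>t\<in>J e l. norm (f (c - int b + int y * t)) powr r) \<le> \<tau>"
    if "Z \<subseteq> Ix" for Z e
  proof -
    have "finite Z" using finite_subset[OF that finIx] .
    moreover have "0 \<le> c \<and> c < int y" if "(c, l) \<in> Z" for c l using that \<open>Z \<subseteq> Ix\<close> res by blast
    moreover have "finite {z. norm (f z) powr r \<noteq> 0}" unfolding supp by (rule fin)
    ultimately show ?thesis
      unfolding J_def \<tau>_def supp[symmetric] using y M by (intro sum_block_le) auto
  qed
  have Vsum: "(\<Sum>(c, l)\<in>Z. V c l) \<le> 2 * \<tau>" if "Z \<subseteq> Ix" for Z
    using add_mono[OF block[OF that, of 1] block[OF that, of 0]]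
    by (simp add: split case_prod_unfold sum.distrib)
  have classwise: "(\<Sum>x\<in>{x\<in>?X. idx x = (c, l)}. norm (prime_avg N y b f x) powr q) \<le> A powr q * (V c l * (2 * \<tau>) powr (q / r - 1))"
    if i: "(c, l) \<in> Ix" for c l
  proof -
    let ?F = "{x\<in>?X. idx x = (c, l)}"
    define u where "u t = norm (f (c - int b + int y * t))" for t
    define W where "W t = (\<Sum>t'\<in>I l. progression_kernel N y b (t - t') * u t')" for t
    have W0: "W t \<ge> 0" for t unfolding W_def u_def by (intro sum_nonneg mult_nonneg_nonneg progression_kernel_nonneg) auto
    have "(\<Sum>x\<in>?F. norm (prime_avg N y b f x) powr q) \<le> (\<Sum>x\<in>?F. W (x div int y) powr q)"
    proof (intro sum_mono powr_mono2)
      fix x assume "x \<in> ?F"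
      then have x: "x mod int y = c" "x div int y div int M = l" by (auto simp: idx_def)
      show "norm (prime_avg N y b f x) \<le> W (x div int y)"
        using norm_prime_avg_le[OF y b, of N f x] unfolding W_def I_def u_def M_def[symmetric] x .
    qed (use q in auto)
    also have "\<dots> = (\<Sum>t\<in>(\<lambda>x. x div int y) ` ?F. W t powr q)"
    proof (rule sum.reindex[symmetric, unfolded comp_def])
      show "inj_on (\<lambda>x. x div int y) ?F"
      proof (rule inj_onI)
        fix x x' assume "x \<in> ?F" "x' \<in> ?F" "x div int y = x' div int y"
        then have "x mod int y = x' mod int y" "x div int y = x' div int y" by (auto simp: idx_def)
        then show "x = x'" by (metis div_mult_mod_eq)
      qed
    qed
    also have "\<dots> \<le> (\<Sum>t\<in>I l. W t powr q)"
    proof (rule sum_mono2)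
      show "(\<lambda>x. x div int y) ` ?F \<subseteq> I l"
      proof (rule image_subsetI)
        fix x assume "x \<in> ?F"
        then have l: "x div int y div int M = l" by (auto simp: idx_def)
        have Mpos: "int M > 0" using M by simp
        show "x div int y \<in> I l"
          using div_mult_mod_eq[of "x div int y" "int M"] pos_mod_bound[OF Mpos, of "x div int y"]
            pos_mod_sign[OF Mpos, of "x div int y"] unfolding l I_def by (auto simp: left_diff_distrib)
      qed
    qed (auto simp: I_def)
    also have "\<dots> \<le> (A * fin_norm r (I l) u) powr q"
      unfolding q_def
    proof (rule fin_norm_dual)
      fix g :: "int \<Rightarrow> real" assume g: "\<forall>x. g x \<ge> 0"
      have "(\<Sum>x\<in>I l. W x * g x) = (\<Sum>x\<in>I l. \<Sum>t\<in>I l. progression_kernel N y b (x - t) * u t * g x)"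
        by (simp add: W_def sum_distrib_right)
      also have "\<dots> \<le> A * fin_norm r (I l) u * fin_norm r (I l) g"
        unfolding I_def M_def using g by (intro loc) (auto simp: u_def)
      finally show "(\<Sum>x\<in>I l. W x * g x) \<le> A * fin_norm r (I l) u * fin_norm r (I l) g" .
    qed (use r A W0 in \<open>auto simp: I_def\<close>)
    also have "\<dots> = A powr q * V c l powr (q / r)"
      using A by (simp add: powr_mult fin_norm_def V_def u_def powr_powr)
    \<comment> \<open>One factor \<open>V c l\<close> is kept for the summation; this is where q >=
      r, that is r <= 2, is used.\<close>
    also have "V c l powr (q / r) = V c l * V c l powr (q / r - 1)"
      using V0[of c l] by (cases "V c l = 0") (auto simp: powr_diff)
    also have "A powr q * \<dots> \<le> A powr q * (V c l * (2 * \<tau>) powr (q / r - 1))"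
    proof (intro mult_left_mono powr_mono2)
      show "V c l \<le> 2 * \<tau>" using Vsum[of "{(c, l)}"] i by simp
    qed (use V0 q in auto)
    finally show ?thesis .
  qed
  have "(\<Sum>x\<in>?X. norm (prime_avg N y b f x) powr q) =
      (\<Sum>i\<in>Ix. \<Sum>x\<in>{x\<in>?X. idx x = i}. norm (prime_avg N y b f x) powr q)"
    by (rule sum.group[symmetric]) (use finX finIx in \<open>auto simp: Ix_def\<close>)
  also have "\<dots> \<le> (\<Sum>(c, l)\<in>Ix. A powr q * (V c l * (2 * \<tau>) powr (q / r - 1)))"
    using classwise by (intro sum_mono) (auto simp: case_prod_unfold)
  also have "\<dots> = A powr q * (\<Sum>(c, l)\<in>Ix. V c l) * (2 * \<tau>) powr (q / r - 1)"
    by (simp add: sum_distrib_left sum_distrib_right case_prod_unfold mult.assoc)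
  also have "\<dots> \<le> A powr q * (2 * \<tau>) * (2 * \<tau>) powr (q / r - 1)"
    using Vsum[of Ix] by (intro mult_right_mono mult_left_mono) auto
  also have "\<dots> = A powr q * (2 * \<tau>) powr (q / r)"
    using \<tau>0 by (cases "\<tau> = 0") (auto simp: powr_diff)
  finally show ?thesis by (simp add: \<tau>_def)
qed

theorem theorem1p1:
  fixes r :: real
  assumes "1 < r" "r < 2"
  shows "\<exists>C>0. \<forall>\<delta>>0. \<exists>C\<delta>>0. \<forall>y::nat. y \<ge> 1 \<longrightarrow>
           (\<forall>N::nat. real N > exp (C\<delta> * real y powr \<delta>) \<longrightarrow>
             (\<forall>f :: int \<Rightarrow> complex. finite {x. f x \<noteq> 0} \<longrightarrow>
               (\<forall>b::nat. 1 \<le> b \<and> b \<le> y \<and> coprime b y \<longrightarrow>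
                  lp_norm (r / (r - 1)) (prime_avg N y b f)
                    \<le> C * (real y / real N) powr (1 / r - 1 / (r / (r - 1))) * lp_norm r f)))"
proof -
  define q where "q = r / (r - 1)"
  have q: "q > 0" "1 / r - 1 / q = 2 / r - 1" using assms by (auto simp: q_def field_simps)
  \<comment> \<open>The order of the moments has to be an integer, as they are bounded by counting
    tuples of divisors.\<close>
  define s where "s = nat \<lceil>q\<rceil>"
  have s: "r / (r - 1) \<le> real s" unfolding s_def q_def by linarith
  obtain C where C: "C \<ge> 1" and loc:
    "\<And>(y :: nat) N b (a :: int) f g. y \<ge> 1 \<Longrightarrow> y\<^sup>2 \<le> N \<Longrightarrow> 2 ^ (8 * s) \<le> N \<Longrightarrow> b \<ge> 1 \<Longrightarrow>
      (\<forall>t. f t \<ge> 0) \<Longrightarrow> (\<forall>x. g x \<ge> 0) \<Longrightarrow>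
      (\<Sum>x\<in>{a..<a + int (2 * (N div y + 1))}. \<Sum>t\<in>{a..<a + int (2 * (N div y + 1))}.
        progression_kernel N y b (x - t) * f t * g x) \<le>
      C * (real y / real N) powr (2 / r - 1) *
        fin_norm r {a..<a + int (2 * (N div y + 1))} f * fin_norm r {a..<a + int (2 * (N div y + 1))} g"
    using that by (rule progression_local_bound[OF assms s])
  show ?thesis
  \<comment> \<open>The 2 bounds 2^(1/r), the price of windows that overlap twice. The constant
    \<open>C\<close> is fixed before \<delta>.\<close>
  proof (rule exI[of _ "2 * C"], intro conjI allI impI)
    show "2 * C > 0" using C by simp
    fix \<delta> :: real assume \<delta>: "\<delta> > 0"
    show "\<exists>C\<delta>>0. \<forall>y::nat. y \<ge> 1 \<longrightarrow>
           (\<forall>N::nat. real N > exp (C\<delta> * real y powr \<delta>) \<longrightarrow>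
             (\<forall>f :: int \<Rightarrow> complex. finite {x. f x \<noteq> 0} \<longrightarrow>
               (\<forall>b::nat. 1 \<le> b \<and> b \<le> y \<and> coprime b y \<longrightarrow>
                  lp_norm (r / (r - 1)) (prime_avg N y b f)
                    \<le> 2 * C * (real y / real N) powr (1 / r - 1 / (r / (r - 1))) * lp_norm r f)))"
    \<comment> \<open>The first summand gives y^2 <= N through ln y <= y^\<delta>/\<delta>, the
      second gives 2^(8 s) <= N since y^\<delta> >= 1.\<close>
    proof (intro exI[of _ "2 / \<delta> + 8 * real s"] conjI allI impI)
      show "2 / \<delta> + 8 * real s > 0" using \<delta> by (intro add_pos_nonneg) auto
      fix y N b :: nat and f :: "int \<Rightarrow> complex"
      assume y: "y \<ge> 1" and N: "real N > exp ((2 / \<delta> + 8 * real s) * real y powr \<delta>)"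
        and fin: "finite {x. f x \<noteq> 0}" and b: "1 \<le> b \<and> b \<le> y \<and> coprime b y"
      have y1: "real y powr \<delta> \<ge> 1" using y \<delta> by (intro ge_one_powr_ge_zero) auto
      have "ln (real y) \<le> real y powr \<delta> / \<delta>" using y \<delta> by (intro ln_powr_bound) auto
      then have "2 * ln (real y) \<le> 2 / \<delta> * real y powr \<delta>" by simp
      also have "\<dots> \<le> (2 / \<delta> + 8 * real s) * real y powr \<delta>" by (intro mult_right_mono) auto
      finally have "exp (2 * ln (real y)) \<le> exp ((2 / \<delta> + 8 * real s) * real y powr \<delta>)" by simp
      also have "exp (2 * ln (real y)) = (real y)\<^sup>2" using y by (simp add: exp_double)
      finally have "real (y\<^sup>2) \<le> real N" unfolding of_nat_power using N by linarith
      then have yN: "y\<^sup>2 \<le> N" by (simp only: of_nat_le_iff)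
      have "real (2 ^ (8 * s)) = 2 ^ (8 * s)" by simp
      also have "\<dots> \<le> exp 1 ^ (8 * s)" using exp_ge_add_one_self[of 1] by (intro power_mono) auto
      also have "\<dots> = exp (8 * real s * 1)" by (simp flip: exp_of_nat_mult)
      also have "\<dots> \<le> exp ((2 / \<delta> + 8 * real s) * real y powr \<delta>)"
        using y1 \<delta> by (subst exp_le_cancel_iff, intro mult_mono) auto
      finally have "real (2 ^ (8 * s)) \<le> real N" using N by linarith
      then have N2: "2 ^ (8 * s) \<le> N" by (simp only: of_nat_le_iff)
      define A where "A = C * (real y / real N) powr (2 / r - 1)"
      have A: "A \<ge> 0" using C by (simp add: A_def)
      define \<tau> where "\<tau> = (\<Sum>x | f x \<noteq> 0. norm (f x) powr r)"
      have \<tau>: "\<tau> \<ge> 0" unfolding \<tau>_def by (intro sum_nonneg) auto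
      have "(\<Sum>x | prime_avg N y b f x \<noteq> 0. norm (prime_avg N y b f x) powr (r / (r - 1))) \<le>
          A powr (r / (r - 1)) * (2 * \<tau>) powr (r / (r - 1) / r)"
        unfolding \<tau>_def
      proof (rule prime_avg_power_sum_le[OF assms y])
        fix a :: int and u g :: "int \<Rightarrow> real" assume "\<forall>t. 0 \<le> u t" "\<forall>x. 0 \<le> g x"
        then show "(\<Sum>x\<in>{a..<a + int (2 * (N div y + 1))}. \<Sum>t\<in>{a..<a + int (2 * (N div y + 1))}.
            progression_kernel N y b (x - t) * u t * g x) \<le>
            A * fin_norm r {a..<a + int (2 * (N div y + 1))} u * fin_norm r {a..<a + int (2 * (N div y + 1))} g"
          unfolding A_def using b by (intro loc y yN N2) auto
      qed (use b A fin in auto)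
      then have "lp_norm q (prime_avg N y b f) \<le> (A powr q * (2 * \<tau>) powr (q / r)) powr (1 / q)"
        unfolding lp_norm_def q_def[symmetric] using q by (intro powr_mono2) (auto intro: sum_nonneg)
      also have "\<dots> = A * (2 * \<tau>) powr (1 / r)"
        using q(1) A by (simp add: powr_mult powr_powr)
      also have "\<dots> = A * (2 powr (1 / r) * \<tau> powr (1 / r))" using \<tau> by (simp add: powr_mult)
      also have "\<dots> \<le> A * (2 * \<tau> powr (1 / r))"
        using A assms powr_mono[of "1 / r" 1 "2::real"] by (intro mult_left_mono mult_right_mono) auto
      also have "\<dots> = 2 * C * (real y / real N) powr (1 / r - 1 / q) * lp_norm r f"
        unfolding q(2) by (simp add: A_def \<tau>_def lp_norm_def)
      finally show "lp_norm (r / (r - 1)) (prime_avg N y b f)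
          \<le> 2 * C * (real y / real N) powr (1 / r - 1 / (r / (r - 1))) * lp_norm r f"
        by (simp only: q_def)
    qed
  qed
qed

end
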